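(* Consider a sequence of instances of the data model below indexed by $n\to\infty$ (with $d,\Sigma,w^*$ allowed to depend on $n$, $\sigma$ fixed), and let $\hat w$ be a minimal $\ell_1$ norm interpolator. Suppose there is a sequence of covariance splittings $\Sigma=\Sigma_1\oplus\Sigma_2$ with $\Sigma_2\ne0$ diagonal such that, with $H\sim N(0,I_d)$: (1) $\operatorname{rank}(\Sigma_1)/n\to0$; (2) $n/r_1(\Sigma_2)\to0$; (3) $\|w^*\|_1\,\mathbb{E}\|\Sigma_2^{1/2}H\|_\infty/\sqrt n\to0$. Then $L(\hat w)\to\sigma^2$ in probability.
   Context: Data model: $d \ge n$; $\Sigma \in \mathbb{R}^{d\times d}$ positive semidefinite; $w^* \in \mathbb{R}^d$ arbitrary; $\sigma\ge0$. $X \in \mathbb{R}^{n\times d}$ has i.i.d. rows $X_i\sim N(0,\Sigma)$, $\xi\sim N(0,\sigma^2I_n)$ independent of $X$, $Y=Xw^*+\xi$. $L(w)=\sigma^2+\|w-w^*\|_\Sigma^2$, $\|x\|_A^2:=\langle x,Ax\rangle$. $\hat w\in\arg\min\{\|w\|_1:Xw=Y\}$. Covariance splitting: $\Sigma=\Sigma_1\oplus\Sigma_2$ means $\Sigma=\Sigma_1+\Sigma_2$, both positive semidefinite, with orthogonal column spaces. $r_1(A)=\left(\mathbb{E}\|A^{1/2}H\|_\infty\right)^2/\max_iA_{ii}$. *)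

theory Defs
  imports "HOL-Probability.Probability"
begin

text \<open>Conventions: a d-vector is a function nat => real (only indices < d matter),
a d x d matrix is a function nat => nat => real (only indices < d matter).\<close>

definition psd :: "nat \<Rightarrow> (nat \<Rightarrow> nat \<Rightarrow> real) \<Rightarrow> bool" where
  "psd d A \<longleftrightarrow> (\<forall>i<d. \<forall>j<d. A i j = A j i) \<and>
     (\<forall>x::nat \<Rightarrow> real. (\<Sum>i<d. \<Sum>j<d. x i * A i j * x j) \<ge> 0)"

definition cols_indep :: "nat \<Rightarrow> (nat \<Rightarrow> nat \<Rightarrow> real) \<Rightarrow> nat set \<Rightarrow> bool" where
  "cols_indep d A J \<longleftrightarrow> J \<subseteq> {..<d} \<and>
     (\<forall>c::nat \<Rightarrow> real. (\<forall>i<d. (\<Sum>j\<in>J. c j * A i j) = 0) \<longrightarrow> (\<forall>j\<in>J. c j = 0))"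

definition mrank :: "nat \<Rightarrow> (nat \<Rightarrow> nat \<Rightarrow> real) \<Rightarrow> nat" where
  "mrank d A = Max (card ` {J. cols_indep d A J})"

definition cov_split :: "nat \<Rightarrow> (nat \<Rightarrow> nat \<Rightarrow> real) \<Rightarrow> (nat \<Rightarrow> nat \<Rightarrow> real)
    \<Rightarrow> (nat \<Rightarrow> nat \<Rightarrow> real) \<Rightarrow> bool" where
  "cov_split d S S1 S2 \<longleftrightarrow> psd d S1 \<and> psd d S2 \<and>
     (\<forall>i<d. \<forall>j<d. S i j = S1 i j + S2 i j) \<and>
     (\<forall>i<d. \<forall>j<d. (\<Sum>k<d. S1 k i * S2 k j) = 0)"

definition is_diag :: "nat \<Rightarrow> (nat \<Rightarrow> nat \<Rightarrow> real) \<Rightarrow> bool" where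
  "is_diag d A \<longleftrightarrow> (\<forall>i<d. \<forall>j<d. i \<noteq> j \<longrightarrow> A i j = 0)"

definition is_zero_mat :: "nat \<Rightarrow> (nat \<Rightarrow> nat \<Rightarrow> real) \<Rightarrow> bool" where
  "is_zero_mat d A \<longleftrightarrow> (\<forall>i<d. \<forall>j<d. A i j = 0)"

definition std_gauss :: "nat \<Rightarrow> (nat \<Rightarrow> real) measure" where
  "std_gauss d = PiM {..<d} (\<lambda>_. std_normal_distribution)"

text \<open>For a diagonal PSD matrix A, A^(1/2) H has coordinates sqrt(A_jj) H_j;
this is E || A^(1/2) H ||_infty.\<close>
definition diag_gauss_sup :: "nat \<Rightarrow> (nat \<Rightarrow> nat \<Rightarrow> real) \<Rightarrow> real" where
  "diag_gauss_sup d A =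
     (\<integral>h. Max (insert 0 ((\<lambda>j. \<bar>sqrt (A j j) * h j\<bar>) ` {..<d})) \<partial>std_gauss d)"

definition r1_diag :: "nat \<Rightarrow> (nat \<Rightarrow> nat \<Rightarrow> real) \<Rightarrow> real" where
  "r1_diag d A = (diag_gauss_sup d A)\<^sup>2 / Max ((\<lambda>i. A i i) ` {..<d})"

definition l1norm :: "nat \<Rightarrow> (nat \<Rightarrow> real) \<Rightarrow> real" where
  "l1norm d w = (\<Sum>j<d. \<bar>w j\<bar>)"

definition interpolators :: "nat \<Rightarrow> nat \<Rightarrow> (nat \<Rightarrow> nat \<Rightarrow> real) \<Rightarrow> (nat \<Rightarrow> real)
    \<Rightarrow> (nat \<Rightarrow> real) set" where
  "interpolators n d X Y = {w. (\<forall>j. d \<le> j \<longrightarrow> w j = 0) \<and>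
      (\<forall>i<n. (\<Sum>j<d. X i j * w j) = Y i)}"

definition min_l1_interpolators :: "nat \<Rightarrow> nat \<Rightarrow> (nat \<Rightarrow> nat \<Rightarrow> real) \<Rightarrow> (nat \<Rightarrow> real)
    \<Rightarrow> (nat \<Rightarrow> real) set" where
  "min_l1_interpolators n d X Y = {w \<in> interpolators n d X Y.
      \<forall>v \<in> interpolators n d X Y. l1norm d w \<le> l1norm d v}"

definition risk :: "nat \<Rightarrow> real \<Rightarrow> (nat \<Rightarrow> nat \<Rightarrow> real) \<Rightarrow> (nat \<Rightarrow> real) \<Rightarrow> (nat \<Rightarrow> real) \<Rightarrow> real" where
  "risk d \<sigma> S wstar w = \<sigma>\<^sup>2 +
     (\<Sum>i<d. \<Sum>j<d. (w i - wstar i) * S i j * (w j - wstar j))"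

definition sample_space :: "nat \<Rightarrow> nat \<Rightarrow> ((nat \<times> nat \<Rightarrow> real) \<times> (nat \<Rightarrow> real)) measure" where
  "sample_space n d = PiM ({..<n} \<times> {..<d}) (\<lambda>_. std_normal_distribution)
      \<Otimes>\<^sub>M PiM {..<n} (\<lambda>_. std_normal_distribution)"

text \<open>Design matrix X with i.i.d. rows X_i = B g_i ~ N(0, B B^T), where B B^T = Sigma.\<close>
definition design :: "nat \<Rightarrow> (nat \<Rightarrow> nat \<Rightarrow> real) \<Rightarrow> (nat \<times> nat \<Rightarrow> real) \<Rightarrow> nat \<Rightarrow> nat \<Rightarrow> real" where
  "design d B G = (\<lambda>i j. \<Sum>k<d. B j k * G (i, k))"

definition response :: "nat \<Rightarrow> real \<Rightarrow> (nat \<Rightarrow> nat \<Rightarrow> real) \<Rightarrow> (nat \<Rightarrow> real)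
    \<Rightarrow> (nat \<times> nat \<Rightarrow> real) \<times> (nat \<Rightarrow> real) \<Rightarrow> nat \<Rightarrow> real" where
  "response d \<sigma> B wstar \<omega> = (\<lambda>i. (\<Sum>j<d. design d B (fst \<omega>) i j * wstar j) + \<sigma> * snd \<omega> i)"

end

(* In this regime the effective rank of Sigma2 exceeds n by more than any constant factor, so
  Dvoretzky's theorem holds by a net argument: writing E for the expected sup norm of Sigma2^(1/2) H,
  every column of the Sigma2-part of the design has norm at most about E, and every vector of norm E
  in R^n is within a small multiple of E of some column up to sign. As the coordinates of
  Sigma2^(1/2) H are independent, the concentration needed for the net follows from the union bound,
  the product formula and the decay of the one-dimensional tails. Hence every y = X2 v for some v
  supported on the Sigma2-coordinates with |v|_1 at most about |y| / E. Applied to the noise xi this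
  bounds the l1 norm of the minimizer w, and for the error D = w - w* it shows that |X2 D|, being at
  most about E |D|_1, is at most |xi| + o(sqrt n). Since X1 D + X2 D = xi, where X1 has rank o(n)
  and is independent of xi, X1 D must be o(sqrt n), and then D has small Sigma1-norm because a
  Gaussian matrix with few columns is well conditioned. The Sigma2-norm of D is at most
  max(Sigma2)^(1/2) |D|_1, which is small as |D|_1 = O(sqrt n / E). *)

theory Submission
  imports Defs
begin

section \<open>Gaussian product measures\<close>

text \<open>Consistency needs the factor one, not just some constant, in |X2 D| <= (1 + o(1)) |sigma
  xi| + o(sqrt n): only then does expanding |sigma xi - X1 D|^2 cancel |sigma xi|^2 and leave |X1
  D|^2 <= o(n) + 2 <sigma xi, X1 D>. Hence Dvoretzky's theorem is needed with relative error h for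
  arbitrarily small h. The cross term is harmless because X1 D = W theta for an n x r Gaussian
  matrix W independent of xi, so that |W^T xi|^2 has mean r n. Concentration of the supremum is read
  off the tail sum, the expected number of coordinates exceeding t. The value of E forces the tail
  sum to be at least 1 at (1 - delta) E and bounded at (1 + delta) E; moving by another delta E
  changes it by a factor exp(c E^2 / L), with L the largest entry of Sigma2. This beats the
  cardinality K^n of a net once E^2 / L, the effective rank, is a large multiple of n. Everything
  rests on the fact that orthonormal functionals of a Gaussian vector are independent standard
  normals, derived here from translation invariance of Lebesgue measure. One parameter h governs all
  approximations and is fixed before n grows.\<close>

abbreviation gauss :: "'i set \<Rightarrow> ('i \<Rightarrow> real) measure" where
  "gauss I \<equiv> PiM I (\<lambda>_. std_normal_distribution)"

definition inner_on :: "'i set \<Rightarrow> ('i \<Rightarrow> real) \<Rightarrow> ('i \<Rightarrow> real) \<Rightarrow> real" where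
  "inner_on I a x = (\<Sum>i\<in>I. a i * x i)"

interpretation std_normal: prob_space std_normal_distribution
  by (rule prob_space_normal_density) simp

lemma prob_space_gauss: "prob_space (gauss I)"
  by (intro prob_space_PiM std_normal.prob_space_axioms)

lemma sets_gauss [measurable_cong]: "sets (gauss I) = sets (PiM I (\<lambda>_. borel))"
  by (intro sets_PiM_cong) auto

lemma inner_on_measurable [measurable]: "inner_on I a \<in> borel_measurable (PiM I (\<lambda>_. borel))"
  unfolding inner_on_def[abs_def] by measurable

lemma inner_on_measurable_gauss [measurable]: "inner_on I a \<in> borel_measurable (gauss I)"
  by (subst measurable_cong_sets[OF sets_gauss refl]) measurable

text \<open>Lets Gaussian integrals be computed against Lebesgue measure, where translations
  preserve integrals. It suffices to compare both sides on boxes, where the indicator and the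
  density both factor over the coordinates.\<close>

lemma PiM_density:
  fixes f :: "'a \<Rightarrow> ennreal"
  assumes I: "finite I" and M: "sigma_finite_measure M" and D: "sigma_finite_measure (density M f)"
    and f[measurable]: "f \<in> borel_measurable M"
  shows "PiM I (\<lambda>_. density M f) = density (PiM I (\<lambda>_. M)) (\<lambda>x. \<Prod>i\<in>I. f (x i))"
proof -
  interpret M: product_sigma_finite "\<lambda>_. M" by (simp add: product_sigma_finite_def M)
  interpret D: product_sigma_finite "\<lambda>_. density M f" by (simp add: product_sigma_finite_def D)
  have s: "sets (PiM I (\<lambda>_. M)) = sets (PiM I (\<lambda>_. density M f))"
    by (rule sets_PiM_cong) auto
  show ?thesis
  proof (rule D.PiM_eqI[OF I, symmetric])
    show "sets (density (PiM I (\<lambda>_. M)) (\<lambda>x. \<Prod>i\<in>I. f (x i))) = sets (PiM I (\<lambda>_. density M f))"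
      using s by simp
  next
    fix A assume A: "\<And>i. i \<in> I \<Longrightarrow> A i \<in> sets (density M f)"
    then have A': "\<And>i. i \<in> I \<Longrightarrow> A i \<in> sets M" by simp
    have "emeasure (density (PiM I (\<lambda>_. M)) (\<lambda>x. \<Prod>i\<in>I. f (x i))) (Pi\<^sub>E I A)
      = (\<integral>\<^sup>+x. (\<Prod>i\<in>I. f (x i)) * indicator (Pi\<^sub>E I A) x \<partial>PiM I (\<lambda>_. M))"
      by (rule emeasure_density) (use A' I in \<open>auto intro!: sets_PiM_I_finite\<close>)
    also have "\<dots> = (\<integral>\<^sup>+x. (\<Prod>i\<in>I. f (x i) * indicator (A i) (x i)) \<partial>PiM I (\<lambda>_. M))"
    proof (rule nn_integral_cong)
      fix x assume "x \<in> space (PiM I (\<lambda>_. M))"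
      then have "x \<in> extensional I" by (auto simp: space_PiM PiE_def)
      then have "indicator (Pi\<^sub>E I A) x = (\<Prod>i\<in>I. indicator (A i) (x i) :: ennreal)"
        using I by (auto simp: indicator_def PiE_def Pi_def prod.If_cases split: if_splits)
      then show "(\<Prod>i\<in>I. f (x i)) * indicator (Pi\<^sub>E I A) x = (\<Prod>i\<in>I. f (x i) * indicator (A i) (x i))"
        by (simp add: prod.distrib)
    qed
    also have "\<dots> = (\<Prod>i\<in>I. \<integral>\<^sup>+x. f x * indicator (A i) x \<partial>M)"
      by (rule M.product_nn_integral_prod) (use I A' in auto)
    also have "\<dots> = (\<Prod>i\<in>I. emeasure (density M f) (A i))"
      using A' by (intro prod.cong) (auto simp: emeasure_density)
    finally show "emeasure (density (PiM I (\<lambda>_. M)) (\<lambda>x. \<Prod>i\<in>I. f (x i))) (Pi\<^sub>E I A)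
      = (\<Prod>i\<in>I. emeasure (density M f) (A i))" .
  qed
qed

lemma nn_integral_lborel_shift:
  fixes f :: "real \<Rightarrow> ennreal"
  assumes [measurable]: "f \<in> borel_measurable borel"
  shows "(\<integral>\<^sup>+x. f (x + c) \<partial>lborel) = (\<integral>\<^sup>+x. f x \<partial>lborel)"
  using nn_integral_real_affine[of f 1 c] by (simp add: add.commute)

lemma distr_PiM_lborel_shift:
  fixes b :: "'i \<Rightarrow> real"
  assumes I: "finite I"
  shows "distr (PiM I (\<lambda>_. lborel)) (PiM I (\<lambda>_. lborel)) (\<lambda>x. \<lambda>i\<in>I. x i + b i) = PiM I (\<lambda>_. lborel :: real measure)"
proof -
  interpret L: product_sigma_finite "\<lambda>_. lborel :: real measure"
    by (simp add: product_sigma_finite_def lborel.sigma_finite_measure_axioms)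
  show ?thesis
  proof (rule L.PiM_eqI[OF I])
    fix A :: "'i \<Rightarrow> real set" assume A: "\<And>i. i \<in> I \<Longrightarrow> A i \<in> sets lborel"
    have "emeasure (distr (PiM I (\<lambda>_. lborel)) (PiM I (\<lambda>_. lborel)) (\<lambda>x. \<lambda>i\<in>I. x i + b i)) (Pi\<^sub>E I A)
      = emeasure (PiM I (\<lambda>_. lborel)) ((\<lambda>x. \<lambda>i\<in>I. x i + b i) -` Pi\<^sub>E I A \<inter> space (PiM I (\<lambda>_. lborel)))"
      by (rule emeasure_distr) (use I A in \<open>auto intro!: sets_PiM_I_finite\<close>)
    also have "(\<lambda>x. \<lambda>i\<in>I. x i + b i) -` Pi\<^sub>E I A \<inter> space (PiM I (\<lambda>_. lborel)) = Pi\<^sub>E I (\<lambda>i. (\<lambda>x. x + b i) -` A i)"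
      by (auto simp: space_PiM PiE_def Pi_def)
    also have "emeasure (PiM I (\<lambda>_. lborel)) \<dots> = (\<Prod>i\<in>I. emeasure lborel ((\<lambda>x. x + b i) -` A i))"
    proof (rule L.emeasure_PiM[OF I])
      fix i assume "i \<in> I"
      then have [measurable]: "A i \<in> sets borel" using A by simp
      have "(\<lambda>x. x + b i) -` A i \<inter> space borel \<in> sets borel" by measurable
      then show "(\<lambda>x. x + b i) -` A i \<in> sets lborel" by simp
    qed
    also have "\<dots> = (\<Prod>i\<in>I. emeasure lborel (A i))"
    proof (rule prod.cong[OF refl])
      fix i assume "i \<in> I"
      then have m[measurable]: "A i \<in> sets borel" using A by simp
      have "emeasure lborel (A i) = emeasure (distr lborel borel ((+) (b i))) (A i)"
        by (simp add: lborel_distr_plus)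
      also have "\<dots> = emeasure lborel ((\<lambda>x. x + b i) -` A i)"
        by (subst emeasure_distr) (auto simp: add.commute[of "b i"] intro!: arg_cong[where f="emeasure lborel"])
      finally show "emeasure lborel ((\<lambda>x. x + b i) -` A i) = emeasure lborel (A i)" by simp
    qed
    finally show "emeasure (distr (PiM I (\<lambda>_. lborel)) (PiM I (\<lambda>_. lborel)) (\<lambda>x. \<lambda>i\<in>I. x i + b i)) (Pi\<^sub>E I A)
      = (\<Prod>i\<in>I. emeasure lborel (A i))" .
  qed simp
qed

lemma nn_integral_PiM_lborel_shift:
  fixes b :: "'i \<Rightarrow> real"
  assumes I: "finite I" and [measurable]: "f \<in> borel_measurable (PiM I (\<lambda>_. lborel :: real measure))"
  shows "(\<integral>\<^sup>+x. f (\<lambda>i\<in>I. x i + b i) \<partial>PiM I (\<lambda>_. lborel)) = (\<integral>\<^sup>+x. f x \<partial>PiM I (\<lambda>_. lborel))"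
  by (subst (2) distr_PiM_lborel_shift[OF I, of b, symmetric], subst nn_integral_distr) simp_all

lemma nn_integral_gauss:
  assumes I: "finite I" and [measurable]: "f \<in> borel_measurable (PiM I (\<lambda>_. borel))"
  shows "(\<integral>\<^sup>+x. f x \<partial>gauss I) =
    (\<integral>\<^sup>+x. (\<Prod>i\<in>I. ennreal (std_normal_density (x i))) * f x \<partial>PiM I (\<lambda>_. lborel :: real measure))"
proof -
  have "gauss I = density (PiM I (\<lambda>_. lborel)) (\<lambda>x. \<Prod>i\<in>I. ennreal (std_normal_density (x i)))"
    by (rule PiM_density[OF I]) (auto intro: lborel.sigma_finite_measure_axioms std_normal.sigma_finite_measure_axioms)
  moreover have "f \<in> borel_measurable (PiM I (\<lambda>_. lborel))"
    using assms(2) by (subst measurable_cong_sets[OF sets_PiM_cong[OF refl] refl]) auto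
  ultimately show ?thesis
    by (simp add: nn_integral_density)
qed

lemma prod_std_normal_density:
  assumes "finite I"
  shows "(\<Prod>i\<in>I. ennreal (std_normal_density (x i)))
    = ennreal ((1 / sqrt (2 * pi)) ^ card I * exp (- inner_on I x x / 2))"
  using assms
  by (simp add: prod_ennreal std_normal_density_def prod.distrib exp_sum[symmetric] inner_on_def
      sum_negf sum_divide_distrib power2_eq_square prod_dividef power_divide flip: prod_constant)

section \<open>Rotation invariance\<close>

text \<open>The restriction to \<open>I\<close> keeps the translate in the space of the product
  measure, which consists of extensional functions.\<close>

definition shift_on :: "'i set \<Rightarrow> real \<Rightarrow> ('i \<Rightarrow> real) \<Rightarrow> ('i \<Rightarrow> real) \<Rightarrow> 'i \<Rightarrow> real" where
  "shift_on I c a x = (\<lambda>i\<in>I. x i + c * a i)"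

lemma inner_on_shift_on:
  "inner_on I b (shift_on I c a x) = inner_on I b x + c * inner_on I b a"
  by (simp add: inner_on_def shift_on_def sum.distrib sum_distrib_left algebra_simps)

lemma inner_on_commute: "inner_on I a b = inner_on I b a"
  by (simp add: inner_on_def mult.commute)

lemma inner_on_shift_on_self:
  "inner_on I (shift_on I c a x) (shift_on I c a x) = inner_on I x x + 2 * c * inner_on I a x + c\<^sup>2 * inner_on I a a"
proof -
  have "inner_on I (shift_on I c a x) (shift_on I c a x)
     = inner_on I (shift_on I c a x) x + c * inner_on I (shift_on I c a x) a"
    by (rule inner_on_shift_on)
  also have "\<dots> = inner_on I x (shift_on I c a x) + c * inner_on I a (shift_on I c a x)"
    by (simp add: inner_on_commute)
  finally show ?thesis
    by (simp add: inner_on_shift_on power2_eq_square algebra_simps inner_on_commute[of I x a])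
qed

lemma shift_on_measurable [measurable]:
  assumes [measurable]: "f \<in> borel_measurable M" "g \<in> measurable M (PiM I (\<lambda>_. borel))"
  shows "(\<lambda>x. shift_on I (f x) a (g x)) \<in> measurable M (PiM I (\<lambda>_. borel))"
  unfolding shift_on_def by measurable

context
  fixes I :: "'i set"
  assumes I: "finite I"
begin

interpretation L: product_sigma_finite "\<lambda>_::'i. lborel :: real measure"
  by (simp add: product_sigma_finite_def lborel.sigma_finite_measure_axioms)

interpretation LI: sigma_finite_measure "PiM I (\<lambda>_::'i. lborel :: real measure)"
  by (rule L.sigma_finite[OF I])

interpretation LP: pair_sigma_finite "PiM I (\<lambda>_::'i. lborel :: real measure)" "lborel :: real measure"
  by standard

lemma sets_PiM_lborel: "sets (PiM I (\<lambda>_. lborel :: real measure)) = sets (PiM I (\<lambda>_. borel))"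
  by (rule sets_PiM_cong) auto

lemma nn_integral_shear_scalar:
  fixes H :: "('i \<Rightarrow> real) \<Rightarrow> real \<Rightarrow> ennreal"
  assumes [measurable]: "(\<lambda>(x, y). H x y) \<in> borel_measurable (PiM I (\<lambda>_. borel) \<Otimes>\<^sub>M borel)"
  shows "(\<integral>\<^sup>+x. \<integral>\<^sup>+y. H x (y + c x) \<partial>lborel \<partial>PiM I (\<lambda>_. lborel))
    = (\<integral>\<^sup>+x. \<integral>\<^sup>+y. H x y \<partial>lborel \<partial>PiM I (\<lambda>_. lborel :: real measure))"
proof (rule nn_integral_cong)
  fix x :: "'i \<Rightarrow> real" assume x: "x \<in> space (PiM I (\<lambda>_. lborel))"
  then have "x \<in> space (PiM I (\<lambda>_. borel))" by (simp add: space_PiM)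
  then have "H x \<in> borel_measurable borel"
    using measurable_Pair2[OF assms] by simp
  then show "(\<integral>\<^sup>+y. H x (y + c x) \<partial>lborel) = (\<integral>\<^sup>+y. H x y \<partial>lborel)"
    by (rule nn_integral_lborel_shift)
qed

text \<open>Once the integrals are exchanged, \<open>y\<close> is fixed and the shear is a plain
  translation of \<open>x\<close>.\<close>

lemma nn_integral_shear_vector:
  fixes H :: "('i \<Rightarrow> real) \<Rightarrow> real \<Rightarrow> ennreal"
  assumes H: "(\<lambda>(x, y). H x y) \<in> borel_measurable (PiM I (\<lambda>_. borel) \<Otimes>\<^sub>M borel)"
  shows "(\<integral>\<^sup>+x. \<integral>\<^sup>+y. H (shift_on I y a x) y \<partial>lborel \<partial>PiM I (\<lambda>_. lborel))
    = (\<integral>\<^sup>+x. \<integral>\<^sup>+y. H x y \<partial>lborel \<partial>PiM I (\<lambda>_. lborel :: real measure))"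
proof -
  have sp: "sets (PiM I (\<lambda>_. lborel :: real measure) \<Otimes>\<^sub>M (lborel :: real measure)) = sets (PiM I (\<lambda>_. borel) \<Otimes>\<^sub>M borel)"
    by (intro sets_pair_measure_cong sets_PiM_lborel) simp
  note [measurable] = H
  have 1: "(\<lambda>(x, y). H x y) \<in> borel_measurable (PiM I (\<lambda>_. lborel) \<Otimes>\<^sub>M lborel)"
    by (subst measurable_cong_sets[OF sp refl]) (rule H)
  have 2: "(\<lambda>(x, y). H (shift_on I y a x) y) \<in> borel_measurable (PiM I (\<lambda>_. lborel) \<Otimes>\<^sub>M lborel)"
    by (subst measurable_cong_sets[OF sp refl]) measurable
  have "(\<integral>\<^sup>+x. \<integral>\<^sup>+y. H (shift_on I y a x) y \<partial>lborel \<partial>PiM I (\<lambda>_. lborel))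
     = (\<integral>\<^sup>+y. \<integral>\<^sup>+x. H (shift_on I y a x) y \<partial>PiM I (\<lambda>_. lborel) \<partial>lborel)"
    using LP.Fubini'[OF 2] by simp
  also have "\<dots> = (\<integral>\<^sup>+y. \<integral>\<^sup>+x. H x y \<partial>PiM I (\<lambda>_. lborel) \<partial>lborel)"
  proof (rule nn_integral_cong)
    fix y :: real
    have "(\<lambda>x. H x y) \<in> borel_measurable (PiM I (\<lambda>_. lborel))"
      by (subst measurable_cong_sets[OF sets_PiM_lborel refl]) measurable
    from nn_integral_PiM_lborel_shift[OF I this, of "\<lambda>i. y * a i"]
    show "(\<integral>\<^sup>+x. H (shift_on I y a x) y \<partial>PiM I (\<lambda>_. lborel)) = (\<integral>\<^sup>+x. H x y \<partial>PiM I (\<lambda>_. lborel))"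
      by (simp add: shift_on_def)
  qed
  also have "\<dots> = (\<integral>\<^sup>+x. \<integral>\<^sup>+y. H x y \<partial>lborel \<partial>PiM I (\<lambda>_. lborel))"
    using LP.Fubini'[OF 1] by simp
  finally show ?thesis .
qed

text \<open>The reflection exchanging the directions \<open>(a, 0)\<close> and \<open>(0, -1)\<close> is a product of three shears.\<close>

lemma nn_integral_reflection:
  fixes H :: "('i \<Rightarrow> real) \<Rightarrow> real \<Rightarrow> ennreal"
  assumes [measurable]: "(\<lambda>(x, y). H x y) \<in> borel_measurable (PiM I (\<lambda>_. borel) \<Otimes>\<^sub>M borel)"
    and a: "inner_on I a a = 1"
  shows "(\<integral>\<^sup>+x. \<integral>\<^sup>+y. H (shift_on I (y - inner_on I a x) a x) (- inner_on I a x) \<partial>lborel \<partial>PiM I (\<lambda>_. lborel))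
    = (\<integral>\<^sup>+x. \<integral>\<^sup>+y. H x y \<partial>lborel \<partial>PiM I (\<lambda>_. lborel :: real measure))"
proof -
  \<comment> \<open>In the coordinates \<open>s = inner_on I a x\<close> and \<open>y\<close>, the
    three shears compose to \<open>(s, y) -> (y, - s)\<close>; the part of \<open>x\<close>
    orthogonal to \<open>a\<close> stays fixed.\<close>
  have "(\<integral>\<^sup>+x. \<integral>\<^sup>+y. H x y \<partial>lborel \<partial>PiM I (\<lambda>_. lborel :: real measure))
     = (\<integral>\<^sup>+x. \<integral>\<^sup>+y. H x (y + (- inner_on I a x)) \<partial>lborel \<partial>PiM I (\<lambda>_. lborel))"
    by (rule nn_integral_shear_scalar[symmetric]) measurable
  also have "\<dots> = (\<integral>\<^sup>+x. \<integral>\<^sup>+y. H (shift_on I y a x) (y + (- inner_on I a (shift_on I y a x))) \<partial>lborel \<partial>PiM I (\<lambda>_. lborel))"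
    by (rule nn_integral_shear_vector[symmetric]) measurable
  also have "\<dots> = (\<integral>\<^sup>+x. \<integral>\<^sup>+y. H (shift_on I y a x) (- inner_on I a x) \<partial>lborel \<partial>PiM I (\<lambda>_. lborel))"
    by (simp add: inner_on_shift_on a)
  also have "\<dots> = (\<integral>\<^sup>+x. \<integral>\<^sup>+y. H (shift_on I (y + (- inner_on I a x)) a x) (- inner_on I a x) \<partial>lborel \<partial>PiM I (\<lambda>_. lborel))"
    by (rule nn_integral_shear_scalar[symmetric]) measurable
  finally show ?thesis by simp
qed

text \<open>An independent scalar Gaussian \<open>y\<close> is adjoined and turned into the
  direction \<open>a\<close>. The joint density depends only on
  \<open>inner_on I x x + y\<^sup>2\<close> and is unchanged, \<open>f y\<close> becomes
  \<open>f (inner_on I a x)\<close>, and \<open>K\<close> is insensitive to the accompanying move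
  along \<open>a\<close>.\<close>

lemma nn_integral_gauss_split:
  fixes K :: "('i \<Rightarrow> real) \<Rightarrow> ennreal"
  assumes f[measurable]: "f \<in> borel_measurable borel"
    and K[measurable]: "K \<in> borel_measurable (PiM I (\<lambda>_. borel))"
    and inv: "\<And>c x. x \<in> extensional I \<Longrightarrow> K (shift_on I c a x) = K x"
    and a: "inner_on I a a = 1"
  shows "(\<integral>\<^sup>+x. f (inner_on I a x) * K x \<partial>gauss I) = (\<integral>\<^sup>+y. f y \<partial>std_normal_distribution) * (\<integral>\<^sup>+x. K x \<partial>gauss I)"
proof -
  \<comment> \<open>The map of \<open>nn_integral_reflection\<close> puts a negated inner product
    into the scalar slot; starting from \<open>- a\<close> makes it
    \<open>inner_on I a x\<close>.\<close>
  define a' where "a' = (\<lambda>i. - a i)"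
  have a'[simp]: "inner_on I a' x = - inner_on I a x" for x
    by (simp add: a'_def inner_on_def sum_negf)
  have a'1: "inner_on I a' a' = 1"
    using a by (simp add: inner_on_def a'_def)
  have inv': "K (shift_on I c a' x) = K x" if "x \<in> extensional I" for c x
    using inv[OF that, of "- c"] by (simp add: shift_on_def a'_def)
  define C where "C = (1 / sqrt (2 * pi)) ^ card I"
  define D where "D x y = ennreal (C * (1 / sqrt (2 * pi)) * exp (- (inner_on I x x + y\<^sup>2) / 2))" for x :: "'i \<Rightarrow> real" and y
  have C0: "C \<ge> 0" by (simp add: C_def)
  have Dq[measurable]: "(\<lambda>x. inner_on I x x) \<in> borel_measurable (PiM I (\<lambda>_. borel))"
    unfolding inner_on_def by measurable
  have Deq: "ennreal (C * exp (- inner_on I x x / 2)) * ennreal (std_normal_density y) = D x y" for x :: "'i \<Rightarrow> real" and y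
    unfolding D_def using C0
    by (subst ennreal_mult[symmetric]) (auto simp: std_normal_density_def mult_exp_exp add_divide_distrib diff_divide_distrib)
  have gi: "(\<integral>\<^sup>+x. g x \<partial>gauss I) = (\<integral>\<^sup>+x. ennreal (C * exp (- inner_on I x x / 2)) * g x \<partial>PiM I (\<lambda>_. lborel))"
    if "g \<in> borel_measurable (PiM I (\<lambda>_. borel))" for g
    using nn_integral_gauss[OF I that] prod_std_normal_density[OF I] by (simp add: C_def)
  have gy: "(\<integral>\<^sup>+y. g y \<partial>std_normal_distribution) = (\<integral>\<^sup>+y. ennreal (std_normal_density y) * g y \<partial>lborel)"
    if "g \<in> borel_measurable borel" for g
    by (rule nn_integral_density) (use that in auto)
  define H where "H x y = D x y * (f y * K x)" for x y
  have Hm[measurable]: "(\<lambda>(x, y). H x y) \<in> borel_measurable (PiM I (\<lambda>_. borel) \<Otimes>\<^sub>M borel)"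
    unfolding H_def D_def by measurable
  have "(\<integral>\<^sup>+y. f y \<partial>std_normal_distribution) * (\<integral>\<^sup>+x. K x \<partial>gauss I)
    = (\<integral>\<^sup>+x. \<integral>\<^sup>+y. f y * K x \<partial>std_normal_distribution \<partial>gauss I)"
    by (subst nn_integral_multc) (auto simp: nn_integral_cmult)
  also have "\<dots> = (\<integral>\<^sup>+x. (\<integral>\<^sup>+y. H x y \<partial>lborel) \<partial>PiM I (\<lambda>_. lborel))"
    by (subst gi, simp, subst gy)
       (auto simp: H_def Deq[symmetric] nn_integral_cmult[symmetric] mult.assoc simp del: mult_exp_exp
         intro!: nn_integral_cong)
  also have "\<dots> = (\<integral>\<^sup>+x. \<integral>\<^sup>+y. H (shift_on I (y - inner_on I a' x) a' x) (- inner_on I a' x) \<partial>lborel \<partial>PiM I (\<lambda>_. lborel))"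
    by (rule nn_integral_reflection[symmetric, OF Hm a'1])
  also have "\<dots> = (\<integral>\<^sup>+x. \<integral>\<^sup>+y. D x y * (f (inner_on I a x) * K x) \<partial>lborel \<partial>PiM I (\<lambda>_. lborel))"
  proof (intro nn_integral_cong)
    fix x :: "'i \<Rightarrow> real" and y assume "x \<in> space (PiM I (\<lambda>_. lborel :: real measure))"
    then have x: "x \<in> extensional I" by (auto simp: space_PiM PiE_def)
    have "D (shift_on I (y - inner_on I a' x) a' x) (- inner_on I a' x) = D x y"
      unfolding D_def inner_on_shift_on_self using a'1 by (simp add: power2_eq_square algebra_simps)
    then show "H (shift_on I (y - inner_on I a' x) a' x) (- inner_on I a' x) = D x y * (f (inner_on I a x) * K x)"
      unfolding H_def using inv'[OF x] by simp
  qed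
  also have "\<dots> = (\<integral>\<^sup>+x. \<integral>\<^sup>+y. f (inner_on I a x) * K x \<partial>std_normal_distribution \<partial>gauss I)"
    by (subst gi, simp, subst gy)
       (auto simp: Deq[symmetric] nn_integral_cmult[symmetric] mult.assoc simp del: mult_exp_exp
         intro!: nn_integral_cong)
  also have "\<dots> = (\<integral>\<^sup>+x. f (inner_on I a x) * K x \<partial>gauss I)"
    by (simp add: std_normal.emeasure_space_1[simplified])
  finally show ?thesis by simp
qed

text \<open>Independence and standard normality of orthonormal functionals in one formula. By
  orthogonality the factors for the other indices are invariant under moves along
  \<open>a k\<close>, so \<open>nn_integral_gauss_split\<close> peels off one factor at a
  time.\<close>

lemma nn_integral_gauss_orthonormal:
  assumes J: "finite J"
    and f: "\<And>j. j \<in> J \<Longrightarrow> f j \<in> borel_measurable borel"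
    and a: "\<And>j k. j \<in> J \<Longrightarrow> k \<in> J \<Longrightarrow> inner_on I (a j) (a k) = (if j = k then 1 else 0)"
  shows "(\<integral>\<^sup>+x. (\<Prod>j\<in>J. f j (inner_on I (a j) x)) \<partial>gauss I) = (\<Prod>j\<in>J. \<integral>\<^sup>+y. f j y \<partial>std_normal_distribution)"
  using J f a
proof (induction J)
  case empty
  then show ?case using prob_space.emeasure_space_1[OF prob_space_gauss, of I] by simp
next
  case (insert k J)
  note [measurable] = insert.prems(1)
  have "(\<integral>\<^sup>+x. f k (inner_on I (a k) x) * (\<Prod>j\<in>J. f j (inner_on I (a j) x)) \<partial>gauss I)
    = (\<integral>\<^sup>+y. f k y \<partial>std_normal_distribution) * (\<integral>\<^sup>+x. (\<Prod>j\<in>J. f j (inner_on I (a j) x)) \<partial>gauss I)"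
  proof (rule nn_integral_gauss_split)
    show "(\<lambda>x. \<Prod>j\<in>J. f j (inner_on I (a j) x)) \<in> borel_measurable (PiM I (\<lambda>_. borel))"
      by measurable
    show "(\<Prod>j\<in>J. f j (inner_on I (a j) (shift_on I c (a k) x))) = (\<Prod>j\<in>J. f j (inner_on I (a j) x))" for c x
    proof (rule prod.cong[OF refl])
      fix j assume j: "j \<in> J"
      then have "inner_on I (a j) (a k) = 0" using insert by auto
      then show "f j (inner_on I (a j) (shift_on I c (a k) x)) = f j (inner_on I (a j) x)"
        by (simp add: inner_on_shift_on)
    qed
  qed (use insert in auto)
  then show ?case using insert by simp
qed

end

section \<open>One-dimensional Gaussian tails\<close>

lemma nn_integral_std_normal_eq:
  "f \<in> borel_measurable borel \<Longrightarrow>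
    (\<integral>\<^sup>+y. f y \<partial>std_normal_distribution) = (\<integral>\<^sup>+y. ennreal (std_normal_density y) * f y \<partial>lborel)"
  by (rule nn_integral_density) auto

text \<open>Both tails are translated back to the origin, where the normal density picks up the
  factor \<open>exp (- x\<^sup>2 / 2) * exp (- x * \<bar>z\<bar>)\<close>. The two translated
  half-lines together cover the line up to the null point 0.\<close>

lemma nn_integral_std_normal_excess:
  fixes f :: "real \<Rightarrow> ennreal"
  assumes [measurable]: "f \<in> borel_measurable borel" and x: "x \<ge> 0"
  shows "(\<integral>\<^sup>+z. f (\<bar>z\<bar> - x) * indicator {z. x < \<bar>z\<bar>} z \<partial>std_normal_distribution)
    = ennreal (exp (- x\<^sup>2 / 2)) * (\<integral>\<^sup>+z. f \<bar>z\<bar> * ennreal (exp (- x * \<bar>z\<bar>)) \<partial>std_normal_distribution)"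
proof -
  let ?\<phi> = "\<lambda>z. ennreal (std_normal_density z)"
  have "(\<integral>\<^sup>+z. f (\<bar>z\<bar> - x) * indicator {z. x < \<bar>z\<bar>} z \<partial>std_normal_distribution)
     = (\<integral>\<^sup>+z. ?\<phi> z * (f (z - x) * indicator {x<..} z) + ?\<phi> z * (f (- z - x) * indicator {..<-x} z) \<partial>lborel)"
    using x by (subst nn_integral_std_normal_eq, measurable)
       (auto intro!: nn_integral_cong split: split_indicator simp: abs_if)
  also have "\<dots> = (\<integral>\<^sup>+z. ?\<phi> z * (f (z - x) * indicator {x<..} z) \<partial>lborel)
      + (\<integral>\<^sup>+z. ?\<phi> z * (f (- z - x) * indicator {..<-x} z) \<partial>lborel)"
    by (rule nn_integral_add) auto
  also have "(\<integral>\<^sup>+z. ?\<phi> z * (f (z - x) * indicator {x<..} z) \<partial>lborel)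
      = (\<integral>\<^sup>+z. ?\<phi> (z + x) * (f (z + x - x) * indicator {x<..} (z + x)) \<partial>lborel)"
    by (rule nn_integral_lborel_shift[symmetric]) measurable
  also have "(\<integral>\<^sup>+z. ?\<phi> z * (f (- z - x) * indicator {..<-x} z) \<partial>lborel)
      = (\<integral>\<^sup>+z. ?\<phi> (z + - x) * (f (- (z + - x) - x) * indicator {..<-x} (z + - x)) \<partial>lborel)"
    by (rule nn_integral_lborel_shift[symmetric]) measurable
  also have "(\<integral>\<^sup>+z. ?\<phi> (z + x) * (f (z + x - x) * indicator {x<..} (z + x)) \<partial>lborel) + \<dots>
    = (\<integral>\<^sup>+z. ?\<phi> (z + x) * (f (z + x - x) * indicator {x<..} (z + x))
       + ?\<phi> (z + - x) * (f (- (z + - x) - x) * indicator {..<-x} (z + - x)) \<partial>lborel)"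
    by (rule nn_integral_add[symmetric]) auto
  also have "\<dots> = (\<integral>\<^sup>+z. ennreal (exp (- x\<^sup>2 / 2)) * (?\<phi> z * (f \<bar>z\<bar> * ennreal (exp (- x * \<bar>z\<bar>)))) \<partial>lborel)"
  proof (rule nn_integral_cong_AE, use AE_lborel_singleton[of 0] in eventually_elim)
    fix z :: real assume "z \<noteq> 0"
    then consider "z > 0" | "z < 0" by linarith
    then show "?\<phi> (z + x) * (f (z + x - x) * indicator {x<..} (z + x))
       + ?\<phi> (z + - x) * (f (- (z + - x) - x) * indicator {..<-x} (z + - x))
       = ennreal (exp (- x\<^sup>2 / 2)) * (?\<phi> z * (f \<bar>z\<bar> * ennreal (exp (- x * \<bar>z\<bar>))))"
    proof cases
      case 1
      have "std_normal_density (z + x) = exp (- x\<^sup>2 / 2) * (std_normal_density z * exp (- x * \<bar>z\<bar>))"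
        using 1 by (simp add: std_normal_density_def mult_exp_exp field_simps power2_eq_square)
      then have "?\<phi> (z + x) = ennreal (exp (- x\<^sup>2 / 2)) * (?\<phi> z * ennreal (exp (- x * \<bar>z\<bar>)))"
        by (simp add: ennreal_mult'')
      then show ?thesis using 1 by (simp add: mult_ac)
    next
      case 2
      have "std_normal_density (z + - x) = exp (- x\<^sup>2 / 2) * (std_normal_density z * exp (- x * \<bar>z\<bar>))"
        using 2 by (simp add: std_normal_density_def mult_exp_exp field_simps power2_eq_square)
      then have "?\<phi> (z + - x) = ennreal (exp (- x\<^sup>2 / 2)) * (?\<phi> z * ennreal (exp (- x * \<bar>z\<bar>)))"
        by (simp add: ennreal_mult'')
      then show ?thesis using 2 by (simp add: mult_ac)
    qed
  qed
  also have "\<dots> = ennreal (exp (- x\<^sup>2 / 2)) * (\<integral>\<^sup>+z. f \<bar>z\<bar> * ennreal (exp (- x * \<bar>z\<bar>)) \<partial>std_normal_distribution)"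
    by (subst nn_integral_cmult, measurable, subst nn_integral_std_normal_eq, measurable)
  finally show ?thesis .
qed

text \<open>Two-sided tail of a centred normal variable of variance \<open>l\<close>. The strict
  inequality makes it 0 for \<open>l = 0\<close>, so vanishing diagonal entries contribute nothing
  to tail sums.\<close>

definition gtail :: "real \<Rightarrow> real \<Rightarrow> real" where
  "gtail l t = measure std_normal_distribution {z. t < sqrt l * \<bar>z\<bar>}"

lemma gtail_nonneg: "gtail l t \<ge> 0"
  by (simp add: gtail_def)

lemma gtail_le_1: "gtail l t \<le> 1"
  by (simp add: gtail_def)

lemma gtail_0: "t \<ge> 0 \<Longrightarrow> gtail 0 t = 0"
  by (simp add: gtail_def)

lemma gtail_eq:
  assumes "l > 0" "t \<ge> 0"
  shows "ennreal (gtail l t) = ennreal (exp (- (t / sqrt l)\<^sup>2 / 2))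
    * (\<integral>\<^sup>+z. ennreal (exp (- (t / sqrt l) * \<bar>z\<bar>)) \<partial>std_normal_distribution)"
proof -
  have "{z. t < sqrt l * \<bar>z\<bar>} = {z. t / sqrt l < \<bar>z\<bar>}"
    using assms by (auto simp: field_simps)
  then have "ennreal (gtail l t) = (\<integral>\<^sup>+z. 1 * indicator {z. t / sqrt l < \<bar>z\<bar>} z \<partial>std_normal_distribution)"
    by (simp add: gtail_def std_normal.emeasure_eq_measure)
  also have "\<dots> = ennreal (exp (- (t / sqrt l)\<^sup>2 / 2))
    * (\<integral>\<^sup>+z. 1 * ennreal (exp (- (t / sqrt l) * \<bar>z\<bar>)) \<partial>std_normal_distribution)"
    by (rule nn_integral_std_normal_excess) (use assms in auto)
  finally show ?thesis by simp
qed

text \<open>By \<open>gtail_eq\<close> with \<open>x = t / sqrt l\<close> and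
  \<open>y = t' / sqrt l\<close>, the prefactors have quotient at most
  \<open>exp (- (x * (y - x)))\<close>, and the remaining integral decreases in the threshold.
  Weakening \<open>l\<close> to \<open>L\<close> makes the rate common to all coordinates, so the
  estimate passes to sums.\<close>

lemma gtail_decay:
  assumes l: "0 \<le> l" "l \<le> L" and L: "L > 0" and t: "0 \<le> t" "t \<le> t'"
  shows "gtail l t' \<le> exp (- (t * (t' - t) / L)) * gtail l t"
proof (cases "l = 0")
  case True
  then show ?thesis using t by (simp add: gtail_0)
next
  case False
  with l have l0: "l > 0" by simp
  define x y where "x = t / sqrt l" and "y = t' / sqrt l"
  have xy: "0 \<le> x" "x \<le> y" using t l0 by (auto simp: x_def y_def divide_right_mono)
  have "x * (y - x) = t * (t' - t) / l"
    using l0 by (simp add: x_def y_def field_simps)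
  also have "\<dots> \<ge> t * (t' - t) / L"
    using l0 l t by (intro divide_left_mono) auto
  finally have e: "exp (- (x * (y - x))) \<le> exp (- (t * (t' - t) / L))" by simp
  have "ennreal (gtail l t') = ennreal (exp (- y\<^sup>2 / 2)) * (\<integral>\<^sup>+z. ennreal (exp (- y * \<bar>z\<bar>)) \<partial>std_normal_distribution)"
    using gtail_eq[OF l0, of t'] t by (simp add: y_def)
  also have "\<dots> \<le> ennreal (exp (- (x * (y - x))) * exp (- x\<^sup>2 / 2)) * (\<integral>\<^sup>+z. ennreal (exp (- x * \<bar>z\<bar>)) \<partial>std_normal_distribution)"
  proof (rule mult_mono)
    have "- y\<^sup>2 / 2 = - (x * (y - x)) + - x\<^sup>2 / 2 - (y - x)\<^sup>2 / 2"
      by (simp add: power2_eq_square field_simps)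
    then have "- y\<^sup>2 / 2 \<le> - (x * (y - x)) + - x\<^sup>2 / 2" by (simp del: power2_eq_iff)
    then show "ennreal (exp (- y\<^sup>2 / 2)) \<le> ennreal (exp (- (x * (y - x))) * exp (- x\<^sup>2 / 2))"
      by (simp only: mult_exp_exp) (intro ennreal_leI, simp)
    show "(\<integral>\<^sup>+z. ennreal (exp (- y * \<bar>z\<bar>)) \<partial>std_normal_distribution) \<le> (\<integral>\<^sup>+z. ennreal (exp (- x * \<bar>z\<bar>)) \<partial>std_normal_distribution)"
      by (intro nn_integral_mono ennreal_leI) (use xy in \<open>auto intro: mult_right_mono\<close>)
  qed auto
  also have "\<dots> = ennreal (exp (- (x * (y - x)))) * ennreal (gtail l t)"
    using gtail_eq[OF l0 t(1)] by (simp add: x_def ennreal_mult'' mult_ac)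
  finally have "gtail l t' \<le> exp (- (x * (y - x))) * gtail l t"
    by (simp add: ennreal_mult''[symmetric] gtail_nonneg flip: ennreal_mult)
  also have "\<dots> \<le> exp (- (t * (t' - t) / L)) * gtail l t"
    using e gtail_nonneg by (intro mult_right_mono) auto
  finally show ?thesis .
qed

lemma nn_integral_std_normal_square: "(\<integral>\<^sup>+z. ennreal (z\<^sup>2) \<partial>std_normal_distribution) = 1"
  using std_normal_distribution_even_moments[of 1]
  by (subst nn_integral_eq_integral) (auto simp: fact_numeral)

lemma nn_integral_std_normal_abs: "(\<integral>\<^sup>+z. ennreal \<bar>z\<bar> \<partial>std_normal_distribution) \<le> 1"
proof -
  have "(\<integral>\<^sup>+z. ennreal \<bar>z\<bar> \<partial>std_normal_distribution)
    \<le> (\<integral>\<^sup>+z. ennreal (1/2) * ennreal (z\<^sup>2) + ennreal (1/2) \<partial>std_normal_distribution)"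
  proof (rule nn_integral_mono)
    fix z :: real
    have "\<bar>z\<bar> \<le> 1/2 * z\<^sup>2 + 1/2"
      using zero_le_power2[of "\<bar>z\<bar> - 1"] by (simp add: power2_eq_square algebra_simps)
    then have "ennreal \<bar>z\<bar> \<le> ennreal (1/2 * z\<^sup>2 + 1/2)" by (rule ennreal_leI)
    also have "ennreal (1/2 * z\<^sup>2 + 1/2) = ennreal (1/2) * ennreal (z\<^sup>2) + ennreal (1/2)"
      by (subst ennreal_plus, simp, simp, subst ennreal_mult', simp, rule refl)
    finally show "ennreal \<bar>z\<bar> \<le> ennreal (1/2) * ennreal (z\<^sup>2) + ennreal (1/2)" .
  qed
  also have "\<dots> = ennreal (1/2) * 1 + ennreal (1/2)"
    by (subst nn_integral_add, simp, simp, subst nn_integral_cmult, simp)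
      (simp add: nn_integral_std_normal_square std_normal.emeasure_space_1[simplified])
  also have "\<dots> = ennreal (1/2 + 1/2)"
    by (subst mult_1_right, subst ennreal_plus) auto
  also have "\<dots> = 1" by simp
  finally show ?thesis .
qed

text \<open>After the excess is shifted to the origin, the claim is that the mean of
  \<open>\<bar>z\<bar> * exp (- x * \<bar>z\<bar>)\<close> is at most the mean of
  \<open>exp (- x * \<bar>z\<bar>)\<close>. This is a negative correlation inequality combined with
  the bound 1 on the mean of \<open>\<bar>z\<bar>\<close>.\<close>

lemma nn_integral_excess_le_gtail:
  assumes l: "l \<ge> 0" and t: "t \<ge> 0"
  shows "(\<integral>\<^sup>+z. ennreal (sqrt l * \<bar>z\<bar> - t) \<partial>std_normal_distribution) \<le> ennreal (sqrt l * gtail l t)"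
proof (cases "l = 0")
  case True
  then show ?thesis using t by (simp add: ennreal_neg)
next
  case False
  with l have l0: "l > 0" by simp
  define x where "x = t / sqrt l"
  have x: "x \<ge> 0" using t l0 by (simp add: x_def)
  let ?I = "\<lambda>f. (\<integral>\<^sup>+z. f z \<partial>std_normal_distribution)"
  have "?I (\<lambda>z. ennreal (\<bar>z\<bar> * exp (- x * \<bar>z\<bar>))) + ennreal (exp (- x))
    = ?I (\<lambda>z. ennreal (\<bar>z\<bar> * exp (- x * \<bar>z\<bar>)) + ennreal (exp (- x)))"
    by (subst nn_integral_add) (auto simp: std_normal.emeasure_space_1[simplified])
  also have "\<dots> \<le> ?I (\<lambda>z. ennreal (exp (- x * \<bar>z\<bar>)) + ennreal (exp (- x)) * ennreal \<bar>z\<bar>)"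
  proof (rule nn_integral_mono)
    fix z :: real
    \<comment> \<open>The factors \<open>\<bar>z\<bar> - 1\<close> and
      \<open>exp (- x * \<bar>z\<bar>) - exp (- x)\<close> never have the same sign.\<close>
    have "(\<bar>z\<bar> - 1) * exp (- x * \<bar>z\<bar>) \<le> (\<bar>z\<bar> - 1) * exp (- x)"
    proof (cases "\<bar>z\<bar> \<ge> 1")
      case True
      then show ?thesis using x mult_left_mono[of 1 "\<bar>z\<bar>" x] by (intro mult_left_mono) auto
    next
      case False
      then show ?thesis using x mult_left_mono[of "\<bar>z\<bar>" 1 x] by (intro mult_left_mono_neg) auto
    qed
    then have "\<bar>z\<bar> * exp (- x * \<bar>z\<bar>) + exp (- x) \<le> exp (- x * \<bar>z\<bar>) + exp (- x) * \<bar>z\<bar>"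
      by (simp add: algebra_simps)
    then show "ennreal (\<bar>z\<bar> * exp (- x * \<bar>z\<bar>)) + ennreal (exp (- x))
      \<le> ennreal (exp (- x * \<bar>z\<bar>)) + ennreal (exp (- x)) * ennreal \<bar>z\<bar>"
      by (simp add: ennreal_mult[symmetric] flip: ennreal_plus)
  qed
  also have "\<dots> = ?I (\<lambda>z. ennreal (exp (- x * \<bar>z\<bar>))) + ennreal (exp (- x)) * ?I (\<lambda>z. ennreal \<bar>z\<bar>)"
    by (subst nn_integral_add, simp, simp, subst nn_integral_cmult, simp, simp)
  also have "\<dots> \<le> ?I (\<lambda>z. ennreal (exp (- x * \<bar>z\<bar>))) + ennreal (exp (- x)) * 1"
    by (intro add_left_mono mult_left_mono nn_integral_std_normal_abs) simp
  finally have *: "?I (\<lambda>z. ennreal (\<bar>z\<bar> * exp (- x * \<bar>z\<bar>))) \<le> ?I (\<lambda>z. ennreal (exp (- x * \<bar>z\<bar>)))"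
    by (simp add: ennreal_add_left_cancel_le add.commute[of _ "ennreal (exp (- x))"])
  have "?I (\<lambda>z. ennreal (sqrt l * \<bar>z\<bar> - t)) = ?I (\<lambda>z. ennreal (sqrt l) * (ennreal (\<bar>z\<bar> - x) * indicator {z. x < \<bar>z\<bar>} z))"
  proof (rule nn_integral_cong)
    fix z :: real
    have "sqrt l * \<bar>z\<bar> - t = sqrt l * (\<bar>z\<bar> - x)" using l0 by (simp add: x_def algebra_simps)
    then show "ennreal (sqrt l * \<bar>z\<bar> - t) = ennreal (sqrt l) * (ennreal (\<bar>z\<bar> - x) * indicator {z. x < \<bar>z\<bar>} z)"
      using l0 by (auto simp: ennreal_mult' ennreal_neg split: split_indicator)
  qed
  also have "\<dots> = ennreal (sqrt l) * ?I (\<lambda>z. ennreal (\<bar>z\<bar> - x) * indicator {z. x < \<bar>z\<bar>} z)"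
    by (rule nn_integral_cmult) simp
  also have "?I (\<lambda>z. ennreal (\<bar>z\<bar> - x) * indicator {z. x < \<bar>z\<bar>} z)
    = ennreal (exp (- x\<^sup>2 / 2)) * ?I (\<lambda>z. ennreal \<bar>z\<bar> * ennreal (exp (- x * \<bar>z\<bar>)))"
    by (rule nn_integral_std_normal_excess) (use x in auto)
  also have "\<dots> \<le> ennreal (exp (- x\<^sup>2 / 2)) * ?I (\<lambda>z. ennreal (exp (- x * \<bar>z\<bar>)))"
    using * by (intro mult_left_mono) (auto simp: ennreal_mult)
  also have "\<dots> = ennreal (gtail l t)"
    using gtail_eq[OF l0 t] by (simp add: x_def)
  finally show ?thesis
    using l0 by (simp add: ennreal_mult' gtail_nonneg mult_left_mono)
qed

section \<open>Concentration of the supremum\<close>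

context
  fixes I :: "'i set" and J :: "'j set" and a :: "'j \<Rightarrow> 'i \<Rightarrow> real" and l :: "'j \<Rightarrow> real"
  assumes I: "finite I" and J: "finite J"
    and a: "\<And>j k. j \<in> J \<Longrightarrow> k \<in> J \<Longrightarrow> inner_on I (a j) (a k) = (if j = k then 1 else 0)"
begin

text \<open>Independence gives a product of factors \<open>1 - gtail (l j) t\<close>, each at most
  \<open>exp (- gtail (l j) t)\<close>. So a large tail sum makes an exceedance nearly certain,
  while by \<open>gauss_some_large\<close> a small one makes it unlikely.\<close>

lemma gauss_all_small:
  "measure (gauss I) {x \<in> space (gauss I). \<forall>j\<in>J. sqrt (l j) * \<bar>inner_on I (a j) x\<bar> \<le> t} \<le> exp (- (\<Sum>j\<in>J. gtail (l j) t))"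
proof -
  interpret G: prob_space "gauss I" by (rule prob_space_gauss)
  let ?A = "{x \<in> space (gauss I). \<forall>j\<in>J. sqrt (l j) * \<bar>inner_on I (a j) x\<bar> \<le> t}"
  let ?f = "\<lambda>j z. indicator {z. sqrt (l j) * \<bar>z\<bar> \<le> t} z :: ennreal"
  have A: "?A \<in> sets (gauss I)" using J by measurable
  have "ennreal (measure (gauss I) ?A) = (\<integral>\<^sup>+x. indicator ?A x \<partial>gauss I)"
    using A by (simp add: G.emeasure_eq_measure)
  also have "\<dots> = (\<integral>\<^sup>+x. (\<Prod>j\<in>J. ?f j (inner_on I (a j) x)) \<partial>gauss I)"
  proof (rule nn_integral_cong)
    fix x assume "x \<in> space (gauss I)"
    then show "(indicator ?A x :: ennreal) = (\<Prod>j\<in>J. ?f j (inner_on I (a j) x))"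
      using J by (auto simp: indicator_def prod.If_cases)
  qed
  also have "\<dots> = (\<Prod>j\<in>J. \<integral>\<^sup>+z. ?f j z \<partial>std_normal_distribution)"
    by (rule nn_integral_gauss_orthonormal[OF I J _ a]) auto
  also have "\<dots> = (\<Prod>j\<in>J. ennreal (1 - gtail (l j) t))"
  proof (rule prod.cong[OF refl])
    fix j assume "j \<in> J"
    have "measure std_normal_distribution (space std_normal_distribution - {z. t < sqrt (l j) * \<bar>z\<bar>}) = 1 - gtail (l j) t"
      unfolding gtail_def by (rule std_normal.prob_compl) simp
    also have "space std_normal_distribution - {z. t < sqrt (l j) * \<bar>z\<bar>} = {z. sqrt (l j) * \<bar>z\<bar> \<le> t}"
      by auto
    finally show "(\<integral>\<^sup>+z. ?f j z \<partial>std_normal_distribution) = ennreal (1 - gtail (l j) t)"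
      by (simp add: std_normal.emeasure_eq_measure)
  qed
  also have "\<dots> = ennreal (\<Prod>j\<in>J. 1 - gtail (l j) t)"
    by (rule prod_ennreal) (simp add: gtail_le_1)
  finally have "measure (gauss I) ?A = (\<Prod>j\<in>J. 1 - gtail (l j) t)"
    by (simp add: prod_nonneg gtail_le_1)
  also have "\<dots> \<le> (\<Prod>j\<in>J. exp (- gtail (l j) t))"
  proof (rule prod_mono)
    fix j assume "j \<in> J"
    show "0 \<le> 1 - gtail (l j) t \<and> 1 - gtail (l j) t \<le> exp (- gtail (l j) t)"
      using gtail_le_1[of "l j" t] exp_ge_add_one_self[of "- gtail (l j) t"] by simp
  qed
  also have "\<dots> = exp (- (\<Sum>j\<in>J. gtail (l j) t))"
    using J by (simp add: exp_sum sum_negf[symmetric])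
  finally show ?thesis .
qed

lemma nn_integral_gauss_unit:
  assumes j: "j \<in> J" and f: "f \<in> borel_measurable borel"
  shows "(\<integral>\<^sup>+x. f (inner_on I (a j) x) \<partial>gauss I) = (\<integral>\<^sup>+z. f z \<partial>std_normal_distribution)"
  using nn_integral_gauss_orthonormal[OF I, of "{j}" "\<lambda>_. f" a] a[OF j j] f by simp

lemma gauss_some_large:
  "measure (gauss I) {x \<in> space (gauss I). \<exists>j\<in>J. t < sqrt (l j) * \<bar>inner_on I (a j) x\<bar>} \<le> (\<Sum>j\<in>J. gtail (l j) t)"
proof -
  interpret G: prob_space "gauss I" by (rule prob_space_gauss)
  have U: "{x \<in> space (gauss I). \<exists>j\<in>J. t < sqrt (l j) * \<bar>inner_on I (a j) x\<bar>}
    = (\<Union>j\<in>J. {x \<in> space (gauss I). t < sqrt (l j) * \<bar>inner_on I (a j) x\<bar>})" by blast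
  have "measure (gauss I) {x \<in> space (gauss I). \<exists>j\<in>J. t < sqrt (l j) * \<bar>inner_on I (a j) x\<bar>}
    \<le> (\<Sum>j\<in>J. measure (gauss I) {x \<in> space (gauss I). t < sqrt (l j) * \<bar>inner_on I (a j) x\<bar>})"
    unfolding U by (rule G.finite_measure_subadditive_finite[OF J]) auto
  also have "\<dots> = (\<Sum>j\<in>J. gtail (l j) t)"
  proof (rule sum.cong[OF refl])
    fix j assume j: "j \<in> J"
    let ?A = "{x \<in> space (gauss I). t < sqrt (l j) * \<bar>inner_on I (a j) x\<bar>}"
    have A: "?A \<in> sets (gauss I)" by measurable
    have "ennreal (measure (gauss I) ?A) = (\<integral>\<^sup>+x. indicator ?A x \<partial>gauss I)"
      by (simp only: nn_integral_indicator[OF A] G.emeasure_eq_measure)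
    also have "\<dots> = (\<integral>\<^sup>+x. indicator {z. t < sqrt (l j) * \<bar>z\<bar>} (inner_on I (a j) x) \<partial>gauss I)"
      by (rule nn_integral_cong) (simp add: indicator_def)
    also have "\<dots> = (\<integral>\<^sup>+z. indicator {z. t < sqrt (l j) * \<bar>z\<bar>} z \<partial>std_normal_distribution)"
      by (rule nn_integral_gauss_unit[OF j]) simp
    also have "\<dots> = gtail (l j) t"
      by (simp add: gtail_def std_normal.emeasure_eq_measure)
    finally show "measure (gauss I) ?A = gtail (l j) t" by (simp add: gtail_nonneg)
  qed
  finally show ?thesis .
qed

end

section \<open>Expected supremum of independent Gaussian coordinates against the tail sum\<close>

lemma inner_on_unit: "finite I \<Longrightarrow> i \<in> I \<Longrightarrow> inner_on I (\<lambda>k. if k = i then 1 else 0) x = x i"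
  by (simp add: inner_on_def if_distrib[of "\<lambda>c. c * _"] cong: if_cong)

lemma diag_gauss_sup_nonneg: "diag_gauss_sup d A \<ge> 0"
  unfolding diag_gauss_sup_def by (rule Bochner_Integration.integral_nonneg) simp

context
  fixes d :: nat and A :: "nat \<Rightarrow> nat \<Rightarrow> real" and L :: real
  assumes A: "\<And>j. j < d \<Longrightarrow> 0 \<le> A j j \<and> A j j \<le> L" and L: "L > 0"
begin

abbreviation sup_fun :: "(nat \<Rightarrow> real) \<Rightarrow> real" where
  "sup_fun h \<equiv> Max (insert 0 ((\<lambda>j. \<bar>sqrt (A j j) * h j\<bar>) ` {..<d}))"

abbreviation tail_sum :: "real \<Rightarrow> real" where
  "tail_sum t \<equiv> \<Sum>j<d. gtail (A j j) t"

lemma sup_fun_measurable [measurable]: "sup_fun \<in> borel_measurable (gauss {..<d})"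
proof -
  \<comment> \<open>The inserted 0 becomes the value at an extra index \<open>d\<close>, which turns
    the set into an indexed family.\<close>
  have eq: "sup_fun = (\<lambda>h. Max ((\<lambda>j. if j = d then 0 else \<bar>sqrt (A j j) * h j\<bar>) ` {..d}))"
    by (rule ext, rule arg_cong[where f=Max]) (auto simp: image_iff lessThan_Suc_atMost[symmetric])
  show ?thesis
    unfolding eq
  proof (rule borel_measurable_Max)
    fix j assume "j \<in> {..d}"
    then show "(\<lambda>h. if j = d then 0 else \<bar>sqrt (A j j) * h j\<bar>) \<in> borel_measurable (gauss {..<d})"
      by (cases "j = d") auto
  qed simp
qed

text \<open>The maximum is at most \<open>t\<close> plus the sum of all excesses over
  \<open>t\<close>, and \<open>nn_integral_excess_le_gtail\<close> bounds the mean of each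
  excess.\<close>

lemma nn_integral_sup_le:
  assumes t: "t \<ge> 0"
  shows "(\<integral>\<^sup>+h. ennreal (sup_fun h) \<partial>gauss {..<d}) \<le> ennreal (t + sqrt L * tail_sum t)"
proof -
  interpret G: prob_space "gauss {..<d}" by (rule prob_space_gauss)
  define e where "e j = (\<lambda>k. if k = j then 1 else 0 :: real)" for j :: nat
  have e: "inner_on {..<d} (e j) x = x j" if "j < d" for j x
    using inner_on_unit[of "{..<d}" j x] that by (simp add: e_def)
  have "(\<integral>\<^sup>+h. ennreal (sup_fun h) \<partial>gauss {..<d})
    \<le> (\<integral>\<^sup>+h. ennreal t + (\<Sum>j<d. ennreal (sqrt (A j j) * \<bar>inner_on {..<d} (e j) h\<bar> - t)) \<partial>gauss {..<d})"
  proof (rule nn_integral_mono)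
    fix h
    have "sup_fun h \<in> insert 0 ((\<lambda>j. \<bar>sqrt (A j j) * h j\<bar>) ` {..<d})"
      by (rule Max_in) auto
    then consider "sup_fun h = 0" | j where "j < d" "sup_fun h = \<bar>sqrt (A j j) * h j\<bar>" by auto
    then show "ennreal (sup_fun h) \<le> ennreal t + (\<Sum>j<d. ennreal (sqrt (A j j) * \<bar>inner_on {..<d} (e j) h\<bar> - t))"
    proof cases
      case 1
      then show ?thesis by simp
    next
      case 2
      have "ennreal (sup_fun h) \<le> ennreal (t + max 0 (sqrt (A j j) * \<bar>h j\<bar> - t))"
        using 2 A[OF 2(1)] by (intro ennreal_leI) (auto simp: abs_mult)
      also have "\<dots> = ennreal t + ennreal (sqrt (A j j) * \<bar>h j\<bar> - t)"
        using t by (subst ennreal_plus) (auto simp: max_def ennreal_neg)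
      also have "\<dots> \<le> ennreal t + (\<Sum>j<d. ennreal (sqrt (A j j) * \<bar>inner_on {..<d} (e j) h\<bar> - t))"
        using member_le_sum[of j "{..<d}" "\<lambda>j. ennreal (sqrt (A j j) * \<bar>inner_on {..<d} (e j) h\<bar> - t)"] 2 e[of j h]
        by (intro add_left_mono) auto
      finally show ?thesis .
    qed
  qed
  also have "\<dots> = ennreal t + (\<Sum>j<d. \<integral>\<^sup>+h. ennreal (sqrt (A j j) * \<bar>inner_on {..<d} (e j) h\<bar> - t) \<partial>gauss {..<d})"
    by (subst nn_integral_add, simp, measurable, subst nn_integral_sum, measurable) (simp add: G.emeasure_space_1)
  also have "\<dots> \<le> ennreal t + (\<Sum>j<d. ennreal (sqrt L * gtail (A j j) t))"
  proof (intro add_left_mono sum_mono)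
    fix j assume "j \<in> {..<d}"
    then have j: "j < d" by simp
    have "(\<integral>\<^sup>+h. ennreal (sqrt (A j j) * \<bar>inner_on {..<d} (e j) h\<bar> - t) \<partial>gauss {..<d})
      = (\<integral>\<^sup>+z. ennreal (sqrt (A j j) * \<bar>z\<bar> - t) \<partial>std_normal_distribution)"
      by (rule nn_integral_gauss_unit[where J="{j}"]) (use j e in \<open>auto simp: e_def\<close>)
    also have "\<dots> \<le> ennreal (sqrt (A j j) * gtail (A j j) t)"
      by (rule nn_integral_excess_le_gtail) (use A j t in auto)
    also have "\<dots> \<le> ennreal (sqrt L * gtail (A j j) t)"
      using A[OF j] by (intro ennreal_leI mult_right_mono) (auto simp: gtail_nonneg)
    finally show "(\<integral>\<^sup>+h. ennreal (sqrt (A j j) * \<bar>inner_on {..<d} (e j) h\<bar> - t) \<partial>gauss {..<d}) \<le> ennreal (sqrt L * gtail (A j j) t)" .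
  qed
  also have "\<dots> = ennreal (t + sqrt L * tail_sum t)"
    using t L by (subst sum_ennreal) (auto simp: gtail_nonneg sum_nonneg sum_distrib_left)
  finally show ?thesis .
qed

lemma nn_integral_sup_eq:
  "(\<integral>\<^sup>+h. ennreal (sup_fun h) \<partial>gauss {..<d}) = ennreal (diag_gauss_sup d A)"
proof -
  \<comment> \<open>Finiteness from the upper bound at \<open>t = 0\<close>; without integrability
    the Bochner integral in \<open>diag_gauss_sup\<close> would default to 0.\<close>
  have "(\<integral>\<^sup>+h. ennreal (sup_fun h) \<partial>gauss {..<d}) < \<infinity>"
    using nn_integral_sup_le[of 0] by (rule order.strict_trans1) simp_all
  then have "integrable (gauss {..<d}) sup_fun"
    by (intro integrableI_nonneg) auto
  then show ?thesis
    unfolding diag_gauss_sup_def std_gauss_def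
    by (rule nn_integral_eq_integral) simp
qed

lemma diag_gauss_sup_le:
  assumes "t \<ge> 0"
  shows "diag_gauss_sup d A \<le> t + sqrt L * tail_sum t"
proof -
  have "0 \<le> t + sqrt L * tail_sum t"
    using assms L by (intro add_nonneg_nonneg mult_nonneg_nonneg sum_nonneg gtail_nonneg) auto
  then show ?thesis
    using nn_integral_sup_le[OF assms] unfolding nn_integral_sup_eq by (simp add: ennreal_le_iff)
qed

text \<open>Markov's inequality for the event that some coordinate exceeds \<open>t\<close>, whose
  probability is bounded below by \<open>gauss_all_small\<close>.\<close>

lemma diag_gauss_sup_ge:
  assumes t: "t \<ge> 0"
  shows "t * (1 - exp (- tail_sum t)) \<le> diag_gauss_sup d A"
proof -
  interpret G: prob_space "gauss {..<d}" by (rule prob_space_gauss)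
  define e where "e j = (\<lambda>k. if k = j then 1 else 0 :: real)" for j :: nat
  have e: "inner_on {..<d} (e j) x = x j" if "j < d" for j x
    using inner_on_unit[of "{..<d}" j x] that by (simp add: e_def)
  let ?S = "{x \<in> space (gauss {..<d}). \<forall>j\<in>{..<d}. sqrt (A j j) * \<bar>inner_on {..<d} (e j) x\<bar> \<le> t}"
  have small: "measure (gauss {..<d}) ?S \<le> exp (- tail_sum t)"
    by (rule gauss_all_small) (use e in \<open>auto simp: e_def\<close>)
  have S: "?S \<in> sets (gauss {..<d})" by measurable
  let ?T = "space (gauss {..<d}) - ?S"
  have "ennreal (t * measure (gauss {..<d}) ?T) = (\<integral>\<^sup>+h. ennreal t * indicator ?T h \<partial>gauss {..<d})"
    using S t by (subst nn_integral_cmult) (auto simp: G.emeasure_eq_measure ennreal_mult)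
  also have "\<dots> \<le> (\<integral>\<^sup>+h. ennreal (sup_fun h) \<partial>gauss {..<d})"
  proof (rule nn_integral_mono)
    fix h assume "h \<in> space (gauss {..<d})"
    show "ennreal t * indicator ?T h \<le> ennreal (sup_fun h)"
    proof (cases "h \<in> ?T")
      case True
      then obtain j where j: "j < d" "t < sqrt (A j j) * \<bar>h j\<bar>" using e by auto
      then have "t \<le> \<bar>sqrt (A j j) * h j\<bar>" using A[of j] by (simp add: abs_mult)
      also have "\<dots> \<le> sup_fun h" by (rule Max_ge) (use j in auto)
      finally show ?thesis using True by (simp add: ennreal_leI)
    qed simp
  qed
  finally have "t * measure (gauss {..<d}) ?T \<le> diag_gauss_sup d A"
    unfolding nn_integral_sup_eq using diag_gauss_sup_nonneg by (simp add: ennreal_le_iff)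
  moreover have "measure (gauss {..<d}) ?T = 1 - measure (gauss {..<d}) ?S"
    by (rule G.prob_compl[OF S])
  moreover have "t * (1 - exp (- tail_sum t)) \<le> t * (1 - measure (gauss {..<d}) ?S)"
    using small t by (intro mult_left_mono) auto
  ultimately show ?thesis by simp
qed

lemma tail_sum_decay:
  assumes "0 \<le> t" "t \<le> t'"
  shows "tail_sum t' \<le> exp (- (t * (t' - t) / L)) * tail_sum t"
  unfolding sum_distrib_left
  by (intro sum_mono gtail_decay) (use A L assms in auto)

text \<open>The two tail estimates say that the supremum is concentrated around its mean; the
  distance \<open>2 \<delta> E\<close> leaves room for one application of \<open>tail_sum_decay\<close>.\<close>

lemma tail_sum_below:
  fixes \<delta> :: real
  defines "E \<equiv> diag_gauss_sup d A"
  assumes \<delta>: "0 < \<delta>" "\<delta> \<le> 1/4" and big: "L \<le> \<delta>\<^sup>2 * E\<^sup>2"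
  shows "tail_sum ((1 - 2 * \<delta>) * E) \<ge> exp (\<delta> * E\<^sup>2 / (2 * L))"
proof -
  have E0: "E \<ge> 0" unfolding E_def by (rule diag_gauss_sup_nonneg)
  have "sqrt L \<le> \<delta> * E"
    using big \<delta> E0 real_sqrt_le_mono[OF big] by (simp add: real_sqrt_mult)
  \<comment> \<open>The tail term has to make up the missing \<open>\<delta> * E\<close>, which is
    at least \<open>sqrt L\<close>; hence the tail sum at \<open>(1 - \<delta>) * E\<close> is at
    least 1.\<close>
  moreover have "E \<le> (1 - \<delta>) * E + sqrt L * tail_sum ((1 - \<delta>) * E)"
    unfolding E_def by (rule diag_gauss_sup_le) (use E0 \<delta> in \<open>simp add: E_def\<close>)
  ultimately have "sqrt L * 1 \<le> sqrt L * tail_sum ((1 - \<delta>) * E)"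
    by (simp add: algebra_simps)
  then have 1: "1 \<le> tail_sum ((1 - \<delta>) * E)" using L by simp
  have "tail_sum ((1 - \<delta>) * E) \<le> exp (- ((1 - 2 * \<delta>) * E * ((1 - \<delta>) * E - (1 - 2 * \<delta>) * E) / L)) * tail_sum ((1 - 2 * \<delta>) * E)"
    by (rule tail_sum_decay) (use \<delta> E0 in \<open>auto intro!: mult_right_mono\<close>)
  also have "(1 - 2 * \<delta>) * E * ((1 - \<delta>) * E - (1 - 2 * \<delta>) * E) / L = (1 - 2 * \<delta>) * (\<delta> * E\<^sup>2 / L)"
    by (simp add: power2_eq_square algebra_simps)
  also have "exp (- ((1 - 2 * \<delta>) * (\<delta> * E\<^sup>2 / L))) \<le> exp (- (\<delta> * E\<^sup>2 / (2 * L)))"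
  proof -
    have "1/2 * (\<delta> * E\<^sup>2 / L) \<le> (1 - 2 * \<delta>) * (\<delta> * E\<^sup>2 / L)"
      using \<delta> L by (intro mult_right_mono) auto
    then show ?thesis by simp
  qed
  finally have "1 \<le> exp (- (\<delta> * E\<^sup>2 / (2 * L))) * tail_sum ((1 - 2 * \<delta>) * E)"
    using 1 by (auto simp: gtail_nonneg sum_nonneg mult_right_mono)
  then have "exp (\<delta> * E\<^sup>2 / (2 * L)) * 1 \<le> exp (\<delta> * E\<^sup>2 / (2 * L)) * (exp (- (\<delta> * E\<^sup>2 / (2 * L))) * tail_sum ((1 - 2 * \<delta>) * E))"
    by (intro mult_left_mono) auto
  then show ?thesis
    by (simp add: mult.assoc[symmetric] mult_exp_exp)
qed

lemma tail_sum_above: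
  fixes \<delta> :: real
  defines "E \<equiv> diag_gauss_sup d A"
  assumes \<delta>: "0 < \<delta>" "\<delta> \<le> 1/4" and E: "E > 0"
  shows "tail_sum ((1 + 2 * \<delta>) * E) \<le> exp (- (\<delta> * E\<^sup>2 / L)) * (2 / \<delta>)"
proof -
  let ?S = "tail_sum ((1 + \<delta>) * E)"
  have S0: "?S \<ge> 0" by (simp add: sum_nonneg gtail_nonneg)
  \<comment> \<open>Forces \<open>exp (- ?S)\<close> to be at least
    \<open>\<delta> / (1 + \<delta>)\<close>, so the tail sum at \<open>(1 + \<delta>) * E\<close>
    is bounded in terms of \<open>\<delta>\<close> alone.\<close>
  have "(1 + \<delta>) * E * (1 - exp (- ?S)) \<le> E"
    unfolding E_def by (rule diag_gauss_sup_ge) (use E \<delta> in \<open>simp add: E_def\<close>)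
  then have "(1 + \<delta>) * (1 - exp (- ?S)) \<le> 1"
    using E by (simp add: mult.commute mult.left_commute mult_le_cancel_left1)
  then have "\<delta> \<le> (1 + \<delta>) * exp (- ?S)" by (simp add: algebra_simps)
  then have "\<delta> * exp ?S \<le> (1 + \<delta>) * exp (- ?S) * exp ?S" by (intro mult_right_mono) auto
  also have "\<dots> = 1 + \<delta>" by (simp add: mult.assoc mult_exp_exp)
  finally have "exp ?S \<le> (1 + \<delta>) / \<delta>" using \<delta> by (simp add: field_simps)
  moreover have "?S \<le> exp ?S" using exp_ge_add_one_self[of ?S] by linarith
  moreover have "(1 + \<delta>) / \<delta> \<le> 2 / \<delta>" using \<delta> by (intro divide_right_mono) auto
  ultimately have K: "?S \<le> 2 / \<delta>" by linarith
  have "tail_sum ((1 + 2 * \<delta>) * E) \<le> exp (- ((1 + \<delta>) * E * ((1 + 2 * \<delta>) * E - (1 + \<delta>) * E) / L)) * ?S"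
    by (rule tail_sum_decay) (use \<delta> E in \<open>auto intro!: mult_right_mono\<close>)
  also have "(1 + \<delta>) * E * ((1 + 2 * \<delta>) * E - (1 + \<delta>) * E) / L = (1 + \<delta>) * (\<delta> * E\<^sup>2 / L)"
    by (simp add: power2_eq_square algebra_simps)
  also have "exp (- ((1 + \<delta>) * (\<delta> * E\<^sup>2 / L))) * ?S \<le> exp (- (\<delta> * E\<^sup>2 / L)) * (2 / \<delta>)"
  proof (rule mult_mono)
    have "1 * (\<delta> * E\<^sup>2 / L) \<le> (1 + \<delta>) * (\<delta> * E\<^sup>2 / L)"
      using \<delta> L by (intro mult_right_mono) auto
    then show "exp (- ((1 + \<delta>) * (\<delta> * E\<^sup>2 / L))) \<le> exp (- (\<delta> * E\<^sup>2 / L))" by simp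
  qed (use K S0 in auto)
  finally show ?thesis .
qed

end

section \<open>Nets on the sphere\<close>

lemma inner_on_self: "inner_on I x x = (L2_set x I)\<^sup>2"
  by (simp add: inner_on_def L2_set_def power2_eq_square[symmetric] sum_nonneg)

lemma inner_on_Cauchy_Schwarz: "\<bar>inner_on I a x\<bar> \<le> L2_set a I * L2_set x I"
proof -
  have "\<bar>inner_on I a x\<bar> \<le> (\<Sum>i\<in>I. \<bar>a i\<bar> * \<bar>x i\<bar>)"
    unfolding inner_on_def by (rule order_trans[OF sum_abs]) (simp add: abs_mult)
  also have "\<dots> \<le> L2_set a I * L2_set x I" by (rule L2_set_mult_ineq)
  finally show ?thesis .
qed

lemma inner_on_diff_left: "inner_on I (\<lambda>i. a i - b i) x = inner_on I a x - inner_on I b x"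
  by (simp add: inner_on_def left_diff_distrib sum_subtractf)

lemma inner_on_scale_left: "inner_on I (\<lambda>i. c * a i) x = c * inner_on I a x"
  by (simp add: inner_on_def sum_distrib_left mult.assoc)

lemma L2_set_scale: "L2_set (\<lambda>i. c * x i) I = \<bar>c\<bar> * L2_set x I"
proof -
  have "(\<Sum>i\<in>I. (c * x i)\<^sup>2) = c\<^sup>2 * (\<Sum>i\<in>I. (x i)\<^sup>2)"
    by (simp add: power_mult_distrib sum_distrib_left)
  then show ?thesis by (simp add: L2_set_def real_sqrt_mult)
qed

lemma sum_half_powers: "(\<Sum>z\<in>{- int N..int N}. (1/2::real) ^ nat \<bar>z\<bar>) = 3 - 2 * (1/2) ^ N"
proof (induction N)
  case (Suc N)
  have "{- int (Suc N)..int (Suc N)} = insert (- int (Suc N)) (insert (int (Suc N)) {- int N..int N})" by auto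
  then have "(\<Sum>z\<in>{- int (Suc N)..int (Suc N)}. (1/2::real) ^ nat \<bar>z\<bar>)
    = (1/2) ^ Suc N + ((1/2) ^ Suc N + (\<Sum>z\<in>{- int N..int N}. (1/2::real) ^ nat \<bar>z\<bar>))"
    by (simp add: nat_add_distrib del: power_Suc)
  then show ?case by (simp only: Suc.IH) simp
qed simp

text \<open>A generating function count. Every lattice point of the ball has weight
  \<open>2 ^ N * (\<Prod>i<n. (1/2) ^ nat \<bar>k i\<bar>)\<close> at least 1, and the total weight
  over the enclosing box factors into one-dimensional geometric sums, each at most 3.\<close>

lemma card_lattice_l1_ball:
  fixes N n :: nat
  defines "K \<equiv> {k \<in> {..<n} \<rightarrow>\<^sub>E (UNIV::int set). (\<Sum>i<n. nat \<bar>k i\<bar>) \<le> N}"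
  shows "finite K \<and> card K \<le> 2 ^ N * 3 ^ n"
proof -
  let ?P = "{..<n} \<rightarrow>\<^sub>E {- int N..int N}"
  have fP: "finite ?P" by (intro finite_PiE) auto
  have KP: "K \<subseteq> ?P"
  proof
    fix k assume k: "k \<in> K"
    have "k i \<in> {- int N..int N}" if "i < n" for i
    proof -
      have "nat \<bar>k i\<bar> \<le> (\<Sum>i<n. nat \<bar>k i\<bar>)" using that by (intro member_le_sum) auto
      then have "nat \<bar>k i\<bar> \<le> N" using k by (simp add: K_def)
      then show ?thesis by auto
    qed
    then show "k \<in> ?P" using k by (auto simp: K_def PiE_def)
  qed
  have fK: "finite K" using KP fP by (rule finite_subset)
  have "real (card K) = (\<Sum>k\<in>K. 1)" by simp
  also have "\<dots> \<le> (\<Sum>k\<in>K. 2 ^ N * (\<Prod>i<n. (1/2) ^ nat \<bar>k i\<bar>))"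
  proof (rule sum_mono)
    fix k assume "k \<in> K"
    then have "(1/2::real) ^ N \<le> (1/2) ^ (\<Sum>i<n. nat \<bar>k i\<bar>)"
      by (intro power_decreasing) (auto simp: K_def)
    also have "\<dots> = (\<Prod>i<n. (1/2) ^ nat \<bar>k i\<bar>)" by (simp add: power_sum)
    finally have "2 ^ N * (1/2) ^ N \<le> 2 ^ N * (\<Prod>i<n. (1/2::real) ^ nat \<bar>k i\<bar>)"
      by (rule mult_left_mono) simp
    then show "1 \<le> 2 ^ N * (\<Prod>i<n. (1/2::real) ^ nat \<bar>k i\<bar>)"
      by (simp add: power_mult_distrib[symmetric])
  qed
  also have "\<dots> \<le> (\<Sum>k\<in>?P. 2 ^ N * (\<Prod>i<n. (1/2) ^ nat \<bar>k i\<bar>))"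
    by (rule sum_mono2[OF fP KP]) (intro mult_nonneg_nonneg prod_nonneg zero_le_power; simp)
  also have "\<dots> = 2 ^ N * (\<Prod>i<n. \<Sum>z\<in>{- int N..int N}. (1/2) ^ nat \<bar>z\<bar>)"
  proof -
    have e: "(\<Prod>i<n. \<Sum>z\<in>{- int N..int N}. (1/2::real) ^ nat \<bar>z\<bar>) = (\<Sum>k\<in>?P. \<Prod>i<n. (1/2) ^ nat \<bar>k i\<bar>)"
      using prod_sum_PiE[of "{..<n}" "\<lambda>_. {- int N..int N}" "\<lambda>_ z. (1/2::real) ^ nat \<bar>z\<bar>"] by simp
    show ?thesis unfolding e by (rule sum_distrib_left[symmetric])
  qed
  also have "\<dots> \<le> 2 ^ N * 3 ^ n"
  proof -
    have "(1/2::real) ^ N \<le> 1" by (simp add: power_le_one)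
    then have "(\<Prod>i<n. 3 - 2 * (1/2::real) ^ N) \<le> 3 ^ n" by (simp add: power_mono)
    then show ?thesis unfolding sum_half_powers by (rule mult_left_mono) simp
  qed
  finally have "real (card K) \<le> real (2 ^ N * 3 ^ n)" by simp
  then show ?thesis using fK by (simp only: of_nat_le_iff)
qed

text \<open>Net points are required to be unit vectors themselves, so that they yield orthonormal
  functionals without renormalization. For \<open>n = 0\<close> there are no unit vectors and the
  empty set is a net.\<close>

definition sphere_net :: "nat \<Rightarrow> real \<Rightarrow> (nat \<Rightarrow> real) set \<Rightarrow> bool" where
  "sphere_net n \<delta> N \<longleftrightarrow> finite N \<and> (\<forall>v\<in>N. L2_set v {..<n} = 1) \<and>
    (\<forall>u. L2_set u {..<n} = 1 \<longrightarrow> (\<exists>v\<in>N. L2_set (\<lambda>i. u i - v i) {..<n} \<le> \<delta>))"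

text \<open>The sphere is cut by a cubic lattice and one unit vector is chosen in each cell it
  meets. Cells are counted by the l1 norm of their rounded coordinates; counting coordinate by
  coordinate would cost a factor of order \<open>sqrt n\<close> per coordinate and spoil the
  exponential bound.\<close>

lemma sphere_net_exists:
  fixes \<delta> :: real
  assumes \<delta>: "\<delta> > 0"
  obtains A :: nat where "A \<ge> 1" "\<And>n. \<exists>N. sphere_net n \<delta> N \<and> card N \<le> A ^ n"
proof -
  define L where "L = nat \<lceil>1 / \<delta>\<rceil> + 1"
  have L: "1 / \<delta> + 1 \<le> real L" unfolding L_def by linarith
  have "\<exists>N. sphere_net n \<delta> N \<and> card N \<le> (2 ^ L * 3) ^ n" for n
  proof -
    \<comment> \<open>Mesh \<open>\<delta> / sqrt n\<close> gives cells of Euclidean diameter at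
      most \<open>\<delta>\<close>. A unit vector has l1 norm at most \<open>sqrt n\<close>, so its
      rounding has l1 norm at most \<open>c * sqrt n + n\<close>, which is linear in
      \<open>n\<close>.\<close>
    define c where "c = sqrt (real n) / \<delta>"
    define key where "key u = (\<lambda>i\<in>{..<n}. \<lfloor>c * u i\<rfloor>)" for u :: "nat \<Rightarrow> real"
    define S where "S = {u. L2_set u {..<n} = 1}"
    define rep where "rep k = (SOME u. u \<in> S \<and> key u = k)" for k
    define N where "N = rep ` key ` S"
    have rep: "rep (key u) \<in> S \<and> key (rep (key u)) = key u" if "u \<in> S" for u
      unfolding rep_def by (rule someI[of _ u]) (use that in simp)
    let ?K = "{k \<in> {..<n} \<rightarrow>\<^sub>E (UNIV::int set). (\<Sum>i<n. nat \<bar>k i\<bar>) \<le> L * n}"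
    have sub: "key ` S \<subseteq> ?K"
    proof
      fix k assume "k \<in> key ` S"
      then obtain u where u: "L2_set u {..<n} = 1" and k: "k = key u" by (auto simp: S_def)
      have l1: "(\<Sum>i<n. \<bar>u i\<bar>) \<le> sqrt (real n)"
        using L2_set_mult_ineq[of "\<lambda>_. 1" u "{..<n}"] u by (simp add: L2_set_def)
      have "real (\<Sum>i<n. nat \<bar>k i\<bar>) = (\<Sum>i<n. \<bar>real_of_int (k i)\<bar>)" by simp
      also have "\<dots> \<le> (\<Sum>i<n. c * \<bar>u i\<bar> + 1)"
      proof (rule sum_mono)
        fix i assume "i \<in> {..<n}"
        then have ki: "k i = \<lfloor>c * u i\<rfloor>" by (simp add: k key_def)
        have "\<bar>real_of_int (k i)\<bar> \<le> \<bar>c * u i\<bar> + 1" unfolding ki by linarith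
        then show "\<bar>real_of_int (k i)\<bar> \<le> c * \<bar>u i\<bar> + 1"
          using \<delta> by (simp add: abs_mult c_def)
      qed
      also have "\<dots> = c * (\<Sum>i<n. \<bar>u i\<bar>) + n" by (simp add: sum.distrib sum_distrib_left)
      also have "\<dots> \<le> c * sqrt n + n" using l1 \<delta> by (intro add_right_mono mult_left_mono) (auto simp: c_def)
      also have "\<dots> = (1 / \<delta> + 1) * n" by (simp add: c_def algebra_simps)
      also have "\<dots> \<le> real L * n" using L by (intro mult_right_mono) auto
      finally have "real (\<Sum>i<n. nat \<bar>k i\<bar>) \<le> real (L * n)" by simp
      then have "(\<Sum>i<n. nat \<bar>k i\<bar>) \<le> L * n" by (simp only: of_nat_le_iff)
      then show "k \<in> ?K" by (auto simp: k key_def)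
    qed
    have fin: "finite (key ` S)" and card: "card (key ` S) \<le> 2 ^ (L * n) * 3 ^ n"
      using card_lattice_l1_ball[where N="L * n" and n=n] sub by (auto intro: finite_subset dest: card_mono[rotated])
    have "card N \<le> card (key ` S)" unfolding N_def using fin by (rule card_image_le)
    then have "card N \<le> (2 ^ L * 3) ^ n" using card by (simp add: power_mult_distrib power_mult)
    moreover have "sphere_net n \<delta> N"
      unfolding sphere_net_def
    proof (intro conjI ballI allI impI)
      show "finite N" using fin by (simp add: N_def)
      show "L2_set v {..<n} = 1" if "v \<in> N" for v
        using that rep by (auto simp: N_def S_def)
      fix u :: "nat \<Rightarrow> real" assume u: "L2_set u {..<n} = 1"
      then have uS: "u \<in> S" by (simp add: S_def)
      have n0: "n > 0" using u by (cases n) auto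
      define v where "v = rep (key u)"
      have v: "v \<in> N" "key v = key u" using rep[OF uS] uS by (auto simp: N_def v_def)
      have "\<bar>u i - v i\<bar> \<le> \<delta> / sqrt n" if i: "i < n" for i
      proof -
        have "\<lfloor>c * u i\<rfloor> = \<lfloor>c * v i\<rfloor>" using fun_cong[OF v(2), of i] i by (simp add: key_def)
        then have "\<bar>c * u i - c * v i\<bar> \<le> 1" by linarith
        moreover have "c \<ge> 0" using \<delta> by (simp add: c_def)
        ultimately have "c * \<bar>u i - v i\<bar> \<le> 1"
          by (simp only: right_diff_distrib[symmetric] abs_mult abs_of_nonneg)
        then show ?thesis using n0 \<delta> by (simp add: c_def field_simps)
      qed
      then have "(\<Sum>i<n. (u i - v i)\<^sup>2) \<le> (\<Sum>i<n. (\<delta> / sqrt n)\<^sup>2)"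
        using \<delta> by (intro sum_mono power2_le_iff_abs_le[THEN iffD2]) auto
      also have "\<dots> = \<delta>\<^sup>2" using n0 by (simp add: power_divide)
      finally have "L2_set (\<lambda>i. u i - v i) {..<n} \<le> \<delta>"
        using \<delta> unfolding L2_set_def by (intro real_le_lsqrt) auto
      then show "\<exists>v\<in>N. L2_set (\<lambda>i. u i - v i) {..<n} \<le> \<delta>" using v by blast
    qed
    ultimately show ?thesis by blast
  qed
  then show thesis by (intro that[of "2 ^ L * 3"]) auto
qed

lemma L2_set_normalize:
  assumes "L2_set x I > 0"
  shows "L2_set (\<lambda>i. inverse (L2_set x I) * x i) I = 1"
  using assms by (simp add: L2_set_scale)

text \<open>The net point nearest to the direction of \<open>x\<close> captures all but a fraction
  \<open>\<delta>\<close> of its norm.\<close>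

lemma sphere_net_norm_bound:
  assumes N: "sphere_net n \<delta> N" and c: "c \<ge> 0" and le: "\<And>v. v \<in> N \<Longrightarrow> \<bar>inner_on {..<n} v x\<bar> \<le> c"
  shows "(1 - \<delta>) * L2_set x {..<n} \<le> c"
proof (cases "L2_set x {..<n} = 0")
  case False
  define \<rho> where "\<rho> = L2_set x {..<n}"
  have \<rho>: "\<rho> > 0" using False L2_set_nonneg[of x "{..<n}"] unfolding \<rho>_def by linarith
  define u where "u = (\<lambda>i. inverse \<rho> * x i)"
  have "L2_set u {..<n} = 1" unfolding u_def \<rho>_def by (rule L2_set_normalize) (use \<rho> in \<open>simp add: \<rho>_def\<close>)
  then obtain v where v: "v \<in> N" "L2_set (\<lambda>i. u i - v i) {..<n} \<le> \<delta>"
    using N by (auto simp: sphere_net_def)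
  have "inner_on {..<n} u x = \<rho>"
    using \<rho> by (simp add: u_def inner_on_scale_left inner_on_self \<rho>_def[symmetric] power2_eq_square)
  then have "\<rho> = inner_on {..<n} (\<lambda>i. u i - v i) x + inner_on {..<n} v x"
    by (simp add: inner_on_diff_left)
  also have "\<dots> \<le> \<delta> * \<rho> + c"
  proof -
    have "inner_on {..<n} (\<lambda>i. u i - v i) x \<le> L2_set (\<lambda>i. u i - v i) {..<n} * \<rho>"
      using inner_on_Cauchy_Schwarz[of "{..<n}" "\<lambda>i. u i - v i" x] by (simp add: \<rho>_def)
    also have "\<dots> \<le> \<delta> * \<rho>" using v \<rho> by (intro mult_right_mono) auto
    finally show ?thesis using le[OF v(1)] by linarith
  qed
  finally show ?thesis by (simp add: \<rho>_def algebra_simps)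
qed (simp add: c)

section \<open>Matrices controlled through a net of directions\<close>

definition mat_vec :: "nat \<Rightarrow> (nat \<Rightarrow> nat \<Rightarrow> real) \<Rightarrow> (nat \<Rightarrow> real) \<Rightarrow> nat \<Rightarrow> real" where
  "mat_vec r W \<theta> = (\<lambda>i. \<Sum>s<r. W i s * \<theta> s)"

lemma mat_vec_scale: "mat_vec r W (\<lambda>s. c * \<theta> s) = (\<lambda>i. c * mat_vec r W \<theta> i)"
  by (simp add: mat_vec_def sum_distrib_left mult_ac)

lemma mat_vec_diff: "mat_vec r W (\<lambda>s. \<theta> s - \<eta> s) = (\<lambda>i. mat_vec r W \<theta> i - mat_vec r W \<eta> i)"
  by (simp add: mat_vec_def right_diff_distrib sum_subtractf)

lemma mat_vec_norm_homogeneous: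
  assumes "\<And>\<eta>. L2_set \<eta> {..<r} = 1 \<Longrightarrow> L2_set (mat_vec r W \<eta>) I \<le> M"
  shows "L2_set (mat_vec r W \<theta>) I \<le> M * L2_set \<theta> {..<r}"
proof (cases "L2_set \<theta> {..<r} = 0")
  case True
  then have "mat_vec r W \<theta> i = 0" for i by (auto simp: mat_vec_def L2_set_eq_0_iff)
  then show ?thesis using True by (simp add: L2_set_def)
next
  case False
  then have p: "L2_set \<theta> {..<r} > 0" using L2_set_nonneg[of \<theta> "{..<r}"] by linarith
  have "inverse (L2_set \<theta> {..<r}) * L2_set (mat_vec r W \<theta>) I \<le> M"
    using assms[OF L2_set_normalize[OF p]] p unfolding mat_vec_scale L2_set_scale by simp
  then show ?thesis using p by (simp add: field_simps)
qed

lemma L2_set_triangle_diff: "L2_set f I \<le> L2_set g I + L2_set (\<lambda>i. f i - g i) I"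
  using L2_set_triangle_ineq[of g "\<lambda>i. f i - g i" I] by simp

text \<open>The supremum \<open>M\<close> of the norm over the whole sphere satisfies
  \<open>M \<le> b + \<delta> * M\<close>. Solving this requires \<open>M\<close> to be finite,
  which is the purpose of the crude row bound in \<open>bdd\<close>. Passing from a net point to a
  general direction then lowers the norm by at most \<open>\<delta> * M\<close>.\<close>

lemma sphere_net_operator_bound:
  fixes W :: "nat \<Rightarrow> nat \<Rightarrow> real"
  assumes N: "sphere_net r \<delta> N" and \<delta>: "0 \<le> \<delta>" "\<delta> < 1" and b: "b \<ge> 0"
    and up: "\<And>v. v \<in> N \<Longrightarrow> L2_set (mat_vec r W v) {..<n} \<le> b"
    and low: "\<And>v. v \<in> N \<Longrightarrow> a \<le> L2_set (mat_vec r W v) {..<n}"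
  shows "(a - \<delta> * b / (1 - \<delta>)) * L2_set \<theta> {..<r} \<le> L2_set (mat_vec r W \<theta>) {..<n}"
proof -
  let ?n = "\<lambda>\<theta>. L2_set (mat_vec r W \<theta>) {..<n}"
  define S where "S = {\<eta>. L2_set \<eta> {..<r} = 1}"
  have bdd: "bdd_above (?n ` S)"
  proof (rule bdd_aboveI2)
    fix \<eta> assume "\<eta> \<in> S"
    then have \<eta>: "L2_set \<eta> {..<r} = 1" by (simp add: S_def)
    have "?n \<eta> \<le> (\<Sum>i<n. \<bar>mat_vec r W \<eta> i\<bar>)" by (rule L2_set_le_sum_abs)
    also have "\<dots> \<le> (\<Sum>i<n. L2_set (W i) {..<r})"
      by (intro sum_mono) (use inner_on_Cauchy_Schwarz[of "{..<r}" _ \<eta>] \<eta> in \<open>auto simp: mat_vec_def inner_on_def\<close>)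
    finally show "?n \<eta> \<le> (\<Sum>i<n. L2_set (W i) {..<r})" .
  qed
  have "?n \<eta> \<le> b / (1 - \<delta>)" if \<eta>: "\<eta> \<in> S" for \<eta>
  proof -
    define M where "M = Sup (?n ` S)"
    have M: "?n \<zeta> \<le> M" if "\<zeta> \<in> S" for \<zeta> unfolding M_def by (rule cSUP_upper[OF that bdd])
    then have M': "?n \<zeta> \<le> M * L2_set \<zeta> {..<r}" for \<zeta>
      by (intro mat_vec_norm_homogeneous) (simp add: S_def)
    have M0: "0 \<le> M" using M[OF \<eta>] L2_set_nonneg[of "mat_vec r W \<eta>" "{..<n}"] by linarith
    have "M \<le> b + \<delta> * M" unfolding M_def
    proof (rule cSUP_least)
      show "S \<noteq> {}" using \<eta> by blast
      fix \<zeta> assume "\<zeta> \<in> S"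
      then obtain v where v: "v \<in> N" "L2_set (\<lambda>i. \<zeta> i - v i) {..<r} \<le> \<delta>"
        using N by (auto simp: sphere_net_def S_def)
      have "?n \<zeta> \<le> ?n v + ?n (\<lambda>i. \<zeta> i - v i)"
        unfolding mat_vec_diff by (rule L2_set_triangle_diff)
      also have "\<dots> \<le> b + M * \<delta>"
        using up[OF v(1)] M'[of "\<lambda>i. \<zeta> i - v i"] mult_left_mono[OF v(2) M0] by linarith
      finally show "?n \<zeta> \<le> b + \<delta> * Sup (?n ` S)" by (simp add: M_def mult.commute)
    qed
    then have "M * (1 - \<delta>) \<le> b" by (simp add: algebra_simps)
    then have "M \<le> b / (1 - \<delta>)" using \<delta> by (simp add: pos_le_divide_eq)
    then show ?thesis using M[OF \<eta>] by linarith
  qed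
  then have up': "?n \<zeta> \<le> b / (1 - \<delta>) * L2_set \<zeta> {..<r}" for \<zeta>
    by (intro mat_vec_norm_homogeneous) (simp add: S_def)
  show ?thesis
  proof (cases "L2_set \<theta> {..<r} = 0")
    case False
    then have p: "L2_set \<theta> {..<r} > 0" using L2_set_nonneg[of \<theta> "{..<r}"] by linarith
    define u where "u = (\<lambda>i. inverse (L2_set \<theta> {..<r}) * \<theta> i)"
    have "L2_set u {..<r} = 1" unfolding u_def by (rule L2_set_normalize[OF p])
    then obtain v where v: "v \<in> N" "L2_set (\<lambda>i. u i - v i) {..<r} \<le> \<delta>"
      using N by (auto simp: sphere_net_def)
    have "?n v \<le> ?n u + ?n (\<lambda>i. v i - u i)"
      unfolding mat_vec_diff by (rule L2_set_triangle_diff)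
    also have "?n (\<lambda>i. v i - u i) \<le> b / (1 - \<delta>) * \<delta>"
    proof -
      have "L2_set (\<lambda>i. v i - u i) {..<r} = L2_set (\<lambda>i. u i - v i) {..<r}"
        by (simp add: L2_set_def power2_commute)
      then show ?thesis
        using up'[of "\<lambda>i. v i - u i"] mult_left_mono[OF v(2), of "b / (1 - \<delta>)"] b \<delta> by simp
    qed
    finally have "a - \<delta> * b / (1 - \<delta>) \<le> ?n u" using low[OF v(1)] by (simp add: mult.commute)
    then show ?thesis using p unfolding u_def mat_vec_scale L2_set_scale by (simp add: field_simps)
  qed (simp add: L2_set_nonneg)
qed

section \<open>Exact solutions and minimal interpolators\<close>

lemma continuous_on_coordinate [continuous_intros]: "continuous_on S (\<lambda>w::nat \<Rightarrow> real. w j)"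
  by (rule continuous_on_subset[OF continuous_on_product_coordinates]) simp

lemma continuous_on_sum_coordinates [continuous_intros]:
  "continuous_on S (\<lambda>w::nat \<Rightarrow> real. \<Sum>j\<in>A. c j * w j)"
  by (intro continuous_intros)

lemma compact_box: "compact {w :: nat \<Rightarrow> real. \<forall>j. w j \<in> (if j < d then {-R..R} else {0})}"
proof -
  have "compactin (product_topology (\<lambda>_::nat. euclidean :: real topology) UNIV)
      (PiE UNIV (\<lambda>j. if j < d then {-R..R} else {0}))"
    by (subst compactin_PiE) auto
  then show ?thesis
    by (simp add: euclidean_product_topology PiE_UNIV_domain Pi_def)
qed

lemma l1norm_coord_le: "j < d \<Longrightarrow> \<bar>w j\<bar> \<le> l1norm d w"
  unfolding l1norm_def by (rule member_le_sum) auto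

lemma l1norm_nonneg: "l1norm d w \<ge> 0"
  by (simp add: l1norm_def sum_nonneg)

lemma l1norm_triangle: "l1norm d (\<lambda>j. v j + w j) \<le> l1norm d v + l1norm d w"
  unfolding l1norm_def sum.distrib[symmetric] by (intro sum_mono) simp

lemma l1norm_triangle_diff: "l1norm d (\<lambda>j. v j - w j) \<le> l1norm d v + l1norm d w"
  unfolding l1norm_def sum.distrib[symmetric] by (intro sum_mono) simp

lemma continuous_on_l1norm [continuous_intros]: "continuous_on S (l1norm d)"
  unfolding l1norm_def[abs_def] by (intro continuous_intros)

text \<open>Vectors are functions on all naturals with the product topology. Coercivity confines the
  sublevel set of \<open>F v0\<close> to a box that is degenerate beyond \<open>d\<close>, and such
  a box is compact by Tychonoff's theorem.\<close>

lemma attains_min_coercive: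
  fixes F :: "(nat \<Rightarrow> real) \<Rightarrow> real"
  assumes C: "closed C" "v0 \<in> C" and sub: "\<And>w j. w \<in> C \<Longrightarrow> d \<le> j \<Longrightarrow> w j = 0"
    and F: "continuous_on UNIV F" and c: "c > 0" and coercive: "\<And>w. c * l1norm d w \<le> F w"
  obtains w where "w \<in> C" "\<And>v. v \<in> C \<Longrightarrow> F w \<le> F v"
proof -
  define K where "K = C \<inter> {w. \<forall>j. w j \<in> (if j < d then {-(F v0 / c)..F v0 / c} else {0})}"
  have inK: "w \<in> K" if w: "w \<in> C" "F w \<le> F v0" for w
  proof -
    have "w j \<in> (if j < d then {-(F v0 / c)..F v0 / c} else {0})" for j
    proof (cases "j < d")
      case True
      then have "c * \<bar>w j\<bar> \<le> c * l1norm d w" using c l1norm_coord_le by simp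
      also have "\<dots> \<le> F v0" using coercive[of w] w(2) by linarith
      finally have "\<bar>w j\<bar> \<le> F v0 / c" using c by (simp add: field_simps)
      then show ?thesis using True by (simp add: abs_le_iff)
    qed (use sub[OF w(1)] in simp)
    then show ?thesis using w by (simp add: K_def)
  qed
  have "compact K" unfolding K_def using C(1) compact_box by (rule closed_Int_compact)
  moreover have "K \<noteq> {}" using inK[OF C(2)] by auto
  ultimately obtain w where w: "w \<in> K" "\<And>v. v \<in> K \<Longrightarrow> F w \<le> F v"
    using continuous_attains_inf[of K F] F continuous_on_subset by (metis subset_UNIV)
  show thesis
  proof (rule that)
    show "w \<in> C" using w by (simp add: K_def)
    show "F w \<le> F v" if "v \<in> C" for v
      using that w(2)[of v] w(2)[OF inK[OF C(2)]] inK[of v] by fastforce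
  qed
qed

lemma min_l1_interpolators_nonempty:
  assumes "interpolators n d X Y \<noteq> {}"
  shows "min_l1_interpolators n d X Y \<noteq> {}"
proof -
  obtain v0 where v0: "v0 \<in> interpolators n d X Y" using assms by auto
  have eq: "interpolators n d X Y = (\<Inter>j\<in>{d..}. {w. w j = 0}) \<inter> (\<Inter>i\<in>{..<n}. {w. (\<Sum>j<d. X i j * w j) = Y i})"
    by (auto simp: interpolators_def)
  have "closed (interpolators n d X Y)"
    unfolding eq
    by (intro closed_Int closed_INT ballI closed_Collect_eq continuous_intros)
  then obtain w where "w \<in> interpolators n d X Y" "\<And>v. v \<in> interpolators n d X Y \<Longrightarrow> l1norm d w \<le> l1norm d v"
    by (rule attains_min_coercive[where F="l1norm d" and c=1 and d=d, OF _ v0])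
       (auto simp: interpolators_def intro: continuous_intros)
  then show ?thesis by (auto simp: min_l1_interpolators_def)
qed

text \<open>If every direction is nearly a column, then a minimizer of the penalized residual below has
  residual zero, since otherwise adding the column nearest to the residual would decrease it.\<close>

lemma exact_solution_of_dense_columns:
  fixes X :: "nat \<Rightarrow> nat \<Rightarrow> real"
  assumes J: "J \<subseteq> {..<d}" and m: "m > 0" and \<delta>: "\<delta> < \<delta>'" "\<delta>' < 1"
    and dense: "\<And>u. L2_set u {..<n} = 1 \<Longrightarrow> \<exists>j\<in>J. \<exists>s. \<bar>s\<bar> = 1 \<and> L2_set (\<lambda>i. m * u i - s * X i j) {..<n} \<le> \<delta> * m"
  obtains v where "\<And>j. j \<notin> J \<Longrightarrow> v j = 0" "\<And>i. i < n \<Longrightarrow> (\<Sum>j<d. X i j * v j) = y i"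
    "(1 - \<delta>') * m * l1norm d v \<le> L2_set y {..<n}"
proof -
  define res where "res v = (\<lambda>i. y i - (\<Sum>j<d. X i j * v j))" for v
  \<comment> \<open>Adding the column nearest to a residual of norm \<open>\<rho>\<close> costs
    \<open>\<rho> / m\<close> in l1 norm and shrinks the residual to
    \<open>\<delta> * \<rho>\<close>. At this penalty the change of \<open>F\<close> is at most
    \<open>(\<delta> - \<delta>') * \<rho>\<close>, which is negative.\<close>
  define c where "c = (1 - \<delta>') * m"
  have c: "c > 0" using m \<delta> by (simp add: c_def)
  define F where "F v = L2_set (res v) {..<n} + c * l1norm d v" for v
  define C where "C = {v :: nat \<Rightarrow> real. \<forall>j. j \<notin> J \<longrightarrow> v j = 0}"
  have Ceq: "C = (\<Inter>j\<in>- J. {v. v j = 0})" by (auto simp: C_def)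
  have Ccl: "closed C" unfolding Ceq
    by (intro closed_INT ballI closed_Collect_eq continuous_intros)
  have C0: "(\<lambda>_. 0) \<in> C" by (simp add: C_def)
  have Fcont: "continuous_on UNIV F"
    unfolding F_def[abs_def] res_def L2_set_def by (intro continuous_intros)
  obtain v where v: "v \<in> C" and vmin: "\<And>w. w \<in> C \<Longrightarrow> F v \<le> F w"
    by (rule attains_min_coercive[where d=d, OF Ccl C0 _ Fcont c]) (use J in \<open>auto simp: C_def F_def L2_set_nonneg\<close>)
  define \<rho> where "\<rho> = L2_set (res v) {..<n}"
  have "\<rho> = 0"
  proof (rule ccontr)
    assume "\<rho> \<noteq> 0"
    then have \<rho>: "\<rho> > 0" using L2_set_nonneg[of "res v" "{..<n}"] unfolding \<rho>_def by linarith
    define u where "u = (\<lambda>i. inverse \<rho> * res v i)"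
    have "L2_set u {..<n} = 1" unfolding u_def \<rho>_def by (rule L2_set_normalize) (use \<rho> in \<open>simp add: \<rho>_def\<close>)
    then obtain j s where j: "j \<in> J" "\<bar>s\<bar> = 1" "L2_set (\<lambda>i. m * u i - s * X i j) {..<n} \<le> \<delta> * m"
      using dense by blast
    have jd: "j < d" using j J by auto
    define v' where "v' = (\<lambda>k. v k + (if k = j then s * \<rho> / m else 0))"
    have v'C: "v' \<in> C" using v j by (auto simp: C_def v'_def)
    have "res v' i = (\<rho> / m) * (m * u i - s * X i j)" for i
    proof -
      have "(\<Sum>k<d. X i k * v' k) = (\<Sum>k<d. X i k * v k) + (\<Sum>k<d. if k = j then X i k * (s * \<rho> / m) else 0)"
        unfolding v'_def sum.distrib[symmetric] by (rule sum.cong) (auto simp: algebra_simps)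
      then have "res v' i = res v i - X i j * (s * \<rho> / m)" using jd by (simp add: res_def)
      moreover have "(\<rho> / m) * (m * u i) = res v i" using \<rho> m by (simp add: u_def)
      ultimately show ?thesis by (simp add: right_diff_distrib mult_ac)
    qed
    then have "L2_set (res v') {..<n} = \<bar>\<rho> / m\<bar> * L2_set (\<lambda>i. m * u i - s * X i j) {..<n}"
      using L2_set_scale[of "\<rho> / m" "\<lambda>i. m * u i - s * X i j" "{..<n}"] by presburger
    also have "\<dots> \<le> \<bar>\<rho> / m\<bar> * (\<delta> * m)" using j(3) by (intro mult_left_mono) auto
    also have "\<dots> = \<rho> * \<delta>" using \<rho> m by simp
    finally have r: "L2_set (res v') {..<n} \<le> \<rho> * \<delta>" .
    have "l1norm d v' \<le> l1norm d v + l1norm d (\<lambda>k. if k = j then s * \<rho> / m else 0)"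
      unfolding v'_def by (rule l1norm_triangle)
    also have "l1norm d (\<lambda>k. if k = j then s * \<rho> / m else 0) = (\<Sum>k<d. if k = j then \<rho> / m else 0)"
      unfolding l1norm_def by (rule sum.cong) (use \<rho> m j(2) in \<open>auto simp: abs_mult\<close>)
    also have "\<dots> = \<rho> / m" using jd by simp
    finally have "c * l1norm d v' \<le> c * (l1norm d v + \<rho> / m)" using c by simp
    also have "\<dots> = c * l1norm d v + (1 - \<delta>') * \<rho>" using m by (simp add: c_def algebra_simps)
    finally have "F v' \<le> \<rho> * \<delta> + (c * l1norm d v + (1 - \<delta>') * \<rho>)" using r by (simp add: F_def)
    also have "\<dots> < F v"
      using mult_strict_left_mono[OF \<delta>(1) \<rho>] by (simp add: F_def \<rho>_def[symmetric] algebra_simps)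
    finally show False using vmin[OF v'C] by simp
  qed
  then have zero: "res v i = 0" if "i < n" for i
    using that by (simp add: \<rho>_def L2_set_eq_0_iff)
  \<comment> \<open>With zero residual, comparing the minimizer with the zero vector bounds the
    penalty by the norm of \<open>y\<close>.\<close>
  have "F v \<le> F (\<lambda>_. 0)" by (rule vmin) (simp add: C_def)
  also have "F (\<lambda>_. 0) = L2_set y {..<n}" by (simp add: F_def res_def l1norm_def)
  finally have "(1 - \<delta>') * m * l1norm d v \<le> L2_set y {..<n}"
    using \<open>\<rho> = 0\<close> by (simp add: F_def \<rho>_def c_def)
  then show thesis
    using v zero by (intro that[of v]) (auto simp: C_def res_def)
qed

section \<open>Gram-Schmidt orthonormalization\<close>

lemma inner_on_sum_right: "inner_on I a (\<lambda>i. \<Sum>s\<in>S. c s * e s i) = (\<Sum>s\<in>S. c s * inner_on I a (e s))"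
  unfolding inner_on_def sum_distrib_left by (subst sum.swap) (simp add: mult_ac)

lemma inner_on_cong: "(\<And>i. i \<in> I \<Longrightarrow> x i = y i) \<Longrightarrow> inner_on I a x = inner_on I a y"
  by (simp add: inner_on_def)

definition orthonormal_on :: "'i set \<Rightarrow> nat \<Rightarrow> (nat \<Rightarrow> 'i \<Rightarrow> real) \<Rightarrow> bool" where
  "orthonormal_on I k e \<longleftrightarrow> (\<forall>s<k. \<forall>t<k. inner_on I (e s) (e t) = (if s = t then 1 else 0))"

text \<open>The residual of each new vector is normalized and appended if it is nonzero and dropped
  otherwise, so dependent families are allowed and only \<open>k \<le> card F\<close> is
  claimed.\<close>

lemma gram_schmidt:
  fixes b :: "'j \<Rightarrow> 'i \<Rightarrow> real"
  assumes I: "finite I" and "finite F"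
  shows "\<exists>k e. k \<le> card F \<and> orthonormal_on I k e \<and>
    (\<forall>j\<in>F. \<forall>i\<in>I. b j i = (\<Sum>s<k. inner_on I (e s) (b j) * e s i))"
  using assms(2)
proof (induction F)
  case empty
  then show ?case by (auto simp: orthonormal_on_def)
next
  case (insert l F)
  then obtain k e where k: "k \<le> card F" and e: "orthonormal_on I k e"
    and b: "\<And>j i. j \<in> F \<Longrightarrow> i \<in> I \<Longrightarrow> b j i = (\<Sum>s<k. inner_on I (e s) (b j) * e s i)" by blast
  define g where "g = (\<lambda>i. b l i - (\<Sum>s<k. inner_on I (e s) (b l) * e s i))"
  have eg: "inner_on I (e t) g = 0" if t: "t < k" for t
  proof -
    have "inner_on I (e t) g = inner_on I (e t) (b l) - inner_on I (e t) (\<lambda>i. \<Sum>s<k. inner_on I (e s) (b l) * e s i)"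
      unfolding g_def by (simp add: inner_on_def right_diff_distrib sum_subtractf)
    also have "inner_on I (e t) (\<lambda>i. \<Sum>s<k. inner_on I (e s) (b l) * e s i)
       = (\<Sum>s<k. if s = t then inner_on I (e s) (b l) else 0)"
      unfolding inner_on_sum_right by (rule sum.cong) (use e t in \<open>auto simp: orthonormal_on_def\<close>)
    finally show ?thesis using t by simp
  qed
  show ?case
  proof (cases "L2_set g I = 0")
    case True
    then have "g i = 0" if "i \<in> I" for i using that I by (simp add: L2_set_eq_0_iff)
    then have "b j i = (\<Sum>s<k. inner_on I (e s) (b j) * e s i)" if "j \<in> insert l F" "i \<in> I" for i j
      using that b by (auto simp: g_def)
    then show ?thesis using k e insert(1,2) by (intro exI[of _ k] exI[of _ e]) auto
  next
    case False
    then have p: "L2_set g I > 0" using L2_set_nonneg[of g I] by linarith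
    define h where "h = (\<lambda>i. inverse (L2_set g I) * g i)"
    define e' where "e' = e(k := h)"
    have hh: "inner_on I h h = 1" using L2_set_normalize[OF p] by (simp add: h_def inner_on_self)
    have eh: "inner_on I (e t) h = 0" "inner_on I h (e t) = 0" if "t < k" for t
      using eg[OF that] inner_on_commute[of I "e t" g]
      by (simp_all add: h_def inner_on_scale_left inner_on_commute[of I "e t"])
    have e'old: "e' s = e s" if "s < k" for s using that by (simp add: e'_def)
    have e'k: "e' k = h" by (simp add: e'_def)
    have "orthonormal_on I (Suc k) e'"
      using e hh eh by (auto simp: orthonormal_on_def e'old e'k less_Suc_eq)
    moreover have "b j i = (\<Sum>s<Suc k. inner_on I (e' s) (b j) * e' s i)" if j: "j \<in> insert l F" and i: "i \<in> I" for i j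
    proof (cases "j = l")
      case True
      have bl: "b l i = g i + (\<Sum>s<k. inner_on I (e s) (b l) * e s i)" for i by (simp add: g_def)
      have "inner_on I h (b l) = inner_on I h g + inner_on I h (\<lambda>i. \<Sum>s<k. inner_on I (e s) (b l) * e s i)"
        by (subst bl[abs_def]) (simp add: inner_on_def distrib_left sum.distrib)
      also have "\<dots> = inner_on I h g" unfolding inner_on_sum_right using eh by simp
      also have "\<dots> = L2_set g I"
        using p by (simp add: h_def inner_on_scale_left inner_on_self power2_eq_square)
      finally have "inner_on I h (b l) * h i = g i" using p by (simp add: h_def)
      then show ?thesis using bl[of i] True by (simp add: e'old e'k)
    next
      case False
      then have jF: "j \<in> F" using j by simp
      have "inner_on I h (b j) = inner_on I h (\<lambda>i. \<Sum>s<k. inner_on I (e s) (b j) * e s i)"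
        by (rule inner_on_cong) (use b[OF jF] in simp)
      also have "\<dots> = 0" unfolding inner_on_sum_right using eh by simp
      finally show ?thesis using b[OF jF i] by (simp add: e'old e'k)
    qed
    ultimately show ?thesis using k insert(1,2) by (intro exI[of _ "Suc k"] exI[of _ e']) auto
  qed
qed

section \<open>Gaussian matrices with few columns\<close>

text \<open>The rank-one matrix \<open>u b^T\<close>. Pairing it with \<open>G\<close> gives the
  bilinear form \<open>u^T G b\<close>, which turns statements about a design in a fixed direction
  into statements about functionals of one Gaussian vector.\<close>

definition tensor :: "('a \<Rightarrow> real) \<Rightarrow> ('b \<Rightarrow> real) \<Rightarrow> 'a \<times> 'b \<Rightarrow> real" where
  "tensor u b = (\<lambda>(i, k). u i * b k)"

lemma inner_on_tensor: "inner_on (I \<times> J) (tensor u b) G = inner_on I u (\<lambda>i. inner_on J b (\<lambda>k. G (i, k)))"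
  by (simp add: inner_on_def tensor_def sum.cartesian_product sum_distrib_left mult_ac case_prod_beta)

lemma inner_on_tensor_tensor:
  "inner_on (I \<times> J) (tensor u b) (tensor v c) = inner_on I u v * inner_on J b c"
  unfolding inner_on_tensor
  by (simp add: inner_on_def tensor_def sum_distrib_left sum_distrib_right mult_ac) (rule sum.swap)

lemma measure_le_Markov:
  assumes "prob_space M" and A: "A \<in> sets M" and f: "f \<in> borel_measurable M" and c: "c > 0"
    and le: "(\<integral>\<^sup>+x. f x \<partial>M) \<le> ennreal C" and C: "C \<ge> 0" and AS: "\<And>x. x \<in> A \<Longrightarrow> ennreal c \<le> f x"
  shows "measure M A \<le> C / c"
proof -
  interpret prob_space M by fact
  have "ennreal (c * measure M A) = (\<integral>\<^sup>+x. ennreal c * indicator A x \<partial>M)"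
    using A c by (subst nn_integral_cmult) (auto simp: emeasure_eq_measure ennreal_mult)
  also have "\<dots> \<le> (\<integral>\<^sup>+x. f x \<partial>M)"
    by (rule nn_integral_mono) (use AS in \<open>auto split: split_indicator\<close>)
  also have "\<dots> \<le> ennreal C" by fact
  finally have "c * measure M A \<le> C" using C by (simp add: ennreal_le_iff)
  then show ?thesis using c by (simp add: field_simps)
qed

text \<open>The tilted density is a multiple of the centred normal density with variance
  \<open>1 / (1 - 2 * b)\<close>.\<close>

lemma nn_integral_std_normal_exp_square:
  fixes b :: real
  assumes b: "b < 1 / 2"
  shows "(\<integral>\<^sup>+z. ennreal (exp (b * z\<^sup>2)) \<partial>std_normal_distribution) = ennreal (1 / sqrt (1 - 2 * b))"
proof -
  define s where "s = 1 / sqrt (1 - 2 * b)"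
  have s: "s > 0" using b by (simp add: s_def)
  have s2: "s\<^sup>2 = 1 / (1 - 2 * b)" using b by (simp add: s_def power_divide)
  have "std_normal_density z * exp (b * z\<^sup>2) = s * normal_density 0 s z" for z
  proof -
    have "- z\<^sup>2 / 2 + b * z\<^sup>2 = - z\<^sup>2 / (2 * s\<^sup>2)" using b by (simp add: s2 field_simps)
    moreover have "sqrt (2 * pi * s\<^sup>2) = sqrt (2 * pi) * s" using s by (simp add: real_sqrt_mult)
    ultimately show ?thesis using s
      by (simp add: normal_density_def std_normal_density_def mult_exp_exp)
  qed
  then have "(\<integral>\<^sup>+z. ennreal (exp (b * z\<^sup>2)) \<partial>std_normal_distribution) = (\<integral>\<^sup>+z. ennreal s * ennreal (normal_density 0 s z) \<partial>lborel)"
    using s by (subst nn_integral_std_normal_eq) (auto simp: ennreal_mult''[symmetric] ennreal_mult[symmetric] intro!: nn_integral_cong)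
  also have "\<dots> = ennreal s * 1"
    using prob_space.emeasure_space_1[OF prob_space_normal_density[OF s, of 0]]
    by (subst nn_integral_cmult) (auto simp: emeasure_density)
  finally show ?thesis by (simp add: s_def)
qed

lemma exp_numeric: "exp (1/4) * (1 / sqrt 3) \<le> (9/10 :: real)" "exp (-1) * sqrt 2 \<le> (9/10 :: real)"
proof -
  have "1 - 1/4 \<le> exp (- (1/4) :: real)" using exp_ge_add_one_self[of "- (1/4) :: real"] by simp
  then have "exp (1/4 :: real) \<le> 4/3" by (simp add: exp_minus field_simps)
  moreover have "1 / sqrt 3 \<le> (27/40 :: real)"
  proof -
    have "40/27 \<le> sqrt (3::real)" by (rule real_le_rsqrt) (simp add: power2_eq_square)
    then show ?thesis by (simp add: field_simps)
  qed
  ultimately have "exp (1/4) * (1 / sqrt 3) \<le> 4/3 * (27/40 :: real)" by (intro mult_mono) auto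
  then show "exp (1/4) * (1 / sqrt 3) \<le> (9/10 :: real)" by simp
  have "exp (-1) \<le> (1/2 :: real)" using exp_ge_add_one_self[of "1::real"] by (simp add: exp_minus field_simps)
  moreover have "sqrt 2 \<le> (9/5 :: real)" by (rule real_le_lsqrt) (auto simp: power2_eq_square)
  ultimately have "exp (-1) * sqrt 2 \<le> (1/2) * (9/5 :: real)" by (intro mult_mono) auto
  then show "exp (-1) * sqrt 2 \<le> (9/10 :: real)" by simp
qed

text \<open>Exponential Markov inequalities with exponents -1 and 1/4, whose per-coordinate moments
  are \<open>1 / sqrt 3\<close> and \<open>sqrt 2\<close>. At the thresholds \<open>n / 4\<close>
  and \<open>4 * n\<close> the resulting bases are those of \<open>exp_numeric\<close>, both below
  9/10.\<close>

lemma chi_square_tails: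
  fixes a :: "nat \<Rightarrow> 'i \<Rightarrow> real"
  assumes I: "finite I" and a: "orthonormal_on I n a"
  shows "measure (gauss I) {x \<in> space (gauss I). (\<Sum>i<n. (inner_on I (a i) x)\<^sup>2) < real n / 4} \<le> (9/10) ^ n"
    and "measure (gauss I) {x \<in> space (gauss I). (\<Sum>i<n. (inner_on I (a i) x)\<^sup>2) > 4 * real n} \<le> (9/10) ^ n"
proof -
  let ?S = "\<lambda>x. \<Sum>i<n. (inner_on I (a i) x)\<^sup>2"
  have E: "(\<integral>\<^sup>+x. ennreal (exp (b * ?S x)) \<partial>gauss I) = ennreal ((1 / sqrt (1 - 2 * b)) ^ n)" if b: "b < 1/2" for b
  proof -
    have "(\<integral>\<^sup>+x. ennreal (exp (b * ?S x)) \<partial>gauss I) = (\<integral>\<^sup>+x. (\<Prod>i<n. ennreal (exp (b * (inner_on I (a i) x)\<^sup>2))) \<partial>gauss I)"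
      by (simp add: prod_ennreal exp_sum sum_distrib_left)
    also have "\<dots> = (\<Prod>i<n. \<integral>\<^sup>+z. ennreal (exp (b * z\<^sup>2)) \<partial>std_normal_distribution)"
      by (rule nn_integral_gauss_orthonormal[OF I, where f="\<lambda>_ z. ennreal (exp (b * z\<^sup>2))"])
         (use a in \<open>auto simp: orthonormal_on_def\<close>)
    also have "\<dots> = ennreal ((1 / sqrt (1 - 2 * b)) ^ n)"
      using b unfolding nn_integral_std_normal_exp_square[OF b] by (simp add: ennreal_power)
    finally show ?thesis .
  qed
  have m: "(\<lambda>x. ennreal (exp (b * ?S x))) \<in> borel_measurable (gauss I)" for b by measurable
  have "measure (gauss I) {x \<in> space (gauss I). ?S x < real n / 4} \<le> (1 / sqrt 3) ^ n / exp (- real n / 4)"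
    by (rule measure_le_Markov[OF prob_space_gauss _ m[of "-1"]])
       (use E[of "-1"] in \<open>measurable, auto intro!: ennreal_leI simp del: space_PiM\<close>)
  also have "\<dots> = (exp (1/4) * (1 / sqrt 3)) ^ n"
    by (simp add: power_mult_distrib exp_minus power_divide exp_of_nat_mult[symmetric] field_simps)
  also have "\<dots> \<le> (9/10) ^ n" by (intro power_mono exp_numeric) auto
  finally show "measure (gauss I) {x \<in> space (gauss I). ?S x < real n / 4} \<le> (9/10) ^ n" .
  have "measure (gauss I) {x \<in> space (gauss I). ?S x > 4 * real n} \<le> (sqrt 2) ^ n / exp (real n)"
    by (rule measure_le_Markov[OF prob_space_gauss _ m[of "1/4"]])
       (use E[of "1/4"] in \<open>measurable, auto intro!: ennreal_leI simp: real_sqrt_divide simp del: space_PiM\<close>)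
  also have "\<dots> = (exp (-1) * sqrt 2) ^ n"
    by (simp add: power_mult_distrib exp_minus power_divide exp_of_nat_mult[symmetric] field_simps)
  also have "\<dots> \<le> (9/10) ^ n" by (intro power_mono exp_numeric) auto
  finally show "measure (gauss I) {x \<in> space (gauss I). ?S x > 4 * real n} \<le> (9/10) ^ n" .
qed

lemma nn_integral_gauss_second_moment:
  assumes I: "finite I"
  shows "(\<integral>\<^sup>+x. ennreal ((inner_on I a x)\<^sup>2) \<partial>gauss I) = ennreal (inner_on I a a)"
proof (cases "L2_set a I = 0")
  case True
  then have "inner_on I a x = 0" for x using I by (simp add: L2_set_eq_0_iff inner_on_def)
  then show ?thesis by simp
next
  case False
  then have p: "L2_set a I > 0" using L2_set_nonneg[of a I] by linarith
  define h where "h = (\<lambda>i. inverse (L2_set a I) * a i)"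
  have h: "inner_on I h h = 1" using L2_set_normalize[OF p] by (simp add: h_def inner_on_self)
  have ah: "inner_on I a x = L2_set a I * inner_on I h x" for x using p by (simp add: h_def inner_on_scale_left)
  have "(\<integral>\<^sup>+x. ennreal ((inner_on I a x)\<^sup>2) \<partial>gauss I) = (\<integral>\<^sup>+x. ennreal ((L2_set a I)\<^sup>2) * ennreal ((inner_on I h x)\<^sup>2) \<partial>gauss I)"
    unfolding ah by (simp add: power_mult_distrib ennreal_mult)
  also have "\<dots> = ennreal ((L2_set a I)\<^sup>2) * (\<integral>\<^sup>+x. ennreal ((inner_on I h x)\<^sup>2) \<partial>gauss I)"
    by (rule nn_integral_cmult) measurable
  also have "(\<integral>\<^sup>+x. ennreal ((inner_on I h x)\<^sup>2) \<partial>gauss I) = (\<integral>\<^sup>+z. ennreal (z\<^sup>2) \<partial>std_normal_distribution)"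
    by (rule nn_integral_gauss_unit[where J="{()}" and a="\<lambda>_. h", OF I]) (use h in auto)
  finally show ?thesis by (simp add: nn_integral_std_normal_square inner_on_self)
qed

lemma orthonormal_tensor_rows:
  assumes "inner_on J f f = 1"
  shows "orthonormal_on ({..<n} \<times> J) n (\<lambda>i. tensor (\<lambda>k. if k = i then 1 else 0) f)"
  using assms by (auto simp: orthonormal_on_def inner_on_tensor_tensor inner_on_unit)

text \<open>For a unit vector \<open>v\<close> the combination \<open>f v\<close> of the orthonormal
  \<open>e s\<close> is a unit vector, so the image of \<open>v\<close> has independent standard
  normal entries and \<open>chi_square_tails\<close> applies. The union over the net costs
  \<open>K ^ r\<close> with \<open>K\<close> free of all dimensions, which is affordable when
  \<open>r\<close> is a small fraction of \<open>n\<close>.\<close>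

lemma gaussian_matrix_lower_bound:
  obtains K :: nat where "K \<ge> 1"
    "\<And>(n::nat) (d::nat) r e. orthonormal_on {..<d} r e \<Longrightarrow>
      \<exists>Bad \<in> sets (gauss ({..<n} \<times> {..<d})). measure (gauss ({..<n} \<times> {..<d})) Bad \<le> real (K ^ r) * (2 * (9/10) ^ n) \<and>
       (\<forall>G \<in> space (gauss ({..<n} \<times> {..<d})) - Bad. \<forall>\<theta>.
          1/4 * sqrt n * L2_set \<theta> {..<r} \<le> L2_set (mat_vec r (\<lambda>i s. inner_on {..<d} (e s) (\<lambda>k. G (i, k))) \<theta>) {..<n})"
proof -
  obtain K where K1: "K \<ge> 1" and K: "\<And>r. \<exists>N. sphere_net r (1/9) N \<and> card N \<le> K ^ r"
    by (rule sphere_net_exists[of "1/9"]) auto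
  show thesis
  proof (rule that[OF K1])
    fix n d r :: nat and e assume e: "orthonormal_on {..<d} r e"
    let ?I = "{..<n} \<times> {..<d}"
    interpret G: prob_space "gauss ?I" by (rule prob_space_gauss)
    have I: "finite ?I" by simp
    obtain N where N: "sphere_net r (1/9) N" and cN: "card N \<le> K ^ r" using K by blast
    have fN: "finite N" using N by (simp add: sphere_net_def)
    define f where "f v = (\<lambda>k. \<Sum>s<r. v s * e s k)" for v :: "nat \<Rightarrow> real"
    define a where "a v = (\<lambda>i. tensor (\<lambda>k. if k = i then 1 else 0) (f v) :: nat \<times> nat \<Rightarrow> real)" for v
    have fe: "inner_on {..<d} (f v) x = (\<Sum>s<r. v s * inner_on {..<d} (e s) x)" for v x
      unfolding inner_on_commute[of _ _ x] f_def by (simp add: inner_on_sum_right inner_on_commute[of _ x])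
    have ef: "inner_on {..<d} (e t) (f v) = v t" if "t < r" for t v
    proof -
      have "inner_on {..<d} (e t) (f v) = (\<Sum>s<r. v s * inner_on {..<d} (e t) (e s))"
        unfolding f_def by (rule inner_on_sum_right)
      also have "\<dots> = (\<Sum>s<r. if s = t then v s else 0)"
        by (rule sum.cong) (use e that in \<open>auto simp: orthonormal_on_def\<close>)
      finally show ?thesis using that by simp
    qed
    have ff: "inner_on {..<d} (f v) (f v) = 1" if "v \<in> N" for v
    proof -
      have "inner_on {..<d} (f v) (f v) = inner_on {..<r} v v" using ef by (simp add: fe inner_on_def[of "{..<r}"])
      then show ?thesis using N that by (simp add: inner_on_self sphere_net_def)
    qed
    have a: "orthonormal_on ?I n (a v)" if "v \<in> N" for v
      unfolding a_def by (rule orthonormal_tensor_rows[OF ff[OF that]])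
    let ?W = "\<lambda>G. (\<lambda>i s. inner_on {..<d} (e s) (\<lambda>k. G (i, k)))"
    have aW: "inner_on ?I (a v i) G = mat_vec r (?W G) v i" if "i < n" for v i and G :: "nat \<times> nat \<Rightarrow> real"
      using that by (simp add: a_def inner_on_tensor inner_on_unit fe mat_vec_def mult.commute)
    let ?S = "\<lambda>v x. \<Sum>i<n. (inner_on ?I (a v i) x)\<^sup>2"
    have SW: "?S v G = (L2_set (mat_vec r (?W G) v) {..<n})\<^sup>2" for v G
      by (simp add: aW L2_set_def sum_nonneg)
    define B1 where "B1 v = {x \<in> space (gauss ?I). ?S v x < real n / 4}" for v
    define B2 where "B2 v = {x \<in> space (gauss ?I). ?S v x > 4 * real n}" for v
    have B: "B1 v \<in> sets (gauss ?I)" "B2 v \<in> sets (gauss ?I)" for v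
      unfolding B1_def B2_def by measurable
    define Bad where "Bad = (\<Union>v\<in>N. B1 v \<union> B2 v)"
    have "Bad \<in> sets (gauss ?I)" unfolding Bad_def using B fN by auto
    moreover have "measure (gauss ?I) Bad \<le> real (K ^ r) * (2 * (9/10) ^ n)"
    proof -
      have "measure (gauss ?I) Bad \<le> (\<Sum>v\<in>N. measure (gauss ?I) (B1 v \<union> B2 v))"
        unfolding Bad_def by (rule G.finite_measure_subadditive_finite) (use B fN in auto)
      also have "\<dots> \<le> (\<Sum>v\<in>N. 2 * (9/10) ^ n)"
      proof (rule sum_mono)
        fix v assume v: "v \<in> N"
        have "measure (gauss ?I) (B1 v \<union> B2 v) \<le> measure (gauss ?I) (B1 v) + measure (gauss ?I) (B2 v)"
          by (rule measure_Un_le[OF B])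
        also have "\<dots> \<le> (9/10) ^ n + (9/10) ^ n"
          unfolding B1_def B2_def by (intro add_mono chi_square_tails[OF I a[OF v]])
        finally show "measure (gauss ?I) (B1 v \<union> B2 v) \<le> 2 * (9/10) ^ n" by simp
      qed
      also have "\<dots> = real (card N) * (2 * (9/10) ^ n)" by simp
      also have "\<dots> \<le> real (K ^ r) * (2 * (9/10) ^ n)"
        using cN by (intro mult_right_mono) (simp_all only: of_nat_le_iff, simp)
      finally show ?thesis .
    qed
    moreover have "1/4 * sqrt n * L2_set \<theta> {..<r} \<le> L2_set (mat_vec r (?W G) \<theta>) {..<n}"
      if G: "G \<in> space (gauss ?I) - Bad" for G \<theta>
    proof -
      \<comment> \<open>The mesh 1/9 is chosen so that \<open>1/2 - (1/9) * 2 / (8/9) = 1/4\<close>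
        stays positive.\<close>
      have "(1/2 * sqrt n - 1/9 * (2 * sqrt n) / (1 - 1/9)) * L2_set \<theta> {..<r} \<le> L2_set (mat_vec r (?W G) \<theta>) {..<n}"
      proof (rule sphere_net_operator_bound[OF N])
        fix v assume v: "v \<in> N"
        have GB: "G \<notin> B1 v" "G \<notin> B2 v" "G \<in> space (gauss ?I)" using G v unfolding Bad_def by blast+
        have "\<not> ?S v G < real n / 4" using GB(1,3) unfolding B1_def by blast
        then have b1: "real n / 4 \<le> ?S v G" by linarith
        have "\<not> ?S v G > 4 * real n" using GB(2,3) unfolding B2_def by blast
        then have b2: "?S v G \<le> 4 * real n" by linarith
        show "L2_set (mat_vec r (?W G) v) {..<n} \<le> 2 * sqrt n"
          by (rule power2_le_imp_le) (use b2 in \<open>simp_all add: SW power_mult_distrib\<close>)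
        show "1/2 * sqrt n \<le> L2_set (mat_vec r (?W G) v) {..<n}"
        proof (rule power2_le_imp_le)
          have "(1/2 * sqrt n)\<^sup>2 = real n / 4" by (simp add: power_mult_distrib power_divide)
          then show "(1/2 * sqrt n)\<^sup>2 \<le> (L2_set (mat_vec r (?W G) v) {..<n})\<^sup>2" using b1 unfolding SW by linarith
        qed (rule L2_set_nonneg)
      qed auto
      then show ?thesis by simp
    qed
    ultimately show "\<exists>Bad \<in> sets (gauss ?I). measure (gauss ?I) Bad \<le> real (K ^ r) * (2 * (9/10) ^ n) \<and>
       (\<forall>G \<in> space (gauss ?I) - Bad. \<forall>\<theta>. 1/4 * sqrt n * L2_set \<theta> {..<r} \<le> L2_set (mat_vec r (?W G) \<theta>) {..<n})"
      by blast
  qed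
qed

section \<open>Dvoretzky's theorem for independent columns\<close>

lemma L2_set_diff_square:
  "(L2_set (\<lambda>i. x i - y i) I)\<^sup>2 = (L2_set x I)\<^sup>2 - 2 * inner_on I x y + (L2_set y I)\<^sup>2"
  unfolding inner_on_self[symmetric]
  by (simp add: inner_on_def algebra_simps sum.distrib sum_subtractf sum_distrib_left)

text \<open>The upper bound on the net makes every column at most slightly longer than
  \<open>E\<close>, while some column has a component of almost \<open>E\<close> along the net point
  \<open>v\<close>; so up to sign that column is nearly \<open>E * v\<close>. Quantitatively the
  squared distance is at most \<open>(12 * \<delta> + 16 * \<delta>\<^sup>2) * E\<^sup>2\<close>,
  giving \<open>4 * sqrt \<delta> * E\<close>, and replacing \<open>v\<close> by \<open>u\<close>
  adds one more \<open>sqrt \<delta> * E\<close>.\<close>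

lemma dvoretzky_geometry:
  fixes X :: "nat \<Rightarrow> nat \<Rightarrow> real" and \<delta> E :: real
  assumes N: "sphere_net n \<delta> N" and \<delta>: "0 < \<delta>" "\<delta> \<le> 1/4" and E: "E > 0"
    and up: "\<And>v j. v \<in> N \<Longrightarrow> j \<in> J \<Longrightarrow> \<bar>inner_on {..<n} v (\<lambda>i. X i j)\<bar> \<le> (1 + 2 * \<delta>) * E"
    and low: "\<And>v. v \<in> N \<Longrightarrow> \<exists>j\<in>J. \<bar>inner_on {..<n} v (\<lambda>i. X i j)\<bar> > (1 - 2 * \<delta>) * E"
  shows "j \<in> J \<Longrightarrow> L2_set (\<lambda>i. X i j) {..<n} \<le> (1 + 4 * \<delta>) * E"
    and "L2_set u {..<n} = 1 \<Longrightarrow>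
      \<exists>j\<in>J. \<exists>s. \<bar>s\<bar> = 1 \<and> L2_set (\<lambda>i. E * u i - s * X i j) {..<n} \<le> 5 * sqrt \<delta> * E"
proof -
  show col: "L2_set (\<lambda>i. X i j) {..<n} \<le> (1 + 4 * \<delta>) * E" if j: "j \<in> J" for j
  proof -
    have "(1 - \<delta>) * L2_set (\<lambda>i. X i j) {..<n} \<le> (1 + 2 * \<delta>) * E"
      by (rule sphere_net_norm_bound[OF N]) (use up j E \<delta> in auto)
    also have "\<dots> \<le> ((1 - \<delta>) * (1 + 4 * \<delta>)) * E"
      using E \<delta> mult_left_mono[of \<delta> "1/4" "4 * \<delta>"] by (intro mult_right_mono) (auto simp: algebra_simps)
    finally have "(1 - \<delta>) * L2_set (\<lambda>i. X i j) {..<n} \<le> (1 - \<delta>) * ((1 + 4 * \<delta>) * E)" by (simp add: mult.assoc)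
    then show ?thesis using \<delta> by simp
  qed
  show "\<exists>j\<in>J. \<exists>s. \<bar>s\<bar> = 1 \<and> L2_set (\<lambda>i. E * u i - s * X i j) {..<n} \<le> 5 * sqrt \<delta> * E"
    if u: "L2_set u {..<n} = 1"
  proof -
    obtain v where v: "v \<in> N" "L2_set (\<lambda>i. u i - v i) {..<n} \<le> \<delta>"
      using N u by (auto simp: sphere_net_def)
    have v1: "L2_set v {..<n} = 1" using N v by (auto simp: sphere_net_def)
    obtain j where j: "j \<in> J" "\<bar>inner_on {..<n} v (\<lambda>i. X i j)\<bar> > (1 - 2 * \<delta>) * E" using low[OF v(1)] by blast
    define s :: real where "s = (if inner_on {..<n} v (\<lambda>i. X i j) \<ge> 0 then 1 else -1)"
    have s: "\<bar>s\<bar> = 1" "s\<^sup>2 = 1" by (auto simp: s_def)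
    have sv: "inner_on {..<n} v (\<lambda>i. s * X i j) > (1 - 2 * \<delta>) * E"
      using j(2) by (auto simp: s_def inner_on_def sum_negf split: if_splits)
    have "(L2_set (\<lambda>i. E * v i - s * X i j) {..<n})\<^sup>2
      = E\<^sup>2 - 2 * E * inner_on {..<n} v (\<lambda>i. s * X i j) + (L2_set (\<lambda>i. X i j) {..<n})\<^sup>2"
      unfolding L2_set_diff_square inner_on_scale_left L2_set_scale using v1 s by (simp add: power_mult_distrib)
    also have "\<dots> \<le> E\<^sup>2 - 2 * E * ((1 - 2 * \<delta>) * E) + ((1 + 4 * \<delta>) * E)\<^sup>2"
    proof -
      have "E * ((1 - 2 * \<delta>) * E) \<le> E * inner_on {..<n} v (\<lambda>i. s * X i j)"
        using sv E by (intro mult_left_mono) auto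
      moreover have "(L2_set (\<lambda>i. X i j) {..<n})\<^sup>2 \<le> ((1 + 4 * \<delta>) * E)\<^sup>2"
        by (intro power_mono col j L2_set_nonneg)
      ultimately show ?thesis by linarith
    qed
    also have "\<dots> = (12 * \<delta> + 16 * \<delta>\<^sup>2) * E\<^sup>2" by (simp add: power2_eq_square algebra_simps)
    also have "\<dots> \<le> (16 * \<delta>) * E\<^sup>2"
      using \<delta> mult_left_mono[of \<delta> "1/4" "16 * \<delta>"] by (intro mult_right_mono) (auto simp: power2_eq_square)
    also have "\<dots> = (4 * sqrt \<delta> * E)\<^sup>2" using \<delta> by (simp add: power_mult_distrib)
    finally have 1: "L2_set (\<lambda>i. E * v i - s * X i j) {..<n} \<le> 4 * sqrt \<delta> * E"
      by (rule power2_le_imp_le) (use E \<delta> in auto)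
    have "L2_set (\<lambda>i. E * (u i - v i)) {..<n} = E * L2_set (\<lambda>i. u i - v i) {..<n}"
      using E by (simp add: L2_set_scale)
    also have "\<dots> \<le> E * sqrt \<delta>"
    proof -
      have "\<delta> \<le> sqrt \<delta>" by (rule real_le_rsqrt) (use \<delta> in \<open>simp add: power2_eq_square mult_left_le\<close>)
      then show ?thesis using v(2) E by (intro mult_left_mono) auto
    qed
    finally have 2: "L2_set (\<lambda>i. E * (u i - v i)) {..<n} \<le> E * sqrt \<delta>" .
    have "L2_set (\<lambda>i. E * u i - s * X i j) {..<n} = L2_set (\<lambda>i. E * (u i - v i) + (E * v i - s * X i j)) {..<n}"
      by (simp add: algebra_simps)
    also have "\<dots> \<le> E * sqrt \<delta> + 4 * sqrt \<delta> * E"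
      by (rule order_trans[OF L2_set_triangle_ineq]) (use 1 2 in linarith)
    finally show ?thesis using j(1) s(1) by (intro bexI[of _ j] exI[of _ s]) (auto simp: algebra_simps)
  qed
qed

text \<open>For fixed \<open>v\<close> in the net, the inner products of \<open>v\<close> with the
  columns are independent normals with variances \<open>A j j\<close>, so the two tail sum estimates
  control their maximum. The constants depend only on \<open>\<eta>\<close>; the factor
  \<open>K ^ n\<close> is the price of the net and must be beaten by the exponential in the
  effective rank.\<close>

lemma dvoretzky_columns:
  fixes \<eta> :: real
  assumes \<eta>: "0 < \<eta>" "\<eta> \<le> 1"
  obtains K :: nat and c :: real and C :: real where "K \<ge> 1" "c > 0" "C > 0"
    "\<And>(n::nat) d B A (L::real). (\<And>j. j < d \<Longrightarrow> 0 \<le> A j j \<and> A j j \<le> L) \<Longrightarrow> L > 0 \<Longrightarrow>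
      (\<And>j k. j < d \<Longrightarrow> k < d \<Longrightarrow> A j j > 0 \<Longrightarrow> A k k > 0 \<Longrightarrow>
         inner_on {..<d} (B j) (B k) = (if j = k then A j j else 0)) \<Longrightarrow>
      L \<le> c * (diag_gauss_sup d A)\<^sup>2 \<Longrightarrow>
      \<exists>Bad \<in> sets (gauss ({..<n} \<times> {..<d})).
        measure (gauss ({..<n} \<times> {..<d})) Bad \<le> C * real (K ^ n) * exp (- c * (diag_gauss_sup d A)\<^sup>2 / L) \<and>
        (\<forall>G \<in> space (gauss ({..<n} \<times> {..<d})) - Bad.
          (\<forall>j<d. A j j > 0 \<longrightarrow> L2_set (\<lambda>i. design d B G i j) {..<n} \<le> (1 + \<eta>) * diag_gauss_sup d A) \<and>
          (\<forall>u. L2_set u {..<n} = 1 \<longrightarrow> (\<exists>j<d. A j j > 0 \<and> (\<exists>s. \<bar>s\<bar> = 1 \<and>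
             L2_set (\<lambda>i. diag_gauss_sup d A * u i - s * design d B G i j) {..<n} \<le> \<eta> * diag_gauss_sup d A))))"
proof -
  \<comment> \<open>Makes the distance \<open>5 * sqrt \<delta>\<close> of
    \<open>dvoretzky_geometry\<close> equal to \<open>\<eta>\<close>.\<close>
  define \<delta> where "\<delta> = (\<eta> / 5)\<^sup>2"
  have sq: "5 * sqrt \<delta> = \<eta>" using \<eta> by (simp add: \<delta>_def)
  have \<delta>0: "\<delta> > 0" using \<eta> by (simp add: \<delta>_def)
  have \<eta>2: "\<eta>\<^sup>2 \<le> \<eta>" using \<eta> by (simp add: power2_eq_square mult_left_le)
  then have \<delta>: "\<delta> \<le> 1/4" "4 * \<delta> \<le> \<eta>" using \<eta> by (auto simp: \<delta>_def power_divide)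
  obtain K where K1: "K \<ge> 1" and K: "\<And>n. \<exists>N. sphere_net n \<delta> N \<and> card N \<le> K ^ n"
    using sphere_net_exists[OF \<delta>0] by metis
  \<comment> \<open>The first entry secures the hypothesis of \<open>tail_sum_below\<close>; the
    second is the common exponential rate of both failure probabilities.\<close>
  define c where "c = min (\<delta>\<^sup>2) (\<delta> / 2)"
  have c: "c > 0" "c \<le> \<delta>\<^sup>2" "c \<le> \<delta> / 2" using \<delta>0 by (auto simp: c_def)
  show thesis
  proof (rule that[OF K1 c(1), of "2 / \<delta> + 1"])
    show "2 / \<delta> + 1 > 0" using \<delta>0 by (simp add: add_pos_pos)
    fix n d :: nat and B A :: "nat \<Rightarrow> nat \<Rightarrow> real" and L :: real
    assume A: "\<And>j. j < d \<Longrightarrow> 0 \<le> A j j \<and> A j j \<le> L" and L: "L > (0::real)"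
      and B: "\<And>j k. j < d \<Longrightarrow> k < d \<Longrightarrow> A j j > 0 \<Longrightarrow> A k k > 0 \<Longrightarrow>
         inner_on {..<d} (B j) (B k) = (if j = k then A j j else 0)"
      and big: "L \<le> c * (diag_gauss_sup d A)\<^sup>2"
    define E where "E = diag_gauss_sup d A"
    define J where "J = {j. j < d \<and> A j j > 0}"
    have big': "L \<le> \<delta>\<^sup>2 * E\<^sup>2" using big c(2) mult_right_mono[OF c(2), of "E\<^sup>2"] by (simp add: E_def)
    have "E \<ge> 0" unfolding E_def by (rule diag_gauss_sup_nonneg)
    moreover have "E \<noteq> 0" using big' L by auto
    ultimately have E: "E > 0" by linarith
    let ?I = "{..<n} \<times> {..<d}"
    interpret G: prob_space "gauss ?I" by (rule prob_space_gauss)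
    have I: "finite ?I" by simp
    have J: "finite J" by (simp add: J_def)
    obtain N where N: "sphere_net n \<delta> N" and cN: "card N \<le> K ^ n" using K by blast
    have fN: "finite N" using N by (simp add: sphere_net_def)
    define a where "a v j = tensor v (\<lambda>k. inverse (sqrt (A j j)) * B j k)" for v :: "nat \<Rightarrow> real" and j
    have a: "inner_on ?I (a v j) (a v k) = (if j = k then 1 else 0)" if "v \<in> N" "j \<in> J" "k \<in> J" for v j k
    proof -
      have "inner_on {..<n} v v = 1" using N that by (simp add: inner_on_self sphere_net_def)
      moreover have "inner_on {..<d} (\<lambda>i. inverse (sqrt (A j j)) * B j i) (\<lambda>i. inverse (sqrt (A k k)) * B k i)
        = inverse (sqrt (A j j)) * (inverse (sqrt (A k k)) * inner_on {..<d} (B j) (B k))"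
        by (simp only: inner_on_scale_left inner_on_commute[of _ "B j"])
      moreover have "inverse (sqrt (A j j)) * (inverse (sqrt (A k k)) * inner_on {..<d} (B j) (B k)) = (if j = k then 1 else 0)"
      proof -
        have "inverse (sqrt x) * (inverse (sqrt x) * x) = 1" if "x > 0" for x :: real
          using that real_sqrt_mult_self[of x] by (simp add: field_simps)
        then show ?thesis using B[of j k] that by (auto simp: J_def)
      qed
      ultimately show ?thesis
        unfolding a_def inner_on_tensor_tensor by simp
    qed
    have aX: "sqrt (A j j) * \<bar>inner_on ?I (a v j) G\<bar> = \<bar>inner_on {..<n} v (\<lambda>i. design d B G i j)\<bar>" if "j \<in> J" for v j G
    proof -
      have "inner_on ?I (a v j) G = inverse (sqrt (A j j)) * inner_on {..<n} v (\<lambda>i. design d B G i j)"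
        unfolding a_def inner_on_tensor inner_on_scale_left design_def inner_on_commute[of _ v] inner_on_scale_left
        by (simp add: inner_on_def inner_on_commute)
      then show ?thesis using that by (simp add: J_def abs_mult)
    qed
    let ?t1 = "(1 + 2 * \<delta>) * E" and ?t2 = "(1 - 2 * \<delta>) * E"
    have t: "?t1 \<ge> 0" "?t2 \<ge> 0" using E \<delta> \<delta>0 by auto
    have tail: "(\<Sum>j\<in>J. gtail (A j j) t) = (\<Sum>j<d. gtail (A j j) t)" if "t \<ge> 0" for t
    proof (rule sum.mono_neutral_left)
      show "\<forall>j\<in>{..<d} - J. gtail (A j j) t = 0"
      proof
        fix j assume "j \<in> {..<d} - J"
        then have "A j j = 0" using A[of j] by (auto simp: J_def)
        then show "gtail (A j j) t = 0" using gtail_0[OF that] by simp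
      qed
    qed (auto simp: J_def)
    define B1 where "B1 v = {x \<in> space (gauss ?I). \<exists>j\<in>J. ?t1 < sqrt (A j j) * \<bar>inner_on ?I (a v j) x\<bar>}" for v
    define B2 where "B2 v = {x \<in> space (gauss ?I). \<forall>j\<in>J. sqrt (A j j) * \<bar>inner_on ?I (a v j) x\<bar> \<le> ?t2}" for v
    have BB: "B1 v \<in> sets (gauss ?I)" "B2 v \<in> sets (gauss ?I)" for v
      unfolding B1_def B2_def using J by measurable
    define x where "x = exp (\<delta> * E\<^sup>2 / (2 * L))"
    have m1: "measure (gauss ?I) (B1 v) \<le> 2 / \<delta> * inverse x" if "v \<in> N" for v
    proof -
      have "measure (gauss ?I) (B1 v) \<le> (\<Sum>j\<in>J. gtail (A j j) ?t1)"
        unfolding B1_def by (rule gauss_some_large[OF I J a[OF that]])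
      also have "\<dots> \<le> exp (- (\<delta> * E\<^sup>2 / L)) * (2 / \<delta>)"
        unfolding tail[OF t(1)] unfolding E_def
        by (rule tail_sum_above[where d=d and A=A, OF A L \<delta>0 \<delta>(1)]) (use E in \<open>auto simp: E_def\<close>)
      also have "\<dots> \<le> exp (- (\<delta> * E\<^sup>2 / (2 * L))) * (2 / \<delta>)"
        using \<delta>0 L by (intro mult_right_mono) (auto simp: field_simps)
      finally show ?thesis by (simp add: x_def exp_minus mult.commute)
    qed
    have m2: "measure (gauss ?I) (B2 v) \<le> inverse x" if "v \<in> N" for v
    proof -
      have "measure (gauss ?I) (B2 v) \<le> exp (- (\<Sum>j\<in>J. gtail (A j j) ?t2))"
        unfolding B2_def by (rule gauss_all_small[OF I J a[OF that]])
      also have "\<dots> \<le> exp (- x)"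
        unfolding tail[OF t(2)] x_def unfolding E_def
        using tail_sum_below[where d=d and A=A, OF A L \<delta>0 \<delta>(1)] big' by (simp add: E_def)
      \<comment> \<open>The doubly exponential bound is weakened to the single exponential that the
        upper tail provides anyway.\<close>
      also have "\<dots> \<le> inverse x"
      proof -
        have "x \<le> exp x" using exp_ge_add_one_self[of x] by linarith
        moreover have "x > 0" by (simp add: x_def)
        ultimately show ?thesis by (simp add: exp_minus le_imp_inverse_le)
      qed
      finally show ?thesis .
    qed
    define Bad where "Bad = (\<Union>v\<in>N. B1 v \<union> B2 v)"
    have "Bad \<in> sets (gauss ?I)" unfolding Bad_def using BB fN by auto
    moreover have "measure (gauss ?I) Bad \<le> (2 / \<delta> + 1) * real (K ^ n) * exp (- c * E\<^sup>2 / L)"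
    proof -
      have "measure (gauss ?I) Bad \<le> (\<Sum>v\<in>N. measure (gauss ?I) (B1 v \<union> B2 v))"
        unfolding Bad_def by (rule G.finite_measure_subadditive_finite) (use BB fN in auto)
      also have "\<dots> \<le> (\<Sum>v\<in>N. (2 / \<delta> + 1) * inverse x)"
      proof (rule sum_mono)
        fix v assume v: "v \<in> N"
        have "measure (gauss ?I) (B1 v \<union> B2 v) \<le> measure (gauss ?I) (B1 v) + measure (gauss ?I) (B2 v)"
          by (rule measure_Un_le[OF BB])
        then show "measure (gauss ?I) (B1 v \<union> B2 v) \<le> (2 / \<delta> + 1) * inverse x"
          using m1[OF v] m2[OF v] by (simp add: algebra_simps)
      qed
      also have "\<dots> = real (card N) * ((2 / \<delta> + 1) * inverse x)" by simp
      also have "\<dots> \<le> real (K ^ n) * ((2 / \<delta> + 1) * exp (- c * E\<^sup>2 / L))"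
      proof (rule mult_mono)
        show "real (card N) \<le> real (K ^ n)" using cN by (simp only: of_nat_le_iff)
        have "c * E\<^sup>2 / L \<le> \<delta> / 2 * E\<^sup>2 / L" using c(3) L by (intro divide_right_mono mult_right_mono) auto
        then have "inverse x \<le> exp (- c * E\<^sup>2 / L)" by (simp add: x_def exp_minus[symmetric] mult.commute)
        then show "(2 / \<delta> + 1) * inverse x \<le> (2 / \<delta> + 1) * exp (- c * E\<^sup>2 / L)"
          using \<delta>0 by (intro mult_left_mono) auto
        show "0 \<le> (2 / \<delta> + 1) * inverse x" using \<delta>0 by (simp add: x_def)
      qed simp
      finally show ?thesis by (simp add: mult_ac)
    qed
    moreover have "(\<forall>j<d. A j j > 0 \<longrightarrow> L2_set (\<lambda>i. design d B G i j) {..<n} \<le> (1 + \<eta>) * E) \<and>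
          (\<forall>u. L2_set u {..<n} = 1 \<longrightarrow> (\<exists>j<d. A j j > 0 \<and> (\<exists>s. \<bar>s\<bar> = 1 \<and>
             L2_set (\<lambda>i. E * u i - s * design d B G i j) {..<n} \<le> \<eta> * E)))"
      if G: "G \<in> space (gauss ?I) - Bad" for G
    proof -
      have up: "\<bar>inner_on {..<n} v (\<lambda>i. design d B G i j)\<bar> \<le> ?t1" if "v \<in> N" "j \<in> J" for v j
      proof -
        have "G \<notin> B1 v" "G \<in> space (gauss ?I)" using G that unfolding Bad_def by blast+
        then have "\<not> ?t1 < sqrt (A j j) * \<bar>inner_on ?I (a v j) G\<bar>"
          using that unfolding B1_def by blast
        then show ?thesis using aX[OF that(2)] by simp
      qed
      have low: "\<exists>j\<in>J. \<bar>inner_on {..<n} v (\<lambda>i. design d B G i j)\<bar> > ?t2" if "v \<in> N" for v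
      proof -
        have "G \<notin> B2 v" "G \<in> space (gauss ?I)" using G that unfolding Bad_def by blast+
        then have "\<exists>j\<in>J. \<not> sqrt (A j j) * \<bar>inner_on ?I (a v j) G\<bar> \<le> ?t2"
          unfolding B2_def by blast
        then show ?thesis using aX by force
      qed
      note geo = dvoretzky_geometry[OF N \<delta>0 \<delta>(1) E up low]
      have "(1 + 4 * \<delta>) * E \<le> (1 + \<eta>) * E" using \<delta> E by (intro mult_right_mono) auto
      then show ?thesis
        using geo(1) geo(2)[unfolded sq] unfolding J_def by (blast intro: order_trans)
    qed
    ultimately show "\<exists>Bad \<in> sets (gauss ?I).
        measure (gauss ?I) Bad \<le> (2 / \<delta> + 1) * real (K ^ n) * exp (- c * (diag_gauss_sup d A)\<^sup>2 / L) \<and>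
        (\<forall>G \<in> space (gauss ?I) - Bad.
          (\<forall>j<d. A j j > 0 \<longrightarrow> L2_set (\<lambda>i. design d B G i j) {..<n} \<le> (1 + \<eta>) * diag_gauss_sup d A) \<and>
          (\<forall>u. L2_set u {..<n} = 1 \<longrightarrow> (\<exists>j<d. A j j > 0 \<and> (\<exists>s. \<bar>s\<bar> = 1 \<and>
             L2_set (\<lambda>i. diag_gauss_sup d A * u i - s * design d B G i j) {..<n} \<le> \<eta> * diag_gauss_sup d A))))"
      unfolding E_def[symmetric] by blast
  qed
qed

section \<open>The low-rank part and its correlation with the noise\<close>

lemma psd_diag_nonneg:
  assumes "psd d A" "j < d"
  shows "0 \<le> A j j"
proof -
  let ?x = "\<lambda>i. if i = j then 1 else 0 :: real"
  have "(\<Sum>i<d. \<Sum>k<d. ?x i * A i k * ?x k) = (\<Sum>i<d. if i = j then A i j else 0)"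
    by (rule sum.cong) (use assms(2) in \<open>auto simp: if_distrib[of "\<lambda>c. _ * c"] cong: if_cong\<close>)
  also have "\<dots> = A j j" using assms(2) by simp
  moreover have "0 \<le> (\<Sum>i<d. \<Sum>k<d. ?x i * A i k * ?x k)"
    using assms(1) unfolding psd_def by (elim conjE allE[of _ ?x])
  ultimately show ?thesis by simp
qed

lemma inner_on_diff_right: "inner_on I x (\<lambda>i. a i - b i) = inner_on I x a - inner_on I x b"
  by (simp add: inner_on_def right_diff_distrib sum_subtractf)

text \<open>In a set of maximal size, adjoining a further column creates a relation, and
  independence of the old columns forces a nonzero coefficient on the new one.\<close>

lemma max_independent_columns:
  obtains J where "cols_indep d A J" "card J = mrank d A"
    "\<And>j. j < d \<Longrightarrow> j \<notin> J \<Longrightarrow> \<exists>c. \<forall>i<d. A i j = (\<Sum>l\<in>J. c l * A i l)"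
proof -
  let ?S = "{J. cols_indep d A J}"
  have "?S \<subseteq> Pow {..<d}" by (auto simp: cols_indep_def)
  then have fin: "finite ?S" by (rule finite_subset) simp
  have "{} \<in> ?S" by (simp add: cols_indep_def)
  then have "mrank d A \<in> card ` ?S" unfolding mrank_def using fin by (intro Max_in) auto
  then obtain J where J: "cols_indep d A J" and card: "card J = mrank d A" by auto
  have Jd: "J \<subseteq> {..<d}" and fJ: "finite J"
    using J finite_subset[of J "{..<d}"] by (auto simp: cols_indep_def)
  show thesis
  proof (rule that[OF J card])
    fix j assume j: "j < d" "j \<notin> J"
    have "\<not> cols_indep d A (insert j J)"
    proof
      assume "cols_indep d A (insert j J)"
      then have "card (insert j J) \<le> mrank d A" unfolding mrank_def using fin by (intro Max_ge) auto
      then show False using j fJ card by simp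
    qed
    then obtain c l where c: "\<And>i. i < d \<Longrightarrow> (\<Sum>j\<in>insert j J. c j * A i j) = 0" and l: "l \<in> insert j J" "c l \<noteq> 0"
      using Jd j(1) by (auto simp: cols_indep_def)
    have c': "c j * A i j + (\<Sum>l\<in>J. c l * A i l) = 0" if "i < d" for i
      using c[OF that] fJ j(2) by simp
    have cj: "c j \<noteq> 0"
    proof
      assume 0: "c j = 0"
      then have "\<forall>i<d. (\<Sum>l\<in>J. c l * A i l) = 0" using c' by auto
      then have "\<forall>l\<in>J. c l = 0" using J by (auto simp: cols_indep_def)
      then show False using l 0 by auto
    qed
    have "A i j = (\<Sum>l\<in>J. (- c l / c j) * A i l)" if "i < d" for i
    proof -
      have "c j * A i j = - (\<Sum>l\<in>J. c l * A i l)" using c'[OF that] by linarith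
      then have "A i j = - (\<Sum>l\<in>J. c l * A i l) / c j" using cj by (simp add: field_simps)
      then show ?thesis by (simp add: sum_negf[symmetric] sum_divide_distrib)
    qed
    then show "\<exists>c. \<forall>i<d. A i j = (\<Sum>l\<in>J. c l * A i l)" by (intro exI[of _ "\<lambda>l. - c l / c j"]) blast
  qed
qed

context
  fixes d :: nat and S S1 S2 B :: "nat \<Rightarrow> nat \<Rightarrow> real"
  assumes factor: "\<And>i j. i < d \<Longrightarrow> j < d \<Longrightarrow> S i j = inner_on {..<d} (B i) (B j)"
    and split: "cov_split d S S1 S2" and diag: "is_diag d S2"
begin

text \<open>For diagonal \<open>S2\<close> the orthogonality relation reduces to the single product
  \<open>S1 j i * S2 j j = 0\<close>. Thus \<open>S\<close> is block diagonal: \<open>S1\<close>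
  lives on the zero coordinates of \<open>S2\<close>, and the positive ones carry a purely diagonal
  block.\<close>

lemma split_zero:
  assumes "i < d" "j < d" "S2 j j \<noteq> 0"
  shows "S1 j i = 0" "S1 i j = 0"
proof -
  have "0 = (\<Sum>k<d. S1 k i * S2 k j)" using split assms by (simp add: cov_split_def)
  also have "\<dots> = (\<Sum>k<d. if k = j then S1 j i * S2 j j else 0)"
    by (rule sum.cong) (use diag assms in \<open>auto simp: is_diag_def\<close>)
  finally show "S1 j i = 0" using assms by simp
  then show "S1 i j = 0" using split assms by (simp add: cov_split_def psd_def)
qed

lemma split_inner: "i < d \<Longrightarrow> j < d \<Longrightarrow> inner_on {..<d} (B i) (B j) = S1 i j + S2 i j"
  using factor split by (simp add: cov_split_def)

lemma split_inner_diag: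
  assumes "j < d" "k < d" "S2 j j > 0" "S2 k k > 0"
  shows "inner_on {..<d} (B j) (B k) = (if j = k then S2 j j else 0)"
  using split_inner[of j k] split_zero[of k j] assms diag by (auto simp: is_diag_def)

text \<open>On the zero coordinates of \<open>S2\<close> the Gram matrix of the rows of
  \<open>B\<close> is \<open>S1\<close>, so linear relations between columns of \<open>S1\<close>
  lift to relations between rows of \<open>B\<close>. Orthonormalizing the rows at independent
  columns therefore spans all of them, with at most \<open>mrank d S1\<close> directions.\<close>

lemma low_rank_rows:
  obtains r e where "r \<le> mrank d S1" "orthonormal_on {..<d} r e"
    "\<And>j i. j < d \<Longrightarrow> S2 j j = 0 \<Longrightarrow> i < d \<Longrightarrow> B j i = (\<Sum>s<r. inner_on {..<d} (e s) (B j) * e s i)"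
proof -
  obtain J where J: "cols_indep d S1 J" and card: "card J = mrank d S1"
    and dep: "\<And>j. j < d \<Longrightarrow> j \<notin> J \<Longrightarrow> \<exists>c. \<forall>i<d. S1 i j = (\<Sum>l\<in>J. c l * S1 i l)"
    by (rule max_independent_columns[of d S1]) blast
  have Jd: "J \<subseteq> {..<d}" and fJ: "finite J"
    using J finite_subset[of J "{..<d}"] by (auto simp: cols_indep_def)
  \<comment> \<open>A nonzero entry of \<open>S2\<close> annihilates the corresponding column of
    \<open>S1\<close>, and a zero column cannot belong to an independent set.\<close>
  have J0: "S2 l l = 0" if l: "l \<in> J" for l
  proof (rule ccontr)
    assume "S2 l l \<noteq> 0"
    then have z: "S1 i l = 0" if "i < d" for i using split_zero(2)[OF that] l Jd by auto
    let ?c = "\<lambda>j. if j = l then 1 else 0 :: real"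
    have "(\<Sum>j\<in>J. ?c j * S1 i j) = 0" if "i < d" for i
      by (rule sum.neutral) (use z[OF that] in auto)
    moreover have "(\<forall>i<d. (\<Sum>j\<in>J. ?c j * S1 i j) = 0) \<longrightarrow> (\<forall>j\<in>J. ?c j = 0)"
      using J unfolding cols_indep_def by (elim conjE allE[of _ ?c])
    ultimately have "?c l = 0" using l by blast
    then show False by simp
  qed
  obtain k e where ke: "k \<le> card J \<and> orthonormal_on {..<d} k e \<and>
    (\<forall>j\<in>J. \<forall>i\<in>{..<d}. B j i = (\<Sum>s<k. inner_on {..<d} (e s) (B j) * e s i))"
    using gram_schmidt[OF finite_lessThan fJ, of d B] by (elim exE)
  then have k: "k \<le> card J" and e: "orthonormal_on {..<d} k e" by blast+
  have b: "B j i = (\<Sum>s<k. inner_on {..<d} (e s) (B j) * e s i)" if "j \<in> J" "i \<in> {..<d}" for j i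
    using ke that by blast
  show thesis
  proof (rule that[of k e])
    show "k \<le> mrank d S1" using k card by simp
    show "orthonormal_on {..<d} k e" by (rule e)
    fix j i assume j: "j < d" "S2 j j = 0" and i: "i < d"
    show "B j i = (\<Sum>s<k. inner_on {..<d} (e s) (B j) * e s i)"
    proof (cases "j \<in> J")
      case False
      then obtain c where c: "\<And>i. i < d \<Longrightarrow> S1 i j = (\<Sum>l\<in>J. c l * S1 i l)" using dep[OF j(1)] by blast
      \<comment> \<open>The column relation of \<open>S1\<close> says that \<open>x\<close> is
        orthogonal to every row in the zero block. Since \<open>x\<close> is a combination of such
        rows, it is orthogonal to itself and vanishes.\<close>
      define x where "x = (\<lambda>i. B j i - (\<Sum>l\<in>J. c l * B l i))"
      have orth: "inner_on {..<d} (B m) x = 0" if m: "m < d" "S2 m m = 0" for m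
      proof -
        have z: "S2 m l = 0" if "l < d" "S2 l l = 0" for l using m that diag by (cases "m = l") (auto simp: is_diag_def)
        have "inner_on {..<d} (B m) x = inner_on {..<d} (B m) (B j) - (\<Sum>l\<in>J. c l * inner_on {..<d} (B m) (B l))"
          unfolding x_def inner_on_diff_right inner_on_sum_right ..
        also have "(\<Sum>l\<in>J. c l * inner_on {..<d} (B m) (B l)) = (\<Sum>l\<in>J. c l * S1 m l)"
          by (rule sum.cong) (use split_inner m J0 z Jd in auto)
        finally show ?thesis using split_inner[OF m(1) j(1)] z[OF j] c[OF m(1)] by simp
      qed
      have "inner_on {..<d} x x = inner_on {..<d} x (B j) - (\<Sum>l\<in>J. c l * inner_on {..<d} x (B l))"
        by (subst (2) x_def) (simp only: inner_on_diff_right inner_on_sum_right)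
      also have "\<dots> = 0" using orth j J0 Jd by (auto simp: inner_on_commute[of _ x] intro!: sum.neutral)
      finally have x0: "x i = 0" if "i < d" for i using that by (simp add: inner_on_self L2_set_eq_0_iff)
      have Bj: "B j i = (\<Sum>l\<in>J. c l * B l i)" if "i < d" for i using x0[OF that] by (simp add: x_def)
      have "inner_on {..<d} (e s) (B j) = (\<Sum>l\<in>J. c l * inner_on {..<d} (e s) (B l))" for s
        unfolding inner_on_sum_right[symmetric] by (rule inner_on_cong) (use Bj in auto)
      then have "(\<Sum>s<k. inner_on {..<d} (e s) (B j) * e s i) = (\<Sum>s<k. \<Sum>l\<in>J. c l * (inner_on {..<d} (e s) (B l) * e s i))"
        by (simp add: sum_distrib_right mult.assoc)
      also have "\<dots> = (\<Sum>l\<in>J. c l * (\<Sum>s<k. inner_on {..<d} (e s) (B l) * e s i))"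
        by (subst sum.swap) (simp add: sum_distrib_left)
      also have "\<dots> = (\<Sum>l\<in>J. c l * B l i)"
      proof (rule sum.cong[OF refl])
        fix l assume "l \<in> J"
        then have "B l i = (\<Sum>s<k. inner_on {..<d} (e s) (B l) * e s i)" by (rule b) (use i in simp)
        from this[symmetric]
        show "c l * (\<Sum>s<k. inner_on {..<d} (e s) (B l) * e s i) = c l * B l i" by (rule arg_cong)
      qed
      finally show ?thesis using Bj[OF i] by simp
    next
      case True
      show ?thesis by (rule b[OF True]) (use i in simp)
    qed
  qed
qed

end

text \<open>\<open>T\<close> is the squared norm of \<open>W^T z\<close>, where \<open>W\<close> is
  the Gaussian matrix in the basis \<open>e\<close> and \<open>z\<close> the noise. For fixed
  \<open>z\<close> each of its \<open>r\<close> entries has second moment |z|^2, so \<open>T\<close>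
  has mean \<open>r * n\<close>, and Markov's inequality finishes.\<close>

lemma noise_correlation_tail:
  fixes n d r :: nat and e :: "nat \<Rightarrow> nat \<Rightarrow> real" and t :: real
  assumes e: "orthonormal_on {..<d} r e" and t: "t > 0"
  defines "T \<equiv> (\<lambda>\<omega>. \<Sum>s<r. (inner_on {..<n} (snd \<omega>) (\<lambda>i. inner_on {..<d} (e s) (\<lambda>k. fst \<omega> (i, k))))\<^sup>2)"
  shows "{\<omega> \<in> space (sample_space n d). T \<omega> > t} \<in> sets (sample_space n d)"
    and "measure (sample_space n d) {\<omega> \<in> space (sample_space n d). T \<omega> > t} \<le> real r * real n / t"
proof -
  let ?M1 = "gauss ({..<n} \<times> {..<d})" and ?M2 = "gauss {..<n}"
  interpret M1: prob_space ?M1 by (rule prob_space_gauss)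
  interpret M2: prob_space ?M2 by (rule prob_space_gauss)
  interpret P: pair_prob_space ?M1 ?M2 ..
  have f: "(\<lambda>\<omega>. fst \<omega> p) \<in> borel_measurable (?M1 \<Otimes>\<^sub>M ?M2)" if "p \<in> {..<n} \<times> {..<d}" for p
    by (rule measurable_compose[OF measurable_fst]) (use that in measurable)
  have g: "(\<lambda>\<omega>. snd \<omega> i) \<in> borel_measurable (?M1 \<Otimes>\<^sub>M ?M2)" if "i \<in> {..<n}" for i
    by (rule measurable_compose[OF measurable_snd]) (use that in measurable)
  have T[measurable]: "T \<in> borel_measurable (?M1 \<Otimes>\<^sub>M ?M2)"
    unfolding T_def inner_on_def
    by (intro borel_measurable_sum borel_measurable_power borel_measurable_times g f borel_measurable_const) auto
  show S: "{\<omega> \<in> space (sample_space n d). T \<omega> > t} \<in> sets (sample_space n d)"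
    unfolding sample_space_def by measurable
  have "(\<integral>\<^sup>+\<omega>. ennreal (T \<omega>) \<partial>(?M1 \<Otimes>\<^sub>M ?M2)) = (\<integral>\<^sup>+z. \<integral>\<^sup>+G. ennreal (T (G, z)) \<partial>?M1 \<partial>?M2)"
    by (rule P.nn_integral_snd[symmetric]) simp
  also have "\<dots> = (\<integral>\<^sup>+z. ennreal (real r) * (\<Sum>i<n. ennreal ((inner_on {..<n} (\<lambda>k. if k = i then 1 else 0) z)\<^sup>2)) \<partial>?M2)"
  proof (rule nn_integral_cong)
    fix z :: "nat \<Rightarrow> real"
    have "T (G, z) = (\<Sum>s<r. (inner_on ({..<n} \<times> {..<d}) (tensor z (e s)) G)\<^sup>2)" for G
      by (simp add: T_def inner_on_tensor)
    then have "(\<integral>\<^sup>+G. ennreal (T (G, z)) \<partial>?M1) = (\<integral>\<^sup>+G. (\<Sum>s<r. ennreal ((inner_on ({..<n} \<times> {..<d}) (tensor z (e s)) G)\<^sup>2)) \<partial>?M1)"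
      by (simp add: sum_ennreal)
    also have "\<dots> = (\<Sum>s<r. \<integral>\<^sup>+G. ennreal ((inner_on ({..<n} \<times> {..<d}) (tensor z (e s)) G)\<^sup>2) \<partial>?M1)"
      by (rule nn_integral_sum) measurable
    also have "\<dots> = (\<Sum>s<r. ennreal (inner_on {..<n} z z))"
      by (rule sum.cong) (use e in \<open>auto simp: nn_integral_gauss_second_moment inner_on_tensor_tensor orthonormal_on_def\<close>)
    also have "\<dots> = ennreal (real r) * ennreal (inner_on {..<n} z z)" by (simp add: ennreal_of_nat_eq_real_of_nat)
    also have "inner_on {..<n} z z = (\<Sum>i<n. (inner_on {..<n} (\<lambda>k. if k = i then 1 else 0) z)\<^sup>2)"
      by (simp add: inner_on_unit) (simp add: inner_on_def power2_eq_square)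
    finally show "(\<integral>\<^sup>+G. ennreal (T (G, z)) \<partial>?M1)
      = ennreal (real r) * (\<Sum>i<n. ennreal ((inner_on {..<n} (\<lambda>k. if k = i then 1 else 0) z)\<^sup>2))"
      by (simp add: sum_ennreal)
  qed
  also have "\<dots> = ennreal (real r) * (\<Sum>i<n. \<integral>\<^sup>+z. ennreal ((inner_on {..<n} (\<lambda>k. if k = i then 1 else 0) z)\<^sup>2) \<partial>?M2)"
    by (subst nn_integral_cmult, measurable, subst nn_integral_sum, measurable)
  also have "\<dots> = ennreal (real r) * (\<Sum>i<n. 1)"
  proof -
    have "(\<integral>\<^sup>+z. ennreal ((inner_on {..<n} (\<lambda>k. if k = i then 1 else 0) z)\<^sup>2) \<partial>?M2) = 1" if "i < n" for i
    proof -
      let ?u = "\<lambda>k. if k = i then 1 else 0 :: real"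
      have "(\<integral>\<^sup>+z. ennreal ((inner_on {..<n} ?u z)\<^sup>2) \<partial>?M2) = ennreal (inner_on {..<n} ?u ?u)"
        by (rule nn_integral_gauss_second_moment) simp
      also have "inner_on {..<n} ?u ?u = 1" using that by (simp add: inner_on_unit)
      finally show ?thesis by simp
    qed
    then show ?thesis by (metis (no_types, lifting) lessThan_iff sum.cong)
  qed
  also have "\<dots> = ennreal (real r * real n)" by (simp add: ennreal_mult ennreal_of_nat_eq_real_of_nat)
  finally have E: "(\<integral>\<^sup>+\<omega>. ennreal (T \<omega>) \<partial>(?M1 \<Otimes>\<^sub>M ?M2)) = ennreal (real r * real n)" .
  show "measure (sample_space n d) {\<omega> \<in> space (sample_space n d). T \<omega> > t} \<le> real r * real n / t"
    unfolding sample_space_def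
  proof (rule measure_le_Markov[where f="\<lambda>\<omega>. ennreal (T \<omega>)"])
    show "prob_space (?M1 \<Otimes>\<^sub>M ?M2)" by (rule P.prob_space_axioms)
    show "{\<omega> \<in> space (?M1 \<Otimes>\<^sub>M ?M2). T \<omega> > t} \<in> sets (?M1 \<Otimes>\<^sub>M ?M2)" using S by (simp only: sample_space_def)
    show "ennreal t \<le> ennreal (T \<omega>)" if "\<omega> \<in> {\<omega> \<in> space (?M1 \<Otimes>\<^sub>M ?M2). T \<omega> > t}" for \<omega>
    proof (rule ennreal_leI)
      have "T \<omega> > t" using that by blast
      then show "t \<le> T \<omega>" by simp
    qed
    show "(\<integral>\<^sup>+\<omega>. ennreal (T \<omega>) \<partial>(?M1 \<Otimes>\<^sub>M ?M2)) \<le> ennreal (real r * real n)" by (simp only: E)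
    show "(\<lambda>\<omega>. ennreal (T \<omega>)) \<in> borel_measurable (?M1 \<Otimes>\<^sub>M ?M2)" by measurable
  qed (use t in simp_all)
qed

section \<open>Deterministic risk bound\<close>

lemma L2_set_zero: "L2_set (\<lambda>i. 0) I = 0"
  by (simp add: L2_set_def)

lemma L2_set_sum_le: "finite J \<Longrightarrow> L2_set (\<lambda>i. \<Sum>j\<in>J. f j i) I \<le> (\<Sum>j\<in>J. L2_set (f j) I)"
proof (induction J rule: finite_induct)
  case (insert j J)
  have "L2_set (\<lambda>i. f j i + (\<Sum>j\<in>J. f j i)) I \<le> L2_set (f j) I + L2_set (\<lambda>i. \<Sum>j\<in>J. f j i) I"
    by (rule L2_set_triangle_ineq)
  then show ?case using insert by simp
qed (simp add: L2_set_zero)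

lemma L2_set_combination_le:
  assumes J: "finite J" and b: "\<And>j. j \<in> J \<Longrightarrow> L2_set (x j) I \<le> b"
  shows "L2_set (\<lambda>i. \<Sum>j\<in>J. c j * x j i) I \<le> b * (\<Sum>j\<in>J. \<bar>c j\<bar>)"
proof -
  have "L2_set (\<lambda>i. \<Sum>j\<in>J. c j * x j i) I \<le> (\<Sum>j\<in>J. L2_set (\<lambda>i. c j * x j i) I)"
    by (rule L2_set_sum_le[OF J])
  also have "\<dots> \<le> (\<Sum>j\<in>J. \<bar>c j\<bar> * b)"
    unfolding L2_set_scale by (intro sum_mono mult_left_mono b) auto
  finally show ?thesis by (simp add: sum_distrib_left mult.commute)
qed

lemma risk_eq:
  assumes S: "\<And>i j. i < d \<Longrightarrow> j < d \<Longrightarrow> S i j = inner_on {..<d} (B i) (B j)"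
  shows "risk d \<sigma> S wstar w = \<sigma>\<^sup>2 + (L2_set (\<lambda>k. \<Sum>j<d. (w j - wstar j) * B j k) {..<d})\<^sup>2"
proof -
  define \<Delta> where "\<Delta> j = w j - wstar j" for j
  have "(\<Sum>i<d. \<Sum>j<d. \<Delta> i * S i j * \<Delta> j) = (\<Sum>i<d. \<Sum>j<d. \<Delta> i * (\<Delta> j * inner_on {..<d} (B i) (B j)))"
    by (intro sum.cong refl) (simp add: S)
  also have "\<dots> = (\<Sum>i<d. \<Delta> i * inner_on {..<d} (B i) (\<lambda>k. \<Sum>j<d. \<Delta> j * B j k))"
    by (simp add: inner_on_sum_right sum_distrib_left)
  also have "\<dots> = inner_on {..<d} (\<lambda>k. \<Sum>j<d. \<Delta> j * B j k) (\<lambda>k. \<Sum>j<d. \<Delta> j * B j k)"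
    by (subst (2) inner_on_sum_right) (simp add: inner_on_commute)
  finally show ?thesis by (simp add: risk_def \<Delta>_def inner_on_self)
qed

lemma quadratic_ineq_bound:
  fixes D a b :: real
  assumes "D\<^sup>2 \<le> b + a * D" "a \<ge> 0" "b \<ge> 0"
  shows "D \<le> a + sqrt b"
proof (rule ccontr)
  assume "\<not> D \<le> a + sqrt b"
  then have D: "D > a + sqrt b" by simp
  have "sqrt b * sqrt b < D * (D - a)"
    using D assms(2,3) by (intro mult_strict_mono') (auto intro: add_nonneg_nonneg)
  then show False using assms by (simp add: power2_eq_square algebra_simps)
qed

text \<open>Square of a sum of two bounds: the first two summands bound the contribution of the
  low-rank part to the error, with the radicand coming from the excess of the residual norm over the
  noise norm, and the last summand bounds the contribution of the diagonal part.\<close>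

definition risk_slack :: "real \<Rightarrow> real \<Rightarrow> real" where
  "risk_slack \<sigma> h = (32 * \<sigma> * h + sqrt (16 * (((1 + 6 * h) * (2 * \<sigma>) + 4 * h)\<^sup>2 - (2 * \<sigma>)\<^sup>2)) + h * (2 * h + 4 * \<sigma>))\<^sup>2"

lemma risk_slack_tendsto: "(risk_slack \<sigma> \<longlongrightarrow> 0) (at_right 0)"
  unfolding risk_slack_def by (auto intro!: tendsto_eq_intros)

context
  fixes n d r :: nat and S A B e :: "nat \<Rightarrow> nat \<Rightarrow> real" and wstar z :: "nat \<Rightarrow> real"
    and G :: "nat \<times> nat \<Rightarrow> real" and \<sigma> h E L :: real
  assumes n: "n > 0" and \<sigma>: "\<sigma> \<ge> 0" and h: "0 < h" "h \<le> 1/4" and E: "E > 0"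
    and S: "\<And>i j. i < d \<Longrightarrow> j < d \<Longrightarrow> S i j = inner_on {..<d} (B i) (B j)"
    and A: "\<And>j. j < d \<Longrightarrow> 0 \<le> A j j \<and> A j j \<le> L"
    and diag: "\<And>j. j < d \<Longrightarrow> A j j > 0 \<Longrightarrow> inner_on {..<d} (B j) (B j) = A j j"
    and e: "orthonormal_on {..<d} r e"
    and rows: "\<And>j i. j < d \<Longrightarrow> A j j = 0 \<Longrightarrow> i < d \<Longrightarrow> B j i = (\<Sum>s<r. inner_on {..<d} (e s) (B j) * e s i)"
    and cols: "\<And>j. j < d \<Longrightarrow> A j j > 0 \<Longrightarrow> L2_set (\<lambda>i. design d B G i j) {..<n} \<le> (1 + h) * E"
    and dense: "\<And>u. L2_set u {..<n} = 1 \<Longrightarrow> \<exists>j<d. A j j > 0 \<and> (\<exists>s. \<bar>s\<bar> = 1 \<and>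
             L2_set (\<lambda>i. E * u i - s * design d B G i j) {..<n} \<le> h * E)"
    and low: "\<And>\<theta>. 1/4 * sqrt n * L2_set \<theta> {..<r} \<le> L2_set (mat_vec r (\<lambda>i s. inner_on {..<d} (e s) (\<lambda>k. G (i, k))) \<theta>) {..<n}"
    and noise: "L2_set z {..<n} \<le> 2 * sqrt n"
    and corr: "L2_set (\<lambda>s. inner_on {..<n} z (\<lambda>i. inner_on {..<d} (e s) (\<lambda>k. G (i, k)))) {..<r} \<le> h * n"
    and signal: "E * l1norm d wstar \<le> h * sqrt n" and eff: "sqrt (n * L) \<le> h * E"
begin

text \<open>Dense columns, used with \<open>\<delta> = h\<close> and
  \<open>\<delta>' = 2 * h\<close>, fit the pure noise at an l1 cost close to its norm divided by
  \<open>E\<close>.\<close>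

lemma noise_interpolator:
  obtains v where "\<And>i. i < n \<Longrightarrow> (\<Sum>j<d. design d B G i j * v j) = \<sigma> * z i"
    "E * l1norm d v \<le> (1 + 4 * h) * L2_set (\<lambda>i. \<sigma> * z i) {..<n}"
proof -
  obtain v where v: "\<And>i. i < n \<Longrightarrow> (\<Sum>j<d. design d B G i j * v j) = \<sigma> * z i"
    and l: "(1 - 2 * h) * E * l1norm d v \<le> L2_set (\<lambda>i. \<sigma> * z i) {..<n}"
  proof (rule exact_solution_of_dense_columns[of "{j. j < d \<and> A j j > 0}" d E h "2 * h" n "design d B G" "\<lambda>i. \<sigma> * z i"])
    show "\<exists>j\<in>{j. j < d \<and> A j j > 0}. \<exists>s. \<bar>s\<bar> = 1 \<and> L2_set (\<lambda>i. E * u i - s * design d B G i j) {..<n} \<le> h * E"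
      if "L2_set u {..<n} = 1" for u
      using dense[OF that] by blast
  qed (use E h in auto)
  \<comment> \<open>\<open>(1 + 4 * h) * (1 - 2 * h) \<ge> 1\<close> holds precisely because
    \<open>h \<le> 1/4\<close>.\<close>
  have "1 * (E * l1norm d v) \<le> ((1 + 4 * h) * (1 - 2 * h)) * (E * l1norm d v)"
    using h E l1norm_nonneg[of d v] mult_left_mono[of h "1/4" "8 * h"]
    by (intro mult_right_mono) (auto simp: algebra_simps)
  also have "\<dots> \<le> (1 + 4 * h) * L2_set (\<lambda>i. \<sigma> * z i) {..<n}"
    using l h by (simp add: mult.assoc mult_left_mono)
  finally show thesis using v by (intro that[of v]) auto
qed

lemma interpolator_of_sum:
  assumes v: "\<And>i. i < n \<Longrightarrow> (\<Sum>j<d. design d B G i j * v j) = \<sigma> * z i"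
  shows "(\<lambda>j. if j < d then wstar j + v j else 0) \<in> interpolators n d (design d B G) (response d \<sigma> B wstar (G, z))"
proof -
  have "(\<Sum>j<d. design d B G i j * (if j < d then wstar j + v j else 0)) = response d \<sigma> B wstar (G, z) i" if "i < n" for i
  proof -
    have "(\<Sum>j<d. design d B G i j * (if j < d then wstar j + v j else 0)) = (\<Sum>j<d. design d B G i j * wstar j + design d B G i j * v j)"
      by (rule sum.cong) (auto simp: algebra_simps)
    then show ?thesis using v[OF that] by (simp add: sum.distrib response_def)
  qed
  then show ?thesis by (simp add: interpolators_def)
qed

lemma min_l1_exists: "min_l1_interpolators n d (design d B G) (response d \<sigma> B wstar (G, z)) \<noteq> {}"
proof -
  obtain v where "\<And>i. i < n \<Longrightarrow> (\<Sum>j<d. design d B G i j * v j) = \<sigma> * z i" by (rule noise_interpolator) blast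
  from interpolator_of_sum[OF this] show ?thesis by (intro min_l1_interpolators_nonempty) blast
qed

text \<open>Comparison with \<open>wstar\<close> plus the noise interpolator bounds the l1 error,
  hence the norm of the fit by the diagonal columns, by nearly the noise norm. Since the low-rank
  fit \<open>y\<close> and this fit add up to the noise, expanding the square shows that
  \<open>y\<close> is small unless it correlates with the noise, which \<open>corr\<close>
  excludes.\<close>

lemma min_l1_risk_bound:
  assumes w: "w \<in> min_l1_interpolators n d (design d B G) (response d \<sigma> B wstar (G, z))"
  shows "\<bar>risk d \<sigma> S wstar w - \<sigma>\<^sup>2\<bar> \<le> risk_slack \<sigma> h"
proof -
  define \<Delta> where "\<Delta> = (\<lambda>j. w j - wstar j)"
  define M where "M = l1norm d \<Delta>"
  define q where "q = L2_set (\<lambda>i. \<sigma> * z i) {..<n}"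
  have M0: "M \<ge> 0" by (simp add: M_def l1norm_nonneg)
  have q0: "q \<ge> 0" by (simp add: q_def L2_set_nonneg)
  have q: "q \<le> 2 * \<sigma> * sqrt n" using mult_left_mono[OF noise \<sigma>] \<sigma> by (simp add: q_def L2_set_scale)
  \<comment> \<open>Density applied to a unit vector, available as \<open>n > 0\<close>, yields an
    index with a positive diagonal entry.\<close>
  have L0: "L \<ge> 0" using A n dense[of "\<lambda>i. if i = 0 then 1 else 0"]
    by (force simp: L2_set_def if_distrib[of "\<lambda>x. x\<^sup>2"] cong: if_cong)
  obtain v where v: "\<And>i. i < n \<Longrightarrow> (\<Sum>j<d. design d B G i j * v j) = \<sigma> * z i" and lv: "E * l1norm d v \<le> (1 + 4 * h) * q"
    unfolding q_def by (rule noise_interpolator) blast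
  have "l1norm d w \<le> l1norm d (\<lambda>j. if j < d then wstar j + v j else 0)"
    using w interpolator_of_sum[OF v] by (simp add: min_l1_interpolators_def)
  also have "\<dots> = l1norm d (\<lambda>j. wstar j + v j)" by (simp add: l1norm_def)
  also have "\<dots> \<le> l1norm d wstar + l1norm d v" by (rule l1norm_triangle)
  finally have "M \<le> 2 * l1norm d wstar + l1norm d v"
    using l1norm_triangle_diff[of d w wstar] by (simp add: M_def \<Delta>_def)
  then have "E * M \<le> E * (2 * l1norm d wstar + l1norm d v)" using E by simp
  then have EM: "E * M \<le> 2 * (h * sqrt n) + (1 + 4 * h) * q"
    using signal lv by (simp add: algebra_simps)

  define K where "K = {j. j < d \<and> A j j = 0}"
  define J where "J = {j. j < d \<and> A j j > 0}"
  have fin: "finite K" "finite J" by (auto simp: K_def J_def)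
  have dec: "(\<Sum>j<d. f j) = (\<Sum>j\<in>K. f j) + (\<Sum>j\<in>J. f j)" for f :: "nat \<Rightarrow> real"
  proof -
    have U: "{..<d} = K \<union> J" using A by (force simp: K_def J_def)
    show ?thesis unfolding U by (rule sum.union_disjoint[OF fin]) (auto simp: K_def J_def)
  qed
  have l1J: "(\<Sum>j\<in>J. \<bar>\<Delta> j\<bar>) \<le> M" unfolding M_def l1norm_def by (rule sum_mono2) (auto simp: J_def)

  \<comment> \<open>The error is split by coordinates: \<open>\<beta>\<close> and
    \<open>\<beta>'\<close> are the images under the transpose of \<open>B\<close> of its parts on
    \<open>K\<close> and \<open>J\<close>, and the excess risk is the squared norm of their sum. In
    the basis \<open>e\<close> the vector \<open>\<beta>\<close> has coefficients
    \<open>\<theta>\<close>, so \<open>y\<close> is the fit of the \<open>K\<close>-part.\<close>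
  define \<beta> where "\<beta> k = (\<Sum>j\<in>K. \<Delta> j * B j k)" for k
  define \<beta>' where "\<beta>' k = (\<Sum>j\<in>J. \<Delta> j * B j k)" for k
  define \<theta> where "\<theta> s = inner_on {..<d} (e s) \<beta>" for s
  define D where "D = L2_set \<theta> {..<r}"
  define W where "W i s = inner_on {..<d} (e s) (\<lambda>k. G (i, k))" for i s
  define y where "y = mat_vec r W \<theta>"
  have D0: "D \<ge> 0" by (simp add: D_def L2_set_nonneg)
  have \<theta>: "\<theta> s = (\<Sum>j\<in>K. \<Delta> j * inner_on {..<d} (e s) (B j))" for s
    unfolding \<theta>_def \<beta>_def by (rule inner_on_sum_right)
  have \<beta>: "\<beta> k = (\<Sum>s<r. \<theta> s * e s k)" if k: "k < d" for k
  proof -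
    have "\<beta> k = (\<Sum>j\<in>K. \<Delta> j * (\<Sum>s<r. inner_on {..<d} (e s) (B j) * e s k))"
      unfolding \<beta>_def
    proof (rule sum.cong[OF refl])
      fix j assume "j \<in> K"
      then have "B j k = (\<Sum>s<r. inner_on {..<d} (e s) (B j) * e s k)"
        by (intro rows k) (simp_all add: K_def)
      then show "\<Delta> j * B j k = \<Delta> j * (\<Sum>s<r. inner_on {..<d} (e s) (B j) * e s k)" by (rule arg_cong)
    qed
    also have "\<dots> = (\<Sum>s<r. \<theta> s * e s k)"
      unfolding \<theta> sum_distrib_left sum_distrib_right by (subst sum.swap) (simp add: mult.assoc)
    finally show ?thesis .
  qed
  have norm\<beta>: "L2_set \<beta> {..<d} = D"
  proof -
    have "inner_on {..<d} \<beta> \<beta> = inner_on {..<d} \<beta> (\<lambda>k. \<Sum>s<r. \<theta> s * e s k)"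
      by (rule inner_on_cong) (simp add: \<beta>)
    also have "\<dots> = (\<Sum>s<r. \<theta> s * \<theta> s)"
      unfolding inner_on_sum_right by (simp add: \<theta>_def inner_on_commute[of _ \<beta>])
    finally have "(L2_set \<beta> {..<d})\<^sup>2 = D\<^sup>2"
      by (simp add: inner_on_self[symmetric] D_def) (simp add: inner_on_def)
    then show ?thesis using D0 L2_set_nonneg[of \<beta> "{..<d}"] by (simp add: power2_eq_iff_nonneg)
  qed
  have yK: "y i = (\<Sum>j\<in>K. design d B G i j * \<Delta> j)" for i
  proof -
    have "y i = inner_on {..<d} (\<lambda>k. G (i, k)) (\<lambda>k. \<Sum>s<r. \<theta> s * e s k)"
      unfolding inner_on_sum_right by (simp add: y_def mat_vec_def W_def inner_on_commute mult.commute)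
    also have "\<dots> = inner_on {..<d} (\<lambda>k. G (i, k)) \<beta>"
      by (rule inner_on_cong) (simp add: \<beta>)
    also have "\<dots> = (\<Sum>j\<in>K. design d B G i j * \<Delta> j)"
      unfolding \<beta>_def inner_on_sum_right by (simp add: design_def inner_on_def mult_ac)
    finally show ?thesis .
  qed
  have resid: "\<sigma> * z i - y i = (\<Sum>j\<in>J. \<Delta> j * design d B G i j)" if i: "i < n" for i
  proof -
    have "(\<Sum>j<d. design d B G i j * w j) = (\<Sum>j<d. design d B G i j * wstar j) + \<sigma> * z i"
      using w i by (simp add: min_l1_interpolators_def interpolators_def response_def)
    then have "\<sigma> * z i = (\<Sum>j<d. design d B G i j * \<Delta> j)"
      by (simp add: \<Delta>_def right_diff_distrib sum_subtractf)
    then show ?thesis unfolding dec yK by (simp add: mult.commute)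
  qed
  have "L2_set (\<lambda>i. \<sigma> * z i - y i) {..<n} = L2_set (\<lambda>i. \<Sum>j\<in>J. \<Delta> j * design d B G i j) {..<n}"
    by (rule L2_set_cong) (simp_all add: resid)
  also have "\<dots> \<le> (1 + h) * E * (\<Sum>j\<in>J. \<bar>\<Delta> j\<bar>)"
    by (rule L2_set_combination_le[where x="\<lambda>j i. design d B G i j", OF fin(2)]) (use cols in \<open>auto simp: J_def\<close>)
  also have "\<dots> \<le> (1 + h) * E * M" using l1J h E by (intro mult_left_mono) auto
  also have "\<dots> = (1 + h) * (E * M)" by simp
  also have "\<dots> \<le> (1 + h) * (2 * (h * sqrt n) + (1 + 4 * h) * q)" using EM h by (intro mult_left_mono) auto
  \<comment> \<open>Terms quadratic in \<open>h\<close> are absorbed with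
    \<open>h \<le> 1/4\<close>; in particular
    \<open>(1 + h) * (1 + 4 * h) \<le> 1 + 6 * h\<close>.\<close>
  also have "\<dots> \<le> (1 + 6 * h) * q + 4 * h * sqrt n"
  proof -
    have hh: "h * h \<le> h * (1/4)" using h by (intro mult_left_mono) auto
    have 1: "h * h * sqrt n \<le> h * sqrt n / 4" using mult_right_mono[OF hh, of "sqrt n"] by simp
    have 2: "h * h * q \<le> h * q / 4" using mult_right_mono[OF hh q0] by simp
    have gen: "2 * a + 2 * a' + q + 5 * b + 4 * b' \<le> q + 6 * b + 4 * a" if "a' \<le> a / 4" "b' \<le> b / 4" "0 \<le> a"
      for a a' b b' :: real using that by linarith
    have "(1 + h) * (2 * (h * sqrt n) + (1 + 4 * h) * q) = 2 * (h * sqrt n) + 2 * (h * h * sqrt n) + q + 5 * (h * q) + 4 * (h * h * q)"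
      by (simp add: algebra_simps)
    moreover have "(1 + 6 * h) * q + 4 * h * sqrt n = q + 6 * (h * q) + 4 * (h * sqrt n)" by (simp add: algebra_simps)
    moreover have "0 \<le> h * sqrt n" using h by simp
    ultimately show ?thesis using gen[OF 1 2] by presburger
  qed
  finally have R: "L2_set (\<lambda>i. \<sigma> * z i - y i) {..<n} \<le> (1 + 6 * h) * q + 4 * h * sqrt n" .
  \<comment> \<open>The excess of the squared bound in \<open>R\<close> over
    \<open>q\<^sup>2\<close> increases with \<open>q\<close>, so it is evaluated at the largest
    value \<open>2 * \<sigma> * sqrt n\<close> and divided by \<open>n\<close>. It vanishes with
    \<open>h\<close> because the leading coefficient of \<open>q\<close> in \<open>R\<close> tends
    to 1.\<close>
  define \<rho> where "\<rho> = ((1 + 6 * h) * (2 * \<sigma>) + 4 * h)\<^sup>2 - (2 * \<sigma>)\<^sup>2"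
  have \<rho>0: "\<rho> \<ge> 0" unfolding \<rho>_def using h \<sigma> by (simp add: power2_eq_square algebra_simps)
  have sn: "sqrt n * sqrt n = real n" by simp
  have R2: "(L2_set (\<lambda>i. \<sigma> * z i - y i) {..<n})\<^sup>2 - q\<^sup>2 \<le> \<rho> * n"
  proof -
    have gen: "x - p \<le> t" if "x \<le> u" "u - p = a + b + c" "a \<le> a'" "b \<le> b'" "a' + b' + c = t"
      for x p t u a b c a' b' :: real using that by linarith
    have 1: "(L2_set (\<lambda>i. \<sigma> * z i - y i) {..<n})\<^sup>2 \<le> ((1 + 6 * h) * q + 4 * h * sqrt n)\<^sup>2"
      by (rule power_mono[OF R L2_set_nonneg])
    have 2: "((1 + 6 * h) * q + 4 * h * sqrt n)\<^sup>2 - q\<^sup>2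
        = (12 * h + 36 * h * h) * q\<^sup>2 + 2 * (1 + 6 * h) * (4 * h * sqrt n) * q + 16 * h * h * (sqrt n * sqrt n)"
      by (simp only: power2_eq_square) (simp only: algebra_simps)
    have 3: "(12 * h + 36 * h * h) * q\<^sup>2 \<le> (12 * h + 36 * h * h) * (2 * \<sigma> * sqrt n)\<^sup>2"
      using h q q0 by (intro mult_left_mono power_mono) auto
    have 4: "2 * (1 + 6 * h) * (4 * h * sqrt n) * q \<le> 2 * (1 + 6 * h) * (4 * h * sqrt n) * (2 * \<sigma> * sqrt n)"
      using h q by (intro mult_left_mono) auto
    have 5: "(12 * h + 36 * h * h) * (2 * \<sigma> * sqrt n)\<^sup>2 + 2 * (1 + 6 * h) * (4 * h * sqrt n) * (2 * \<sigma> * sqrt n)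
       + 16 * h * h * (sqrt n * sqrt n) = \<rho> * (sqrt n * sqrt n)"
      unfolding \<rho>_def by (simp only: power2_eq_square) (simp only: algebra_simps)
    show ?thesis using gen[OF 1 2 3 4 5] unfolding sn .
  qed
  \<comment> \<open>Moving \<open>W\<close> to the other side gives the inner product of
    \<open>W^T z\<close> with \<open>\<theta>\<close>, to which \<open>corr\<close> and
    Cauchy-Schwarz apply.\<close>
  have cross: "inner_on {..<n} (\<lambda>i. \<sigma> * z i) y \<le> \<sigma> * (h * n * D)"
  proof -
    have "inner_on {..<n} z y = inner_on {..<r} (\<lambda>s. inner_on {..<n} z (\<lambda>i. W i s)) \<theta>"
      unfolding y_def mat_vec_def
      by (subst mult.commute, subst inner_on_sum_right) (simp add: inner_on_def[of "{..<r}"] mult.commute)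
    also have "\<dots> \<le> L2_set (\<lambda>s. inner_on {..<n} z (\<lambda>i. W i s)) {..<r} * D"
      using inner_on_Cauchy_Schwarz[of "{..<r}" "\<lambda>s. inner_on {..<n} z (\<lambda>i. W i s)" \<theta>] by (simp add: D_def)
    also have "\<dots> \<le> h * n * D"
      using corr D0 by (intro mult_right_mono) (auto simp: W_def)
    finally show ?thesis unfolding inner_on_scale_left using \<sigma> by (rule mult_left_mono)
  qed
  \<comment> \<open>Expanding the square of \<open>\<sigma> * z - y\<close> isolates the squared
    norm of \<open>y\<close> once the noise norm \<open>q\<^sup>2\<close> cancels; together with
    \<open>low\<close> this is a quadratic inequality for \<open>D\<close>.\<close>
  have "(1/4 * sqrt n * D)\<^sup>2 \<le> (L2_set y {..<n})\<^sup>2"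
    unfolding y_def W_def D_def by (rule power_mono[OF low]) (simp add: L2_set_nonneg)
  also have "\<dots> \<le> \<rho> * n + 2 * (\<sigma> * (h * n * D))"
    using R2 cross unfolding L2_set_diff_square q_def by linarith
  finally have "n * D\<^sup>2 \<le> n * (16 * \<rho> + 32 * \<sigma> * h * D)"
    using sn by (simp add: power_mult_distrib power_divide algebra_simps)
  then have "D\<^sup>2 \<le> 16 * \<rho> + 32 * \<sigma> * h * D" using n by simp
  then have D: "D \<le> 32 * \<sigma> * h + sqrt (16 * \<rho>)"
    by (rule quadratic_ineq_bound) (use \<sigma> h \<rho>0 in auto)

  \<comment> \<open>Here only the l1 norm of the error is used: it is of order
    \<open>sqrt n / E\<close>, and \<open>sqrt L\<close> times this is small by the effective rank
    condition \<open>eff\<close>.\<close>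
  have "L2_set \<beta>' {..<d} \<le> sqrt L * (\<Sum>j\<in>J. \<bar>\<Delta> j\<bar>)"
    unfolding \<beta>'_def
  proof (rule L2_set_combination_le[OF fin(2)])
    fix j assume "j \<in> J"
    then have j: "j < d" "A j j > 0" by (auto simp: J_def)
    have "(L2_set (B j) {..<d})\<^sup>2 \<le> L" using diag[OF j] A[OF j(1)] by (simp add: inner_on_self)
    then show "L2_set (B j) {..<d} \<le> sqrt L" by (rule real_le_rsqrt)
  qed
  also have "\<dots> \<le> sqrt L * M" using l1J L0 by (intro mult_left_mono) auto
  also have "\<dots> \<le> h * (2 * h + 4 * \<sigma>)"
  proof -
    have "(1 + 4 * h) * q \<le> 2 * (2 * \<sigma> * sqrt n)" using h q q0 by (intro mult_mono) auto
    then have "E * M \<le> sqrt n * (2 * h + 4 * \<sigma>)" using EM by (simp add: algebra_simps)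
    then have "sqrt L * (E * M) \<le> sqrt L * (sqrt n * (2 * h + 4 * \<sigma>))" using L0 by (intro mult_left_mono) auto
    also have "\<dots> = sqrt (n * L) * (2 * h + 4 * \<sigma>)" by (simp add: real_sqrt_mult)
    also have "\<dots> \<le> h * E * (2 * h + 4 * \<sigma>)" using eff h \<sigma> by (intro mult_right_mono) auto
    finally have "E * (sqrt L * M) \<le> E * (h * (2 * h + 4 * \<sigma>))" by (simp add: mult_ac)
    then show ?thesis using E by simp
  qed
  finally have \<beta>': "L2_set \<beta>' {..<d} \<le> h * (2 * h + 4 * \<sigma>)" .
  have "risk d \<sigma> S wstar w - \<sigma>\<^sup>2 = (L2_set (\<lambda>k. \<beta> k + \<beta>' k) {..<d})\<^sup>2"
    using risk_eq[where S=S and B=B and d=d, OF S] unfolding dec by (simp add: \<beta>_def \<beta>'_def \<Delta>_def)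
  also have "\<dots> \<le> (32 * \<sigma> * h + sqrt (16 * \<rho>) + h * (2 * h + 4 * \<sigma>))\<^sup>2"
    using L2_set_triangle_ineq[of \<beta> \<beta>' "{..<d}"] D \<beta>' unfolding norm\<beta>
    by (intro power_mono) (auto simp: L2_set_nonneg)
  finally show ?thesis
    using risk_eq[where S=S and B=B and d=d, OF S] by (simp add: risk_slack_def \<rho>_def)
qed

end

section \<open>Convergence in probability\<close>

lemma gtail_pos:
  assumes "l > 0" "t \<ge> 0"
  shows "gtail l t > 0"
proof (rule ccontr)
  let ?f = "\<lambda>z. ennreal (exp (- (t / sqrt l) * \<bar>z\<bar>))"
  assume "\<not> gtail l t > 0"
  then have "ennreal (gtail l t) = 0" using gtail_nonneg[of l t] by simp
  then have "(\<integral>\<^sup>+z. ?f z \<partial>std_normal_distribution) = 0"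
    unfolding gtail_eq[OF assms] by simp
  then have "AE z in std_normal_distribution. ?f z = 0"
    by (subst (asm) nn_integral_0_iff_AE) auto
  then have "AE z in std_normal_distribution. False"
    by eventually_elim simp
  then show False by (simp add: std_normal.AE_const)
qed

lemma diag_gauss_sup_pos:
  assumes A: "\<And>j. j < d \<Longrightarrow> 0 \<le> A j j \<and> A j j \<le> L" and L: "L > 0" and j: "j < d" "A j j > 0"
  shows "diag_gauss_sup d A > 0"
proof -
  have "0 < gtail (A j j) 1" using j by (intro gtail_pos) auto
  also have "\<dots> \<le> (\<Sum>j<d. gtail (A j j) 1)"
    by (rule member_le_sum) (use j in \<open>auto simp: gtail_nonneg\<close>)
  finally have "0 < 1 - exp (- (\<Sum>j<d. gtail (A j j) 1))" by simp
  also have "\<dots> \<le> diag_gauss_sup d A" using diag_gauss_sup_ge[where d=d and A=A, OF A L, of 1] by simp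
  finally show ?thesis .
qed

lemma measure_pair_Times:
  assumes "prob_space M" "prob_space N" "A \<in> sets M" "B \<in> sets N"
  shows "measure (M \<Otimes>\<^sub>M N) (A \<times> B) = measure M A * measure N B"
proof -
  interpret M: prob_space M by fact
  interpret N: prob_space N by fact
  interpret P: pair_prob_space M N ..
  have "ennreal (measure (M \<Otimes>\<^sub>M N) (A \<times> B)) = ennreal (measure M A * measure N B)"
    using N.emeasure_pair_measure_Times[OF assms(3,4)]
    by (simp add: P.emeasure_eq_measure M.emeasure_eq_measure N.emeasure_eq_measure ennreal_mult)
  then show ?thesis by (simp add: ennreal_inj)
qed

lemma noise_norm_tail:
  fixes n :: nat
  defines "Bad \<equiv> {z \<in> space (gauss {..<n}). \<not> L2_set z {..<n} \<le> 2 * sqrt n}"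
  shows "Bad \<in> sets (gauss {..<n})" and "measure (gauss {..<n}) Bad \<le> (9/10) ^ n"
proof -
  let ?u = "\<lambda>i k. if k = i then 1 else 0 :: real"
  have u: "orthonormal_on {..<n} n ?u" by (auto simp: orthonormal_on_def inner_on_unit)
  have "L2_set z {..<n} \<le> 2 * sqrt n \<longleftrightarrow> (\<Sum>i<n. (inner_on {..<n} (?u i) z)\<^sup>2) \<le> 4 * real n" for z
  proof -
    have "(\<Sum>i<n. (inner_on {..<n} (?u i) z)\<^sup>2) = (L2_set z {..<n})\<^sup>2"
      by (simp add: inner_on_unit L2_set_def sum_nonneg)
    moreover have "L2_set z {..<n} \<le> 2 * sqrt n \<longleftrightarrow> (L2_set z {..<n})\<^sup>2 \<le> (2 * sqrt n)\<^sup>2"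
      by (rule power_mono_iff[symmetric]) (simp_all add: L2_set_nonneg)
    ultimately show ?thesis by (simp add: power_mult_distrib)
  qed
  then have eq: "Bad = {z \<in> space (gauss {..<n}). (\<Sum>i<n. (inner_on {..<n} (?u i) z)\<^sup>2) > 4 * real n}"
    unfolding Bad_def by (simp only: not_le)
  show "Bad \<in> sets (gauss {..<n})" unfolding eq by measurable
  show "measure (gauss {..<n}) Bad \<le> (9/10) ^ n"
    unfolding eq by (rule chi_square_tails(2)[OF _ u]) simp
qed

text \<open>The four summands are the failure probabilities of the Dvoretzky event, the conditioning
  of the low-rank Gaussian matrix, the noise norm, and the correlation of the noise with the
  low-rank part. Outside all four, the deterministic bound applies.\<close>

lemma risk_tail_bound:
  fixes h :: real
  assumes h: "0 < h" "h \<le> 1/4"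
  obtains K1 K2 :: nat and c C :: real where "K1 \<ge> 1" "K2 \<ge> 1" "c > 0" "C > 0"
    "\<And>n d S S1 S2 B wstar \<sigma> what L \<epsilon>. n > 0 \<Longrightarrow> \<sigma> \<ge> 0 \<Longrightarrow>
      (\<And>i j. i < d \<Longrightarrow> j < d \<Longrightarrow> S i j = inner_on {..<d} (B i) (B j)) \<Longrightarrow>
      cov_split d S S1 S2 \<Longrightarrow> is_diag d S2 \<Longrightarrow> (\<And>j. j < d \<Longrightarrow> S2 j j \<le> L) \<Longrightarrow> L > 0 \<Longrightarrow>
      L \<le> c * (diag_gauss_sup d S2)\<^sup>2 \<Longrightarrow> diag_gauss_sup d S2 * l1norm d wstar \<le> h * sqrt n \<Longrightarrow>
      sqrt (real n * L) \<le> h * diag_gauss_sup d S2 \<Longrightarrow> risk_slack \<sigma> h \<le> \<epsilon> \<Longrightarrow>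
      (\<And>\<omega>. \<omega> \<in> space (sample_space n d) \<Longrightarrow>
        min_l1_interpolators n d (design d B (fst \<omega>)) (response d \<sigma> B wstar \<omega>) \<noteq> {} \<Longrightarrow>
        what \<omega> \<in> min_l1_interpolators n d (design d B (fst \<omega>)) (response d \<sigma> B wstar \<omega>)) \<Longrightarrow>
      measure (sample_space n d) {\<omega> \<in> space (sample_space n d). \<bar>risk d \<sigma> S wstar (what \<omega>) - \<sigma>\<^sup>2\<bar> > \<epsilon>}
        \<le> C * real (K1 ^ n) * exp (- c * (diag_gauss_sup d S2)\<^sup>2 / L)
          + real (K2 ^ mrank d S1) * (2 * (9/10) ^ n) + (9/10) ^ n + real (mrank d S1) / (h\<^sup>2 * real n)"
proof -
  obtain K1 c C where K1: "K1 \<ge> 1" "c > 0" "C > 0" and dv: "\<And>(n::nat) d B A (L::real). (\<And>j. j < d \<Longrightarrow> 0 \<le> A j j \<and> A j j \<le> L) \<Longrightarrow> L > 0 \<Longrightarrow>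
      (\<And>j k. j < d \<Longrightarrow> k < d \<Longrightarrow> A j j > 0 \<Longrightarrow> A k k > 0 \<Longrightarrow>
         inner_on {..<d} (B j) (B k) = (if j = k then A j j else 0)) \<Longrightarrow>
      L \<le> c * (diag_gauss_sup d A)\<^sup>2 \<Longrightarrow>
      \<exists>Bad \<in> sets (gauss ({..<n} \<times> {..<d})).
        measure (gauss ({..<n} \<times> {..<d})) Bad \<le> C * real (K1 ^ n) * exp (- c * (diag_gauss_sup d A)\<^sup>2 / L) \<and>
        (\<forall>G \<in> space (gauss ({..<n} \<times> {..<d})) - Bad.
          (\<forall>j<d. A j j > 0 \<longrightarrow> L2_set (\<lambda>i. design d B G i j) {..<n} \<le> (1 + h) * diag_gauss_sup d A) \<and>
          (\<forall>u. L2_set u {..<n} = 1 \<longrightarrow> (\<exists>j<d. A j j > 0 \<and> (\<exists>s. \<bar>s\<bar> = 1 \<and>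
             L2_set (\<lambda>i. diag_gauss_sup d A * u i - s * design d B G i j) {..<n} \<le> h * diag_gauss_sup d A))))"
  proof (rule dvoretzky_columns[OF h(1)])
    show "h \<le> 1" using h by simp
  qed blast
  obtain K2 where K2: "K2 \<ge> 1" and lb: "\<And>(n::nat) (d::nat) r e. orthonormal_on {..<d} r e \<Longrightarrow>
      \<exists>Bad \<in> sets (gauss ({..<n} \<times> {..<d})). measure (gauss ({..<n} \<times> {..<d})) Bad \<le> real (K2 ^ r) * (2 * (9/10) ^ n) \<and>
       (\<forall>G \<in> space (gauss ({..<n} \<times> {..<d})) - Bad. \<forall>\<theta>.
          1/4 * sqrt n * L2_set \<theta> {..<r} \<le> L2_set (mat_vec r (\<lambda>i s. inner_on {..<d} (e s) (\<lambda>k. G (i, k))) \<theta>) {..<n})"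
    by (rule gaussian_matrix_lower_bound) blast
  show thesis
  proof (rule that[OF K1(1) K2 K1(2,3)])
    fix n d :: nat and S S1 S2 B :: "nat \<Rightarrow> nat \<Rightarrow> real" and wstar :: "nat \<Rightarrow> real" and \<sigma> L \<epsilon> :: real
      and what :: "(nat \<times> nat \<Rightarrow> real) \<times> (nat \<Rightarrow> real) \<Rightarrow> nat \<Rightarrow> real"
    assume n: "n > 0" and \<sigma>: "\<sigma> \<ge> 0"
      and S: "\<And>i j. i < d \<Longrightarrow> j < d \<Longrightarrow> S i j = inner_on {..<d} (B i) (B j)"
      and split: "cov_split d S S1 S2" and diag: "is_diag d S2"
      and SL: "\<And>j. j < d \<Longrightarrow> S2 j j \<le> L" and L: "L > 0"
      and big: "L \<le> c * (diag_gauss_sup d S2)\<^sup>2"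
      and signal: "diag_gauss_sup d S2 * l1norm d wstar \<le> h * sqrt n"
      and eff: "sqrt (real n * L) \<le> h * diag_gauss_sup d S2" and \<epsilon>: "risk_slack \<sigma> h \<le> \<epsilon>"
      and what: "\<And>\<omega>. \<omega> \<in> space (sample_space n d) \<Longrightarrow>
        min_l1_interpolators n d (design d B (fst \<omega>)) (response d \<sigma> B wstar \<omega>) \<noteq> {} \<Longrightarrow>
        what \<omega> \<in> min_l1_interpolators n d (design d B (fst \<omega>)) (response d \<sigma> B wstar \<omega>)"
    define E where "E = diag_gauss_sup d S2"
    have A: "0 \<le> S2 j j \<and> S2 j j \<le> L" if "j < d" for j
      using split SL[OF that] psd_diag_nonneg[OF _ that] by (simp add: cov_split_def)
    have "E \<ge> 0" unfolding E_def by (rule diag_gauss_sup_nonneg)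
    moreover have "E \<noteq> 0" using big L by (auto simp: E_def)
    ultimately have E: "E > 0" by linarith
    have orth: "inner_on {..<d} (B j) (B k) = (if j = k then S2 j j else 0)"
      if "j < d" "k < d" "S2 j j > 0" "S2 k k > 0" for j k
      by (rule split_inner_diag[OF S split diag that])
    obtain r e where r: "r \<le> mrank d S1" and e: "orthonormal_on {..<d} r e"
      and rows: "\<And>j i. j < d \<Longrightarrow> S2 j j = 0 \<Longrightarrow> i < d \<Longrightarrow> B j i = (\<Sum>s<r. inner_on {..<d} (e s) (B j) * e s i)"
    proof (rule low_rank_rows[where d=d and S=S and ?S1.0=S1 and ?S2.0=S2 and B=B, OF S split diag])
      fix r e assume 1: "r \<le> mrank d S1" "orthonormal_on {..<d} r e"
        and 2: "\<And>j i. j < d \<Longrightarrow> S2 j j = 0 \<Longrightarrow> i < d \<Longrightarrow> B j i = (\<Sum>s<r. inner_on {..<d} (e s) (B j) * e s i)"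
      show thesis by (rule that[OF 1 2])
    qed
    let ?I = "{..<n} \<times> {..<d}"
    let ?M1 = "gauss ?I" and ?M2 = "gauss {..<n}"
    interpret M1: prob_space ?M1 by (rule prob_space_gauss)
    interpret M2: prob_space ?M2 by (rule prob_space_gauss)
    interpret P: pair_prob_space ?M1 ?M2 ..
    obtain B1 where B1: "B1 \<in> sets ?M1" "measure ?M1 B1 \<le> C * real (K1 ^ n) * exp (- c * E\<^sup>2 / L)"
      and cols: "\<And>G j. G \<in> space ?M1 - B1 \<Longrightarrow> j < d \<Longrightarrow> S2 j j > 0 \<Longrightarrow> L2_set (\<lambda>i. design d B G i j) {..<n} \<le> (1 + h) * E"
      and dense: "\<And>G u. G \<in> space ?M1 - B1 \<Longrightarrow> L2_set u {..<n} = 1 \<Longrightarrow> \<exists>j<d. S2 j j > 0 \<and> (\<exists>s. \<bar>s\<bar> = 1 \<and>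
             L2_set (\<lambda>i. E * u i - s * design d B G i j) {..<n} \<le> h * E)"
      using dv[of d S2 L B n, OF A L orth big] unfolding E_def by blast
    obtain B2 where B2: "B2 \<in> sets ?M1" "measure ?M1 B2 \<le> real (K2 ^ r) * (2 * (9/10) ^ n)"
      and low: "\<And>G \<theta>. G \<in> space ?M1 - B2 \<Longrightarrow>
          1/4 * sqrt n * L2_set \<theta> {..<r} \<le> L2_set (mat_vec r (\<lambda>i s. inner_on {..<d} (e s) (\<lambda>k. G (i, k))) \<theta>) {..<n}"
      using lb[OF e, of n] by blast
    define B3 where "B3 = {z \<in> space ?M2. \<not> L2_set z {..<n} \<le> 2 * sqrt n}"
    have B3: "B3 \<in> sets ?M2" "measure ?M2 B3 \<le> (9/10) ^ n"
      unfolding B3_def by (rule noise_norm_tail)+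
    \<comment> \<open>Its square root is the bound \<open>h * n\<close> required by the
      deterministic argument, and Markov's inequality leaves
      \<open>r / (h\<^sup>2 * n)\<close>.\<close>
    define t where "t = (h * real n)\<^sup>2"
    have t: "t > 0" using h n by (simp add: t_def)
    define T where "T \<omega> = (\<Sum>s<r. (inner_on {..<n} (snd \<omega>) (\<lambda>i. inner_on {..<d} (e s) (\<lambda>k. fst \<omega> (i, k))))\<^sup>2)"
      for \<omega> :: "(nat \<times> nat \<Rightarrow> real) \<times> (nat \<Rightarrow> real)"
    define B4 where "B4 = {\<omega> \<in> space (sample_space n d). T \<omega> > t}"
    have B4: "B4 \<in> sets (sample_space n d)" "measure (sample_space n d) B4 \<le> real r * real n / t"
      unfolding B4_def T_def by (rule noise_correlation_tail[OF e t])+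
    have sp: "space (sample_space n d) = space ?M1 \<times> space ?M2"
      by (simp add: sample_space_def space_pair_measure)
    let ?Bad = "((B1 \<times> space ?M2) \<union> (B2 \<times> space ?M2)) \<union> ((space ?M1 \<times> B3) \<union> B4)"
    have sets: "B1 \<times> space ?M2 \<in> sets (sample_space n d)" "B2 \<times> space ?M2 \<in> sets (sample_space n d)"
      "space ?M1 \<times> B3 \<in> sets (sample_space n d)"
      unfolding sample_space_def using B1(1) B2(1) B3(1) by (auto intro: pair_measureI)
    have sub: "{\<omega> \<in> space (sample_space n d). \<bar>risk d \<sigma> S wstar (what \<omega>) - \<sigma>\<^sup>2\<bar> > \<epsilon>} \<subseteq> ?Bad"
    proof
      fix \<omega> assume \<omega>: "\<omega> \<in> {\<omega> \<in> space (sample_space n d). \<bar>risk d \<sigma> S wstar (what \<omega>) - \<sigma>\<^sup>2\<bar> > \<epsilon>}"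
      obtain G z where Gz: "\<omega> = (G, z)" by (cases \<omega>)
      have G: "G \<in> space ?M1" and z: "z \<in> space ?M2" and \<omega>s: "\<omega> \<in> space (sample_space n d)"
        using \<omega> unfolding sp Gz by blast+
      show "\<omega> \<in> ?Bad"
      proof (rule ccontr)
        assume "\<omega> \<notin> ?Bad"
        then have nb: "G \<notin> B1" "G \<notin> B2" "z \<notin> B3" "\<omega> \<notin> B4" using G z unfolding Gz by blast+
        have noise: "L2_set z {..<n} \<le> 2 * sqrt n" using nb(3) z unfolding B3_def by blast
        have "T \<omega> \<le> t" using nb(4) \<omega>s unfolding B4_def by force
        then have "L2_set (\<lambda>s. inner_on {..<n} z (\<lambda>i. inner_on {..<d} (e s) (\<lambda>k. G (i, k)))) {..<r} \<le> sqrt t"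
          unfolding L2_set_def T_def Gz by simp
        also have "sqrt t = h * n" using h by (simp add: t_def)
        finally have corr: "L2_set (\<lambda>s. inner_on {..<n} z (\<lambda>i. inner_on {..<d} (e s) (\<lambda>k. G (i, k)))) {..<r} \<le> h * n" .
        have G1: "G \<in> space ?M1 - B1" and G2: "G \<in> space ?M1 - B2" using G nb by blast+
        have dg: "inner_on {..<d} (B j) (B j) = S2 j j" if "j < d" "S2 j j > 0" for j
          using orth[OF that(1) that(1) that(2) that(2)] by simp
        note core = n \<sigma> h E S A dg e rows cols[OF G1] dense[OF G1] low[OF G2] noise corr
          signal[folded E_def] eff[folded E_def]
        \<comment> \<open>The selector \<open>what\<close> is constrained only where minimizers
          exist, so existence has to be established on the good event first.\<close>
        have "min_l1_interpolators n d (design d B G) (response d \<sigma> B wstar (G, z)) \<noteq> {}"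
          by (rule min_l1_exists[where n=n and d=d and r=r and S=S and A=S2 and B=B and e=e and wstar=wstar and z=z and G=G and \<sigma>=\<sigma> and h=h and E=E and L=L, OF core])
        then have wm: "what \<omega> \<in> min_l1_interpolators n d (design d B G) (response d \<sigma> B wstar (G, z))"
          using what[OF \<omega>s] unfolding Gz by simp
        have "\<bar>risk d \<sigma> S wstar (what \<omega>) - \<sigma>\<^sup>2\<bar> \<le> risk_slack \<sigma> h"
          by (rule min_l1_risk_bound[where n=n and d=d and r=r and S=S and A=S2 and B=B and e=e and wstar=wstar and z=z and G=G and \<sigma>=\<sigma> and h=h and E=E and L=L, OF core wm])
        moreover have "\<bar>risk d \<sigma> S wstar (what \<omega>) - \<sigma>\<^sup>2\<bar> > \<epsilon>" using \<omega> by blast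
        ultimately show False using \<epsilon> by linarith
      qed
    qed
    let ?P = "measure (sample_space n d)"
    interpret Q: prob_space "sample_space n d"
      unfolding sample_space_def by (rule P.prob_space_axioms)
    have "?P {\<omega> \<in> space (sample_space n d). \<bar>risk d \<sigma> S wstar (what \<omega>) - \<sigma>\<^sup>2\<bar> > \<epsilon>} \<le> ?P ?Bad"
      by (rule Q.finite_measure_mono[OF sub]) (intro sets.Un sets B4(1))
    also have "\<dots> \<le> (?P (B1 \<times> space ?M2) + ?P (B2 \<times> space ?M2)) + (?P (space ?M1 \<times> B3) + ?P B4)"
      by (intro order_trans[OF measure_Un_le] add_mono sets.Un sets B4(1) order_refl measure_Un_le)
    also have "?P (B1 \<times> space ?M2) = measure ?M1 B1"
      unfolding sample_space_def
      by (simp add: measure_pair_Times[OF prob_space_gauss prob_space_gauss B1(1)] M2.prob_space)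
    also have "?P (B2 \<times> space ?M2) = measure ?M1 B2"
      unfolding sample_space_def
      by (simp add: measure_pair_Times[OF prob_space_gauss prob_space_gauss B2(1)] M2.prob_space)
    also have "?P (space ?M1 \<times> B3) = measure ?M2 B3"
      unfolding sample_space_def
      by (simp add: measure_pair_Times[OF prob_space_gauss prob_space_gauss _ B3(1)] M1.prob_space)
    also have "(measure ?M1 B1 + measure ?M1 B2) + (measure ?M2 B3 + ?P B4)
      \<le> (C * real (K1 ^ n) * exp (- c * E\<^sup>2 / L) + real (K2 ^ mrank d S1) * (2 * (9/10) ^ n))
        + ((9/10) ^ n + real (mrank d S1) / (h\<^sup>2 * real n))"
    proof (intro add_mono B1 B3)
      have "real (K2 ^ r) \<le> real (K2 ^ mrank d S1)" using K2 r by (simp add: power_increasing)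
      then have "real (K2 ^ r) * (2 * (9/10) ^ n) \<le> real (K2 ^ mrank d S1) * (2 * (9/10) ^ n)"
        by (rule mult_right_mono) simp
      then show "measure ?M1 B2 \<le> real (K2 ^ mrank d S1) * (2 * (9/10) ^ n)"
        using B2(2) by (rule order_trans[rotated])
      have "real r * real n / t = real r / (h\<^sup>2 * real n)"
        using n by (simp add: t_def power2_eq_square field_simps)
      also have "\<dots> \<le> real (mrank d S1) / (h\<^sup>2 * real n)" using r by (intro divide_right_mono) auto
      finally show "?P B4 \<le> real (mrank d S1) / (h\<^sup>2 * real n)" using B4(2) by linarith
    qed
    finally show "?P {\<omega> \<in> space (sample_space n d). \<bar>risk d \<sigma> S wstar (what \<omega>) - \<sigma>\<^sup>2\<bar> > \<epsilon>}
        \<le> C * real (K1 ^ n) * exp (- c * (diag_gauss_sup d S2)\<^sup>2 / L)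
          + real (K2 ^ mrank d S1) * (2 * (9/10) ^ n) + (9/10) ^ n + real (mrank d S1) / (h\<^sup>2 * real n)"
      unfolding E_def by (simp add: add.assoc)
  qed
qed

text \<open>In the first bound the summand 1 beside \<open>ln K\<close> leaves a spare
  \<open>exp (-1) ^ n\<close>. In the second the net factor consumes at most half of the exponent of
  \<open>(9/10) ^ n\<close>, whence the square root.\<close>

lemma geometric_decay_bounds:
  fixes K n :: nat and x :: real
  assumes K: "K \<ge> 1"
  shows "(ln K + 1) * n \<le> x \<Longrightarrow> real (K ^ n) * exp (- x) \<le> exp (-1) ^ n"
    and "(ln K + 1) * m \<le> - ln (9/10) / 2 * n \<Longrightarrow> real (K ^ m) * (9/10) ^ n \<le> sqrt (9/10) ^ n"
proof -
  have Ke: "real (K ^ n) = exp (n * ln K)" for n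
    using K by (simp add: exp_of_nat_mult)
  show "real (K ^ n) * exp (- x) \<le> exp (-1) ^ n" if "(ln K + 1) * n \<le> x"
    using that unfolding Ke by (simp add: mult_exp_exp exp_of_nat_mult[symmetric] algebra_simps)
  show "real (K ^ m) * (9/10) ^ n \<le> sqrt (9/10) ^ n" if "(ln K + 1) * m \<le> - ln (9/10) / 2 * n"
  proof -
    have "(9/10 :: real) ^ n = exp (n * ln (9/10))" by (simp add: exp_of_nat_mult)
    moreover have "sqrt (9/10) ^ n = exp (n * (ln (9/10) / 2))"
      by (simp add: exp_of_nat_mult ln_sqrt[symmetric])
    moreover have "m * ln K + n * ln (9/10) \<le> n * (ln (9/10) / 2)"
      using that by (simp add: algebra_simps)
    ultimately show ?thesis unfolding Ke by (simp add: mult_exp_exp)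
  qed
qed

theorem theorem9:
  fixes d :: "nat \<Rightarrow> nat"
    and \<Sigma> \<Sigma>1 \<Sigma>2 B :: "nat \<Rightarrow> nat \<Rightarrow> nat \<Rightarrow> real"
    and wstar :: "nat \<Rightarrow> nat \<Rightarrow> real"
    and \<sigma> :: real
    and what :: "nat \<Rightarrow> (nat \<times> nat \<Rightarrow> real) \<times> (nat \<Rightarrow> real) \<Rightarrow> nat \<Rightarrow> real"
  assumes sigma_nonneg: "\<sigma> \<ge> 0"
    and dim: "\<And>n. n \<le> d n"
    and Sigma_psd: "\<And>n. psd (d n) (\<Sigma> n)"
    and factor: "\<And>n i j. i < d n \<Longrightarrow> j < d n \<Longrightarrow> \<Sigma> n i j = (\<Sum>k<d n. B n i k * B n j k)"
    and split: "\<And>n. cov_split (d n) (\<Sigma> n) (\<Sigma>1 n) (\<Sigma>2 n)"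
    and diag2: "\<And>n. is_diag (d n) (\<Sigma>2 n)"
    and nonzero2: "\<And>n. \<not> is_zero_mat (d n) (\<Sigma>2 n)"
    and cond1: "(\<lambda>n. real (mrank (d n) (\<Sigma>1 n)) / real n) \<longlonglongrightarrow> 0"
    and cond2: "(\<lambda>n. real n / r1_diag (d n) (\<Sigma>2 n)) \<longlonglongrightarrow> 0"
    and cond3: "(\<lambda>n. l1norm (d n) (wstar n) * diag_gauss_sup (d n) (\<Sigma>2 n) / sqrt (real n))
                  \<longlonglongrightarrow> 0"
    and what_min: "\<And>n \<omega>. \<omega> \<in> space (sample_space n (d n)) \<Longrightarrow>
        min_l1_interpolators n (d n) (design (d n) (B n) (fst \<omega>)) (response (d n) \<sigma> (B n) (wstar n) \<omega>) \<noteq> {} \<Longrightarrow>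
        what n \<omega> \<in> min_l1_interpolators n (d n) (design (d n) (B n) (fst \<omega>))
                     (response (d n) \<sigma> (B n) (wstar n) \<omega>)"
    and what_meas: "\<And>n. (\<lambda>\<omega>. risk (d n) \<sigma> (\<Sigma> n) (wstar n) (what n \<omega>))
                        \<in> borel_measurable (sample_space n (d n))"
  shows "\<forall>\<epsilon>>0. (\<lambda>n. measure (sample_space n (d n))
            {\<omega> \<in> space (sample_space n (d n)).
               \<bar>risk (d n) \<sigma> (\<Sigma> n) (wstar n) (what n \<omega>) - \<sigma>\<^sup>2\<bar> > \<epsilon>}) \<longlonglongrightarrow> 0"
proof (intro allI impI)
  fix \<epsilon> :: real assume \<epsilon>: "\<epsilon> > 0"
  \<comment> \<open>\<open>h\<close> is fixed from \<open>\<epsilon>\<close> before \<open>n\<close>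
    grows, so constants that depend on it stay fixed in the limit.\<close>
  have "\<forall>\<^sub>F h in at_right 0. risk_slack \<sigma> h < \<epsilon>"
    by (rule order_tendstoD(2)[OF risk_slack_tendsto \<epsilon>])
  moreover have "\<forall>\<^sub>F h in at_right (0::real). 0 < h \<and> h < 1/4"
    by (auto simp: eventually_at_right_field intro!: exI[of _ "1/4"])
  ultimately have "\<forall>\<^sub>F h in at_right 0. risk_slack \<sigma> h < \<epsilon> \<and> 0 < h \<and> h < 1/4"
    by eventually_elim simp
  then obtain h where h: "risk_slack \<sigma> h < \<epsilon>" "0 < h" "h < 1/4"
    using eventually_happens'[OF trivial_limit_at_right_real] by blast
  have h': "h \<le> 1/4" and h\<epsilon>: "risk_slack \<sigma> h \<le> \<epsilon>" using h by simp_all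
  obtain K1 K2 :: nat and c C :: real where K: "K1 \<ge> 1" "K2 \<ge> 1" and c: "c > 0" and C: "C > 0"
    and tail: "\<And>n d S S1 S2 B wstar \<sigma> what L \<epsilon>. n > 0 \<Longrightarrow> \<sigma> \<ge> 0 \<Longrightarrow>
      (\<And>i j. i < d \<Longrightarrow> j < d \<Longrightarrow> S i j = inner_on {..<d} (B i) (B j)) \<Longrightarrow>
      cov_split d S S1 S2 \<Longrightarrow> is_diag d S2 \<Longrightarrow> (\<And>j. j < d \<Longrightarrow> S2 j j \<le> L) \<Longrightarrow> L > 0 \<Longrightarrow>
      L \<le> c * (diag_gauss_sup d S2)\<^sup>2 \<Longrightarrow> diag_gauss_sup d S2 * l1norm d wstar \<le> h * sqrt n \<Longrightarrow>
      sqrt (real n * L) \<le> h * diag_gauss_sup d S2 \<Longrightarrow> risk_slack \<sigma> h \<le> \<epsilon> \<Longrightarrow>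
      (\<And>\<omega>. \<omega> \<in> space (sample_space n d) \<Longrightarrow>
        min_l1_interpolators n d (design d B (fst \<omega>)) (response d \<sigma> B wstar \<omega>) \<noteq> {} \<Longrightarrow>
        what \<omega> \<in> min_l1_interpolators n d (design d B (fst \<omega>)) (response d \<sigma> B wstar \<omega>)) \<Longrightarrow>
      measure (sample_space n d) {\<omega> \<in> space (sample_space n d). \<bar>risk d \<sigma> S wstar (what \<omega>) - \<sigma>\<^sup>2\<bar> > \<epsilon>}
        \<le> C * real (K1 ^ n) * exp (- c * (diag_gauss_sup d S2)\<^sup>2 / L)
          + real (K2 ^ mrank d S1) * (2 * (9/10) ^ n) + (9/10) ^ n + real (mrank d S1) / (h\<^sup>2 * real n)"
    by (rule risk_tail_bound[OF h(2) h']) blast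
  define E where "E n = diag_gauss_sup (d n) (\<Sigma>2 n)" for n
  define L where "L n = Max ((\<lambda>i. \<Sigma>2 n i i) ` {..<d n})" for n
  define p where "p n = measure (sample_space n (d n)) {\<omega> \<in> space (sample_space n (d n)).
      \<bar>risk (d n) \<sigma> (\<Sigma> n) (wstar n) (what n \<omega>) - \<sigma>\<^sup>2\<bar> > \<epsilon>}" for n
  define m where "m n = mrank (d n) (\<Sigma>1 n)" for n
  have S: "\<Sigma> n i j = inner_on {..<d n} (B n i) (B n j)" if "i < d n" "j < d n" for n i j
    using factor[OF that] by (simp add: inner_on_def)
  have SL: "\<Sigma>2 n j j \<le> L n" if "j < d n" for n j
    unfolding L_def by (rule Max_ge) (use that in auto)
  have S0: "0 \<le> \<Sigma>2 n j j" if "j < d n" for n j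
    using split[of n] psd_diag_nonneg[OF _ that] by (simp add: cov_split_def)
  have pos: "\<exists>j<d n. \<Sigma>2 n j j > 0" for n
  proof -
    obtain i j where ij: "i < d n" "j < d n" "\<Sigma>2 n i j \<noteq> 0" using nonzero2[of n] by (auto simp: is_zero_mat_def)
    then have "i = j" using diag2[of n] by (auto simp: is_diag_def)
    then show ?thesis using ij S0[of i n] by (intro exI[of _ i]) auto
  qed
  have L: "L n > 0" for n using pos[of n] SL[of _ n] by (auto intro: less_le_trans)
  have E: "E n > 0" for n
  proof -
    obtain j where "j < d n" "\<Sigma>2 n j j > 0" using pos by blast
    then show ?thesis unfolding E_def
      by (intro diag_gauss_sup_pos[where d="d n" and A="\<Sigma>2 n" and L="L n"]) (use S0 SL L in auto)
  qed
  \<comment> \<open>The three entries serve, in order, the smallness of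
    \<open>sqrt (n * L n)\<close> relative to \<open>E n\<close>, the effective rank threshold of
    the Dvoretzky estimate, and the domination of the net size \<open>K1 ^ n\<close>. Using
    \<open>ln K1 + 1\<close> keeps the denominator positive when \<open>K1 = 1\<close>.\<close>
  define \<kappa> where "\<kappa> = min (min (h\<^sup>2) c) (c / (ln K1 + 1))"
  have lnK: "ln K1 + 1 > 0" "ln K2 + 1 > 0" using K by (simp_all add: add_nonneg_pos)
  have \<kappa>: "\<kappa> > 0" using h(2) c lnK by (simp add: \<kappa>_def)
  \<comment> \<open>A rank below \<open>\<mu> * n\<close> is exactly what the second bound of
    \<open>geometric_decay_bounds\<close> asks for.\<close>
  define \<mu> where "\<mu> = - ln (9/10) / 2 / (ln K2 + 1)"
  have \<mu>: "\<mu> > 0" unfolding \<mu>_def using lnK by (intro divide_pos_pos) auto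
  define u where "u n = C * exp (-1) ^ n + 2 * sqrt (9/10) ^ n + (9/10) ^ n + m n / n / h\<^sup>2" for n :: nat
  have "\<forall>\<^sub>F n in sequentially. n / r1_diag (d n) (\<Sigma>2 n) < \<kappa>"
    by (rule order_tendstoD(2)[OF cond2 \<kappa>])
  moreover have "\<forall>\<^sub>F n in sequentially. m n / n < \<mu>"
    unfolding m_def by (rule order_tendstoD(2)[OF cond1 \<mu>])
  moreover have "\<forall>\<^sub>F n in sequentially. l1norm (d n) (wstar n) * E n / sqrt n < h"
    unfolding E_def by (rule order_tendstoD(2)[OF cond3 h(2)])
  moreover have "\<forall>\<^sub>F n in sequentially. n > (0::nat)" by (rule eventually_gt_at_top)
  ultimately have le: "\<forall>\<^sub>F n in sequentially. p n \<le> u n"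
  proof eventually_elim
    case (elim n)
    have n: "n > 0" by (rule elim(4))
    \<comment> \<open>The effective rank of \<open>\<Sigma>2 n\<close> is
      \<open>(E n)\<^sup>2 / L n\<close>, so condition (2) becomes an upper bound on
      \<open>n * L n\<close>.\<close>
    have "n / ((E n)\<^sup>2 / L n) < \<kappa>" using elim(1) by (simp add: r1_diag_def E_def L_def)
    then have nR: "n * L n < \<kappa> * (E n)\<^sup>2" using E[of n] by (simp add: field_simps)
    have \<kappa>': "\<kappa> * (E n)\<^sup>2 \<le> h\<^sup>2 * (E n)\<^sup>2" "\<kappa> * (E n)\<^sup>2 \<le> c * (E n)\<^sup>2" "\<kappa> * (E n)\<^sup>2 \<le> c / (ln K1 + 1) * (E n)\<^sup>2"
      by (intro mult_right_mono; simp add: \<kappa>_def)+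
    have "1 * L n \<le> n * L n" using n L[of n] by (intro mult_right_mono) auto
    then have big: "L n \<le> c * (E n)\<^sup>2" using nR \<kappa>'(2) by linarith
    have "sqrt (n * L n) \<le> sqrt ((h * E n)\<^sup>2)"
      using nR \<kappa>'(1) by (intro real_sqrt_le_mono) (simp add: power_mult_distrib)
    then have eff: "sqrt (n * L n) \<le> h * E n" using h(2) E[of n] by simp
    have signal: "E n * l1norm (d n) (wstar n) \<le> h * sqrt n"
      using elim(3) n by (simp add: field_simps)
    have "p n \<le> C * real (K1 ^ n) * exp (- c * (E n)\<^sup>2 / L n)
          + real (K2 ^ m n) * (2 * (9/10) ^ n) + (9/10) ^ n + real (m n) / (h\<^sup>2 * real n)"
      unfolding p_def E_def m_def
      by (rule tail[OF n sigma_nonneg S split diag2 SL L big[unfolded E_def] signal[unfolded E_def] eff[unfolded E_def] h\<epsilon> what_min])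
    also have "\<dots> = C * (real (K1 ^ n) * exp (- (c * (E n)\<^sup>2 / L n))) + 2 * (real (K2 ^ m n) * (9/10) ^ n)
        + (9/10) ^ n + m n / n / h\<^sup>2" by simp
    also have "\<dots> \<le> C * exp (-1) ^ n + 2 * sqrt (9/10) ^ n + (9/10) ^ n + m n / n / h\<^sup>2"
    proof (intro add_mono order_refl mult_left_mono geometric_decay_bounds K)
      have "n * L n \<le> c / (ln K1 + 1) * (E n)\<^sup>2" using nR \<kappa>'(3) by linarith
      then show "(ln K1 + 1) * n \<le> c * (E n)\<^sup>2 / L n" using lnK L[of n] by (simp add: field_simps)
      have "m n \<le> \<mu> * n" using elim(2) n by (simp add: field_simps)
      then show "(ln K2 + 1) * m n \<le> - ln (9/10) / 2 * n" using lnK unfolding \<mu>_def by (simp add: field_simps)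
    qed (use C in auto)
    finally show ?case by (simp add: u_def)
  qed
  have "u \<longlonglongrightarrow> C * 0 + 2 * 0 + 0 + 0 / h\<^sup>2"
    unfolding u_def m_def
  proof (intro tendsto_intros cond1 LIMSEQ_power_zero)
    show "norm (exp (- 1) :: real) < 1" by simp
    show "norm (sqrt (9/10) :: real) < 1" by simp
  qed (use h(2) in auto)
  then have u0: "u \<longlonglongrightarrow> 0" by simp
  have "p \<longlonglongrightarrow> 0"
    by (rule tendsto_sandwich[OF _ le tendsto_const u0]) (simp add: p_def)
  then show "(\<lambda>n. measure (sample_space n (d n)) {\<omega> \<in> space (sample_space n (d n)).
      \<bar>risk (d n) \<sigma> (\<Sigma> n) (wstar n) (what n \<omega>) - \<sigma>\<^sup>2\<bar> > \<epsilon>}) \<longlonglongrightarrow> 0"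
    unfolding p_def .
qed

end
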